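(* Let $m\neq\pm1$ be a square-free integer, $p$ a prime with $p\nmid m$, and $k$ a positive integer. Let $f(X)=X^{p^k}-m$, $\alpha$ a root of $f$, and $s:=v_p(m^p-m)-1$. (i) If $s\leq k$, then $\operatorname{ind}_p(\alpha)=\dfrac{p^k-p^{k-s}}{p-1}$. (ii) If $k<s$, then $\operatorname{ind}_p(\alpha)=\dfrac{p^k-1}{p-1}$.
   Context: For an algebraic integer $\alpha$ generating a number field $K=\mathbb{Q}(\alpha)$ with ring of integers $\mathcal{O}_K$, the index is $\operatorname{ind}(\alpha)=(\mathcal{O}_K^+:\mathbb{Z}[\alpha]^+)$ (index of additive groups), and the $p$-index is $\operatorname{ind}_p(\alpha)=v_p(\operatorname{ind}(\alpha))$, where $v_p$ is the $p$-adic valuation. *)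

theory Defs
  imports "HOL-Computational_Algebra.Computational_Algebra"
begin

definition alg_int :: "complex \<Rightarrow> bool" where
  "alg_int x \<longleftrightarrow> (\<exists>q :: int poly. lead_coeff q = 1 \<and> poly (map_poly of_int q) x = 0)"

definition num_field :: "complex \<Rightarrow> complex set" where
  "num_field \<alpha> = {poly (map_poly of_rat q) \<alpha> | q :: rat poly. True}"

definition ring_of_ints :: "complex \<Rightarrow> complex set" where
  "ring_of_ints \<alpha> = {x \<in> num_field \<alpha>. alg_int x}"

definition Zadj :: "complex \<Rightarrow> complex set" where
  "Zadj \<alpha> = {poly (map_poly of_int q) \<alpha> | q :: int poly. True}"

definition ind :: "complex \<Rightarrow> nat" where
  "ind \<alpha> = card ((\<lambda>x. (\<lambda>y. x + y) ` Zadj \<alpha>) ` ring_of_ints \<alpha>)"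

definition ind_p :: "nat \<Rightarrow> complex \<Rightarrow> nat" where
  "ind_p p \<alpha> = multiplicity p (ind \<alpha>)"

end

theory Submission
  imports Defs
begin

text \<open>
  Write \<open>n = p ^ k\<close>, \<open>t = min s k\<close>, and note that \<open>m ^ n - m\<close> has \<open>p\<close>-adic valuation \<open>s + 1\<close>, so that
  the Newton polygon of \<open>X ^ n - m\<close> at \<open>X = m\<close> is governed by \<open>s\<close> and \<open>k\<close>. For \<open>h \<le> t\<close> the elements
  \<open>E h = (\<alpha> ^ n - m ^ n) / (p ^ h * (\<alpha> ^ q - m ^ q))\<close>, \<open>q = p ^ (k - h)\<close>, are integral, and
  adjoining them one after the other to \<open>\<int>[\<alpha>]\<close> yields a module \<open>M\<close> in which \<open>\<int>[\<alpha>]\<close> has index \<open>p\<close> to the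
  power \<open>p ^ (k - 1) + \<dots> + p ^ (k - t)\<close>.

  It remains to see that an integer \<open>z\<close> of the field with \<open>p * z \<in> M\<close> lies in \<open>M\<close>. All conjugates of
  \<open>z\<close> are integral, hence belong to a valuation ring of \<open>\<complex>\<close> above \<open>p\<close>. Modulo \<open>p\<close>, \<open>M\<close> is spanned
  by \<open>E h * (\<alpha> - m) ^ i\<close> with \<open>i < D h\<close>, and multiplication by a power of \<open>\<alpha> - m\<close> reduces to \<open>i = D h - 1\<close>.
  Let \<open>a\<close> be a root closest to \<open>m\<close>; then \<open>E h\<close> is a unit at \<open>a\<close>, and evaluating at \<open>a * \<zeta>\<close> for \<open>\<zeta>\<close>
  of order \<open>p ^ (k - h)\<close>, where \<open>(a * \<zeta> - m) ^ D h\<close> has the valuation of \<open>p\<close>, isolates the \<open>h\<close>-th coefficient.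
\<close>

section \<open>Valuation rings\<close>

text \<open>Both cases of the formula are one geometric sum, p^(k-1) + ... + p^(k-t) = (p^k -
  p^(k-t)) / (p - 1). Expansion in powers of \<alpha> - m is natural because X^n - m is (X - m)^n
  modulo p, by Frobenius and Fermat. The numbers \<open>D h\<close> arise since p times
  \<open>E (h + 1)\<close> is \<open>E h\<close> times a polynomial congruent to (X - m)^(D h)
  modulo p; hence higher powers die modulo p M, while D 0 + ... + D t telescopes to n, as many
  elements as a basis needs.

  Valuation rings of the whole complex field, obtained from Zorn's lemma, replace prime ideals: all
  roots and all roots of unity can be compared in one of them. Conjugation needs X^n - m
  irreducible; this comes from Eisenstein at a prime l dividing the squarefree m exactly once, and
  lets integer relations pass between complex roots. Only p has to be examined, since n m
  annihilates the ring of integers modulo \<int>[\<alpha>] and p does not divide m.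

  The obstacle is p = 2, where D (t - 1) = D t: the last two coefficients enter with equal weight
  and one evaluation cannot separate them.\<close>

lemma poly_altdef_le:
  fixes x :: "'a::comm_semiring_1"
  assumes "degree q \<le> N"
  shows "poly q x = (\<Sum>i\<le>N. coeff q i * x ^ i)"
  unfolding poly_altdef using assms
  by (intro sum.mono_neutral_left) (auto simp: coeff_eq_0)

locale subring_set =
  fixes R :: "'a::field set"
  assumes one: "1 \<in> R"
    and diff: "x \<in> R \<Longrightarrow> y \<in> R \<Longrightarrow> x - y \<in> R"
    and mult: "x \<in> R \<Longrightarrow> y \<in> R \<Longrightarrow> x * y \<in> R"
begin

lemma zero: "0 \<in> R"
  using diff[OF one one] by simp

lemma uminus: "x \<in> R \<Longrightarrow> - x \<in> R"
  using diff[OF zero] by simp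

lemma add: "x \<in> R \<Longrightarrow> y \<in> R \<Longrightarrow> x + y \<in> R"
  using diff[OF _ uminus] by fastforce

lemma power: "x \<in> R \<Longrightarrow> x ^ i \<in> R"
  by (induction i) (auto intro: one mult)

lemma of_nat: "of_nat i \<in> R"
  by (induction i) (auto intro: zero one add)

lemma of_int: "of_int i \<in> R"
  by (cases i) (auto intro: of_nat uminus diff one)

lemma numeral: "numeral i \<in> R"
  using of_nat[of "numeral i"] by simp

lemma sum: "(\<And>i. i \<in> A \<Longrightarrow> f i \<in> R) \<Longrightarrow> sum f A \<in> R"
  by (induction A rule: infinite_finite_induct) (auto intro: zero add)

lemma prod: "(\<And>i. i \<in> A \<Longrightarrow> f i \<in> R) \<Longrightarrow> prod f A \<in> R"
  by (induction A rule: infinite_finite_induct) (auto intro: one mult)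

lemma poly: "(\<And>i. coeff q i \<in> R) \<Longrightarrow> x \<in> R \<Longrightarrow> poly q x \<in> R"
  unfolding poly_altdef by (intro sum mult power)

lemma poly_of_int: "x \<in> R \<Longrightarrow> poly (map_poly of_int q) x \<in> R"
  by (rule poly) (auto simp: coeff_map_poly of_int)

lemmas closed = zero one diff mult uminus add power of_nat of_int numeral sum prod

lemma adjoin: "subring_set {poly q x | q. \<forall>i. coeff q i \<in> R}" (is "subring_set ?A")
proof
  show "1 \<in> ?A"
    by (rule CollectI, rule exI[of _ 1]) (auto simp: coeff_1 intro: closed)
  fix u v assume "u \<in> ?A" "v \<in> ?A"
  then obtain q r where q: "u = poly q x" "\<forall>i. coeff q i \<in> R" and r: "v = poly r x" "\<forall>i. coeff r i \<in> R"
    by blast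
  show "u - v \<in> ?A"
    by (rule CollectI, rule exI[of _ "q - r"]) (use q r in \<open>auto intro: closed\<close>)
  show "u * v \<in> ?A"
    by (rule CollectI, rule exI[of _ "q * r"]) (use q r in \<open>auto simp: coeff_mult intro: closed\<close>)
qed

lemma subset_adjoin: "R \<subseteq> {poly q x | q. \<forall>i. coeff q i \<in> R}"
proof
  fix u assume "u \<in> R"
  then show "u \<in> {poly q x | q. \<forall>i. coeff q i \<in> R}"
    by (intro CollectI exI[of _ "[:u:]"]) (auto simp: coeff_pCons zero split: nat.split)
qed

lemma mem_adjoin: "x \<in> {poly q x | q. \<forall>i. coeff q i \<in> R}"
  by (intro CollectI exI[of _ "[:0, 1:]"]) (auto simp: coeff_pCons closed split: nat.split)

end

locale valuation_ring = subring_set V for V :: "'a::field set" +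
  assumes total: "x \<in> V \<or> inverse x \<in> V"

text \<open>A subring that is maximal among those omitting \<open>inverse y\<close> turns out to be
  a valuation ring (Chevalley's argument), with \<open>y\<close> of positive valuation.\<close>

locale maximal_subring = subring_set R for R :: "'a::field set" +
  fixes y :: 'a
  assumes y: "y \<in> R" and inv_y: "inverse y \<notin> R"
    and maximal: "subring_set S \<Longrightarrow> R \<subseteq> S \<Longrightarrow> inverse y \<notin> S \<Longrightarrow> S = R"
begin

lemma y_nonzero: "y \<noteq> 0"
  using inv_y zero by auto

definition I where "I = (*) y ` R"

lemma I_subset: "I \<subseteq> R"
  by (auto simp: I_def intro: mult y)

lemma one_notin_I: "1 \<notin> I"
proof
  assume "1 \<in> I"
  then obtain r where "r \<in> R" "1 = y * r" by (auto simp: I_def)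
  then show False using inv_y by (metis inverse_unique)
qed

lemma I_zero: "0 \<in> I" by (auto simp: I_def intro: image_eqI[of _ _ 0] zero)

lemma I_add: "u \<in> I \<Longrightarrow> v \<in> I \<Longrightarrow> u + v \<in> I"
  by (auto simp: I_def add simp flip: distrib_left)

lemma I_mult: "u \<in> I \<Longrightarrow> r \<in> R \<Longrightarrow> u * r \<in> I"
  by (auto simp: I_def mult mult.assoc)

text \<open>Maximality forces \<open>inverse y\<close> into \<open>R[x]\<close>; multiplying that
  expression by \<open>y\<close> makes all coefficients multiples of \<open>y\<close>.\<close>

lemma adjoin_obtains:
  assumes "x \<notin> R"
  obtains q where "\<And>i. coeff q i \<in> I" "poly q x = 1"
proof -
  let ?S = "{poly q x | q. \<forall>i. coeff q i \<in> R}"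
  have "inverse y \<in> ?S"
    using maximal[OF adjoin subset_adjoin, of x] mem_adjoin[of x] assms by blast
  then obtain q where q: "inverse y = poly q x" "\<forall>i. coeff q i \<in> R" by blast
  show ?thesis
    by (rule that[of "smult y q"]) (use q y_nonzero in \<open>auto simp: I_def simp flip: q(1)\<close>)
qed

text \<open>Otherwise a relation for \<open>inverse (1 - u)\<close>, cleared of denominators, puts a
  power of \<open>1 - u\<close> into \<open>I\<close>; but such powers are 1 modulo
  \<open>I\<close>. This allows dividing by one minus the constant coefficient of a
  relation.\<close>

lemma inverse_one_minus:
  assumes "u \<in> I"
  shows "inverse (1 - u) \<in> R"
proof (rule ccontr)
  assume "inverse (1 - u) \<notin> R"
  then obtain q where q: "\<And>i. coeff q i \<in> I" "poly q (inverse (1 - u)) = 1"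
    using adjoin_obtains by blast
  have "1 - u \<noteq> 0" using assms one_notin_I by auto
  let ?d = "degree q"
  have eq: "(1 - u) ^ ?d = (\<Sum>i\<le>?d. coeff q i * (1 - u) ^ (?d - i))"
  proof -
    have "(1 - u) ^ ?d = (1 - u) ^ ?d * poly q (inverse (1 - u))" using q by simp
    also have "\<dots> = (\<Sum>i\<le>?d. coeff q i * (1 - u) ^ (?d - i))"
      unfolding poly_altdef sum_distrib_left using \<open>1 - u \<noteq> 0\<close>
      by (intro sum.cong) (auto simp: power_diff field_simps)
    finally show ?thesis .
  qed
  have sum_I: "sum f A \<in> I" if "\<And>i. i \<in> A \<Longrightarrow> f i \<in> I" for f and A :: "nat set"
    using that by (induction A rule: infinite_finite_induct) (auto intro: I_add I_zero)
  have pow: "(1 - u) ^ ?d \<in> I"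
  proof -
    have "(\<Sum>i\<le>?d. coeff q i * (1 - u) ^ (?d - i)) \<in> I"
      using assms I_subset by (intro sum_I I_mult[OF q(1)] power diff one) auto
    then show ?thesis using eq by simp
  qed
  moreover have "1 - (1 - u) ^ d \<in> I" for d :: nat
  proof (induction d)
    case (Suc d)
    have "1 - (1 - u) ^ Suc d = (1 - (1 - u) ^ d) + u * (1 - u) ^ d"
      by (simp add: algebra_simps)
    moreover have "(1 - u) ^ d \<in> R" using assms I_subset by (intro power diff one) auto
    ultimately show ?case using Suc assms by (simp only: I_add I_mult)
  qed (simp add: I_zero)
  ultimately have "1 \<in> I" using I_add[OF pow] by (metis add.commute diff_add_cancel)
  then show False using one_notin_I by simp
qed

text \<open>Two relations, in \<open>x\<close> and in its inverse, with coefficients in the ideal \<open>I\<close> can be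
  played off against each other to lower the longer one.\<close>

lemma no_two_relations:
  assumes "\<And>i. coeff q i \<in> I" "poly q x = 1" "\<And>i. coeff r i \<in> I" "poly r (inverse x) = 1"
    and "x \<noteq> 0"
  shows False
  using assms
proof (induction "degree q + degree r" arbitrary: q r x rule: less_induct)
  case less
  have *: False if le: "degree r \<le> degree q"
    and q: "\<And>i. coeff q i \<in> I" "poly q x = 1" and r: "\<And>i. coeff r i \<in> I" "poly r (inverse x) = 1"
    and x: "x \<noteq> 0"
    and IH: "\<And>q'. (\<And>i. coeff q' i \<in> I) \<Longrightarrow> poly q' x = 1 \<Longrightarrow> degree q' < degree q \<Longrightarrow> False" for q r x
  proof (cases "degree q = 0")
    case True
    then have "coeff q 0 = 1" using q(2) by (simp add: poly_altdef)
    then show False using q(1)[of 0] one_notin_I by simp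
  next
    case False
    let ?N = "degree q" let ?u = "1 - coeff r 0"
    define e where "e j = coeff r (?N - j) * inverse ?u" for j
    have u: "inverse ?u \<in> R" using r inverse_one_minus by blast
    have u0: "?u \<noteq> 0" using r(1)[of 0] one_notin_I by auto
    have "1 = (\<Sum>j\<le>?N. coeff r j * inverse x ^ j)"
      using r(2) poly_altdef_le[OF le] by metis
    also have "\<dots> = coeff r 0 + (\<Sum>j\<in>{1..?N}. coeff r j * inverse x ^ j)"
      by (subst sum.atMost_shift) (simp add: sum.atLeast1_atMost_eq)
    finally have u_eq: "?u = (\<Sum>j\<in>{1..?N}. coeff r j * inverse x ^ j)" by (simp add: algebra_simps)
    then have "?u * x ^ ?N = (\<Sum>j\<in>{1..?N}. coeff r j * x ^ (?N - j))"
      unfolding u_eq sum_distrib_right using x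
      by (intro sum.cong) (auto simp: power_diff field_simps)
    also have "\<dots> = (\<Sum>j<?N. coeff r (?N - j) * x ^ j)"
      by (rule sum.reindex_bij_witness[of _ "\<lambda>j. ?N - j" "\<lambda>j. ?N - j"]) auto
    finally have uxN: "?u * x ^ ?N = (\<Sum>j<?N. coeff r (?N - j) * x ^ j)" .
    have xN: "x ^ ?N = (\<Sum>j<?N. e j * x ^ j)"
    proof -
      have "x ^ ?N = inverse ?u * (?u * x ^ ?N)" using u0 by (simp flip: mult.assoc)
      then show ?thesis
        unfolding uxN by (simp add: e_def sum_distrib_left mult_ac)
    qed
    \<comment> \<open>The relation in \<open>inverse x\<close>, solved for \<open>x ^ ?N\<close>,
      replaces the leading power in \<open>q\<close>: same value, coefficients still in
      \<open>I\<close>, smaller degree.\<close>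
    define q' where "q' = (\<Sum>j<?N. monom (coeff q j + coeff q ?N * e j) j)"
    have co: "coeff q' j = (if j < ?N then coeff q j + coeff q ?N * e j else 0)" for j
      by (simp add: q'_def coeff_sum)
    have "poly q' x = (\<Sum>j<?N. coeff q j * x ^ j) + coeff q ?N * x ^ ?N"
      unfolding xN q'_def
      by (simp add: poly_sum poly_monom distrib_right sum.distrib sum_distrib_left mult.assoc)
    also have "\<dots> = poly q x"
      unfolding poly_altdef lessThan_Suc_atMost[symmetric] by simp
    finally have "poly q' x = 1" using q by simp
    moreover have "coeff q' j \<in> I" for j
    proof -
      have "e j \<in> R" unfolding e_def using r(1)[of "?N - j"] u I_subset by (intro mult) auto
      then show ?thesis unfolding co using q(1) I_zero by (simp add: I_add I_mult)
    qed
    moreover have "degree q' < ?N"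
      using False by (intro degree_lessI) (auto simp: co)
    ultimately show False using IH by blast
  qed
  show ?case
  proof (cases "degree r \<le> degree q")
    case True
    show False
    proof (rule *[OF True less.prems])
      fix q' :: "'a poly"
      assume "\<And>i. coeff q' i \<in> I" "poly q' x = 1" "degree q' < degree q"
      then show False using less.hyps[of q' r x] less.prems by simp
    qed
  next
    case False
    show False
    proof (rule *[of q r "inverse x"])
      fix q' :: "'a poly"
      assume "\<And>i. coeff q' i \<in> I" "poly q' (inverse x) = 1" "degree q' < degree r"
      then show False using less.hyps[of q q' x] less.prems by simp
    qed (use less.prems False in auto)
  qed
qed

sublocale valuation_ring R
proof
  fix x
  show "x \<in> R \<or> inverse x \<in> R"
  proof (rule ccontr)
    assume "\<not> (x \<in> R \<or> inverse x \<in> R)"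
    then have "x \<notin> R" "inverse x \<notin> R" "x \<noteq> 0" using zero by auto
    then show False
      using adjoin_obtains[of x] adjoin_obtains[of "inverse x"] no_two_relations by metis
  qed
qed

end

text \<open>Zorn's lemma on the subrings above \<open>B\<close> that omit \<open>inverse y\<close>.
  It serves twice: with \<open>B = Z[1/x]\<close> for non-integral \<open>x\<close>, and with the
  integers for \<open>B\<close> and \<open>p\<close> for \<open>y\<close>.\<close>

theorem exists_valuation_ring:
  fixes B :: "'a::field set"
  assumes "subring_set B" "y \<in> B" "inverse y \<notin> B"
  obtains V where "valuation_ring V" "B \<subseteq> V" "y \<in> V" "inverse y \<notin> V"
proof -
  let ?\<A> = "{S. subring_set S \<and> B \<subseteq> S \<and> inverse y \<notin> S}"
  have "\<exists>M\<in>?\<A>. \<forall>X\<in>?\<A>. M \<subseteq> X \<longrightarrow> X = M"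
  proof (rule subset_Zorn_nonempty)
    show "?\<A> \<noteq> {}" using assms by auto
    fix C assume C: "C \<noteq> {}" "subset.chain ?\<A> C"
    then have sub: "\<And>S. S \<in> C \<Longrightarrow> subring_set S \<and> B \<subseteq> S \<and> inverse y \<notin> S"
      by (auto simp: subset.chain_def)
    have common: "\<exists>S\<in>C. u \<in> S \<and> v \<in> S"
      if "S \<in> C" "T \<in> C" "u \<in> S" "v \<in> T" for S T u v
    proof -
      have "S \<subseteq> T \<or> T \<subseteq> S" using C that by (simp add: subset_chain_def)
      then show ?thesis using that by blast
    qed
    have "subring_set (\<Union>C)"
    proof
      show "1 \<in> \<Union>C" using C sub by (auto dest: subring_set.one)
      fix u v assume "u \<in> \<Union>C" "v \<in> \<Union>C"
      then obtain S where "S \<in> C" "u \<in> S" "v \<in> S" using common by (meson UnionE)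
      then show "u - v \<in> \<Union>C" "u * v \<in> \<Union>C"
        using sub by (auto intro: subring_set.diff subring_set.mult)
    qed
    then show "\<Union>C \<in> ?\<A>" using C sub by auto
  qed
  then obtain M where M: "M \<in> ?\<A>" and max: "\<forall>X\<in>?\<A>. M \<subseteq> X \<longrightarrow> X = M" ..
  interpret maximal_subring M y
  proof (intro maximal_subring.intro maximal_subring_axioms.intro)
    fix S assume "subring_set S" "M \<subseteq> S" "inverse y \<notin> S"
    then show "S = M" using M max by blast
  qed (use M assms in auto)
  show ?thesis using that M y inv_y valuation_ring_axioms by simp
qed

section \<open>Integer polynomials and algebraic integers\<close>

abbreviation ipoly :: "int poly \<Rightarrow> 'a::comm_ring_1 \<Rightarrow> 'a" where
  "ipoly q x \<equiv> poly (map_poly of_int q) x"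

lemma ipoly_add:
  fixes x :: "'a::comm_ring_1"
  shows "ipoly (q + r) x = ipoly q x + ipoly r x"
proof -
  have "map_poly of_int (q + r) = (map_poly of_int q + map_poly of_int r :: 'a poly)"
    by (simp add: poly_eq_iff coeff_map_poly)
  then show ?thesis by simp
qed

lemma ipoly_smult: "ipoly (smult a q) x = of_int a * ipoly q x"
  by (simp add: map_poly_smult)

lemma ipoly_mult: "ipoly (q * r) x = ipoly q x * ipoly r x"
  by (induction q) (simp_all add: map_poly_pCons ipoly_add ipoly_smult algebra_simps)

lemma ipoly_of_nat_mult: "ipoly (of_nat i * q) x = of_nat i * ipoly q x"
  by (simp add: of_nat_poly ipoly_smult)

lemma ipoly_diff: "ipoly (q - r) x = ipoly q x - ipoly r x"
  using ipoly_add[of "q - r" r x] by simp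

lemma ipoly_power: "ipoly (q ^ i) x = ipoly q x ^ i"
  by (induction i) (simp_all add: ipoly_mult)

lemma ipoly_sum: "ipoly (sum f A) x = (\<Sum>i\<in>A. ipoly (f i) x)"
  by (induction A rule: infinite_finite_induct) (simp_all add: ipoly_add)

lemma ipoly_monom: "ipoly (monom a i) x = of_int a * x ^ i"
  by (simp add: map_poly_monom poly_monom)

lemma ipoly_altdef: "ipoly q x = (\<Sum>i\<le>degree q. of_int (coeff q i) * x ^ i)"
proof -
  have "ipoly q x = ipoly (\<Sum>i\<le>degree q. monom (coeff q i) i) x"
    by (simp only: poly_as_sum_of_monoms)
  then show ?thesis by (simp only: ipoly_sum ipoly_monom)
qed

lemma ipoly_altdef_le:
  "degree q \<le> N \<Longrightarrow> ipoly q x = (\<Sum>i\<le>N. of_int (coeff q i) * x ^ i)"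
  unfolding ipoly_altdef by (intro sum.mono_neutral_left) (auto simp: coeff_eq_0)

lemma ipoly_altdef_less:
  assumes "degree q < N"
  shows "ipoly q x = (\<Sum>i<N. of_int (coeff q i) * x ^ i)"
proof -
  have "ipoly q x = (\<Sum>i\<le>N - 1. of_int (coeff q i) * x ^ i)"
    using assms by (intro ipoly_altdef_le) auto
  also have "{..N - 1} = {..<N}" using assms by auto
  finally show ?thesis .
qed

lemmas ipoly_simps = ipoly_add ipoly_diff ipoly_mult ipoly_power ipoly_smult ipoly_sum ipoly_monom
  map_poly_pCons

lemma alg_int_iff: "alg_int x \<longleftrightarrow> algebraic_int x"
  unfolding alg_int_def algebraic_int_altdef_ipoly by auto

text \<open>Valuation rings are integrally closed: if \<open>x\<close> is outside,
  \<open>inverse x\<close> is inside, and the equation divided by \<open>x ^ d\<close> writes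
  \<open>x\<close> as a polynomial in \<open>inverse x\<close>.\<close>

lemma (in valuation_ring) algebraic_int_mem:
  fixes x :: 'a
  assumes "poly q x = 0" "lead_coeff q = 1" "\<And>i. coeff q i \<in> V"
  shows "x \<in> V"
proof (rule ccontr)
  assume "x \<notin> V"
  then have inv: "inverse x \<in> V" and "x \<noteq> 0" using total zero by auto
  obtain d where d: "degree q = Suc d"
    using assms \<open>x \<notin> V\<close> by (cases "degree q") (auto simp: poly_altdef)
  have "(\<Sum>i\<le>d. coeff q i * x ^ i) + x ^ Suc d = 0"
    using assms(1,2) by (simp add: poly_altdef d del: power_Suc)
  then have "0 = inverse x ^ d * ((\<Sum>i\<le>d. coeff q i * x ^ i) + x ^ Suc d)" by simp
  also have "\<dots> = (\<Sum>i\<le>d. coeff q i * inverse x ^ (d - i)) + x"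
    unfolding distrib_left sum_distrib_left using \<open>x \<noteq> 0\<close>
    by (intro arg_cong2[where f = "(+)"] sum.cong) (auto simp: power_diff field_simps)
  finally have "x = - (\<Sum>i\<le>d. coeff q i * inverse x ^ (d - i))"
    by (simp add: eq_neg_iff_add_eq_0 add.commute)
  also have "\<dots> \<in> V" using inv assms(3) by (intro closed)
  finally show False using \<open>x \<notin> V\<close> by simp
qed

text \<open>For \<open>x\<close> not integral, \<open>x\<close> is not in \<open>Z[1/x]\<close>, so
  some valuation ring contains \<open>1/x\<close> but not \<open>x\<close>. Integrality can thus be
  tested one valuation at a time.\<close>

lemma alg_int_iff_valuation_rings:
  "alg_int x \<longleftrightarrow> (\<forall>V. valuation_ring V \<longrightarrow> x \<in> V)"
proof (intro iffI allI impI)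
  fix V :: "complex set"
  assume "alg_int x" and V: "valuation_ring V"
  then obtain q :: "int poly" where q: "lead_coeff q = 1" "ipoly q x = 0" unfolding alg_int_def by blast
  interpret valuation_ring V by (fact V)
  show "x \<in> V"
  proof (rule algebraic_int_mem)
    show "ipoly q x = 0" by fact
    have "degree (map_poly of_int q :: complex poly) = degree q"
      by (rule degree_map_poly) simp
    then show "lead_coeff (map_poly of_int q :: complex poly) = 1"
      using q by (simp add: coeff_map_poly)
  qed (simp add: coeff_map_poly of_int)
next
  assume *: "\<forall>V. valuation_ring V \<longrightarrow> x \<in> V"
  show "alg_int x"
  proof (rule ccontr)
    assume x: "\<not> alg_int x"
    interpret Z: subring_set "\<int> :: complex set" by unfold_locales auto
    let ?B = "{poly q (inverse x) | q. \<forall>i. coeff q i \<in> \<int>}"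
    have "x \<noteq> 0" using x by (auto simp: alg_int_iff)
    have "inverse (inverse x) \<notin> ?B"
    proof
      assume "inverse (inverse x) \<in> ?B"
      then obtain q where q: "\<forall>i. coeff q i \<in> \<int>" "x = poly q (inverse x)" by auto
      let ?d = "degree q"
      \<comment> \<open>\<open>x = q(1/x)\<close> multiplied by \<open>x ^ ?d\<close> becomes the
        monic equation \<open>r(x) = 0\<close>.\<close>
      define r where "r = monom 1 (Suc ?d) - (\<Sum>i\<le>?d. monom (coeff q i) (?d - i))"
      have "degree (\<Sum>i\<le>?d. monom (coeff q i) (?d - i)) \<le> ?d"
        by (intro degree_sum_le) (auto intro: order.trans[OF degree_monom_le])
      then have small: "degree (\<Sum>i\<le>?d. monom (coeff q i) (?d - i)) < Suc ?d" by simp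
      have deg: "degree r = Suc ?d"
        unfolding r_def diff_conv_add_uminus
        by (subst degree_add_eq_left) (use small in \<open>auto simp: degree_monom_eq\<close>)
      have "lead_coeff r = 1"
        unfolding deg using small coeff_eq_0[of _ "Suc ?d"] by (simp add: r_def)
      moreover have "\<forall>i. coeff r i \<in> \<int>"
        unfolding r_def using q by (auto simp: coeff_sum intro!: Ints_diff Z.sum)
      moreover have "poly r x = 0"
      proof -
        have "x ^ Suc ?d = x ^ ?d * poly q (inverse x)" using q(2) by simp
        also have "\<dots> = (\<Sum>i\<le>?d. coeff q i * x ^ (?d - i))"
          unfolding poly_altdef sum_distrib_left using \<open>x \<noteq> 0\<close>
          by (intro sum.cong) (auto simp: power_diff field_simps)
        finally show ?thesis by (simp add: r_def poly_monom poly_sum del: power_Suc)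
      qed
      ultimately have "algebraic_int x" by (auto intro: algebraic_int.intros)
      then show False using x by (simp add: alg_int_iff)
    qed
    then obtain V where "valuation_ring V" "inverse (inverse x) \<notin> V"
      using exists_valuation_ring[OF Z.adjoin[of "inverse x"], of "inverse x"] Z.mem_adjoin[of "inverse x"]
      by metis
    then show False using * by simp
  qed
qed

text \<open>Closure under the ring operations holds because the algebraic integers are an
  intersection of rings.\<close>

interpretation alg_int: subring_set "Collect alg_int"
proof
  fix x y assume *: "x \<in> Collect alg_int" "y \<in> Collect alg_int"
  have "x - y \<in> V" "x * y \<in> V" if "valuation_ring V" for V
  proof -
    interpret valuation_ring V by fact
    show "x - y \<in> V" "x * y \<in> V"
      using * that by (auto simp: alg_int_iff_valuation_rings intro: closed)
  qed
  then show "x - y \<in> Collect alg_int" "x * y \<in> Collect alg_int"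
    by (auto simp: alg_int_iff_valuation_rings)
qed (auto simp: alg_int_iff)

section \<open>Divisibility with respect to a valuation\<close>

context valuation_ring
begin

text \<open>In terms of the valuation \<open>v\<close> of \<open>V\<close>, the relation \<open>x \<preceq> y\<close> says \<open>v x \<le> v y\<close>.\<close>

definition vdvd :: "'a \<Rightarrow> 'a \<Rightarrow> bool" (infix "\<preceq>" 50) where
  "x \<preceq> y \<longleftrightarrow> (\<exists>v\<in>V. y = x * v)"

lemma vdvdI: "v \<in> V \<Longrightarrow> y = x * v \<Longrightarrow> x \<preceq> y"
  by (auto simp: vdvd_def)

lemma vdvd_refl [simp]: "x \<preceq> x"
  by (rule vdvdI[of 1]) (auto intro: one)

lemma vdvd_0 [simp]: "x \<preceq> 0"
  by (rule vdvdI[of 0]) (auto intro: zero)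

lemma zero_vdvd: "0 \<preceq> x \<longleftrightarrow> x = 0"
  by (auto simp: vdvd_def intro: zero)

lemma vdvd_trans [trans]: "x \<preceq> y \<Longrightarrow> y \<preceq> z \<Longrightarrow> x \<preceq> z"
  unfolding vdvd_def by (metis mult mult.assoc)

lemma vdvd_total: "x \<preceq> y \<or> y \<preceq> x"
proof (cases "x = 0 \<or> y = 0")
  case False
  then show ?thesis
    using total[of "x / y"] by (auto intro: vdvdI[of "x / y"] vdvdI[of "y / x"])
qed auto

lemma vdvd_add: "x \<preceq> y \<Longrightarrow> x \<preceq> z \<Longrightarrow> x \<preceq> y + z"
  unfolding vdvd_def by (metis add distrib_left)

lemma vdvd_diff: "x \<preceq> y \<Longrightarrow> x \<preceq> z \<Longrightarrow> x \<preceq> y - z"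
  unfolding vdvd_def by (metis diff right_diff_distrib)

lemma vdvd_add_cancel: "x \<preceq> y + z \<Longrightarrow> x \<preceq> z \<Longrightarrow> x \<preceq> y"
  using vdvd_diff[of x "y + z" z] by simp

lemma vdvd_minus_iff [simp]: "x \<preceq> - y \<longleftrightarrow> x \<preceq> y"
  using vdvd_diff[of x 0 y] vdvd_diff[of x 0 "- y"] by auto

lemma vdvd_sum: "(\<And>i. i \<in> A \<Longrightarrow> x \<preceq> f i) \<Longrightarrow> x \<preceq> sum f A"
  by (induction A rule: infinite_finite_induct) (auto intro: vdvd_add)

lemma vdvd_mult_right: "x \<preceq> y \<Longrightarrow> z \<in> V \<Longrightarrow> x \<preceq> y * z"
  unfolding vdvd_def by (metis mult mult.assoc)

lemma vdvd_mult_left: "x \<preceq> y \<Longrightarrow> z \<in> V \<Longrightarrow> x \<preceq> z * y"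
  using vdvd_mult_right by (simp add: mult.commute)

lemma vdvd_mult_mono: "x \<preceq> y \<Longrightarrow> x' \<preceq> y' \<Longrightarrow> x * x' \<preceq> y * y'"
  unfolding vdvd_def by (metis (no_types, opaque_lifting) mult mult.assoc mult.left_commute)

lemma vdvd_power: "x \<preceq> y \<Longrightarrow> x ^ i \<preceq> y ^ i"
  by (induction i) (auto intro: vdvd_mult_mono)

lemma vdvd_prod: "(\<And>i. i \<in> A \<Longrightarrow> f i \<preceq> g i) \<Longrightarrow> prod f A \<preceq> prod g A"
  by (induction A rule: infinite_finite_induct) (auto intro: vdvd_mult_mono)

lemma vdvd_mult_cancel: "z \<noteq> 0 \<Longrightarrow> z * x \<preceq> z * y \<longleftrightarrow> x \<preceq> y"
  by (auto simp: vdvd_def mult.assoc)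

lemma vdvd_one_mult: "x \<preceq> 1 \<Longrightarrow> y \<preceq> 1 \<Longrightarrow> x * y \<preceq> 1"
  using vdvd_mult_mono[of x 1 y 1] by simp

lemma vdvd_one_power: "x \<preceq> 1 \<Longrightarrow> x ^ i \<preceq> 1"
  using vdvd_power[of x 1 i] by simp

lemma vdvd_one_power_iff:
  assumes "x \<in> V" "i > 0"
  shows "x ^ i \<preceq> 1 \<longleftrightarrow> x \<preceq> 1"
proof
  obtain j where "i = Suc j" using \<open>i > 0\<close> gr0_implies_Suc by blast
  then have "x \<preceq> x ^ i" using assms by (intro vdvdI[of "x ^ j"]) (auto intro: power)
  then show "x ^ i \<preceq> 1 \<Longrightarrow> x \<preceq> 1" by (rule vdvd_trans)
qed (rule vdvd_one_power)

lemma vdvd_power_cancel: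
  assumes "x ^ i \<preceq> y ^ i" "i > 0"
  shows "x \<preceq> y"
proof (rule ccontr)
  assume *: "\<not> x \<preceq> y"
  then have "y \<preceq> x" using vdvd_total by blast
  then obtain v where v: "v \<in> V" "x = y * v" by (auto simp: vdvd_def)
  have "y \<noteq> 0" using * by auto
  then have "v ^ i \<preceq> 1"
    using assms(1) vdvd_mult_cancel[of "y ^ i" "v ^ i" 1] by (simp add: v power_mult_distrib)
  then have "v \<preceq> 1" using v assms(2) by (simp add: vdvd_one_power_iff)
  then have "y * v \<preceq> y * 1" by (rule vdvd_mult_mono[OF vdvd_refl])
  then show False using * v by simp
qed

text \<open>\<open>V\<close> is local: of two elements one divides the other, hence also their
  sum.\<close>

lemma nonunit_add:
  assumes "x \<in> V" "y \<in> V" "\<not> x \<preceq> 1" "\<not> y \<preceq> 1"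
  shows "\<not> x + y \<preceq> 1"
proof
  assume *: "x + y \<preceq> 1"
  have "x \<preceq> x + y \<or> y \<preceq> x + y" using vdvd_total[of x y] by (auto intro: vdvd_add)
  then show False using * assms vdvd_trans by blast
qed

lemma unit_add:
  assumes "x \<preceq> 1" "x \<in> V" "y \<in> V" "\<not> y \<preceq> 1"
  shows "x + y \<preceq> 1"
proof (rule ccontr)
  assume "\<not> x + y \<preceq> 1"
  moreover have "\<not> - y \<preceq> 1"
    using assms(4) vdvd_trans[of y "- y" 1] vdvd_minus_iff[of y y] vdvd_refl by blast
  moreover have "x + y \<in> V" "- y \<in> V" using assms by (auto intro: add uminus)
  ultimately have "\<not> (x + y) + - y \<preceq> 1" using nonunit_add by blast
  then show False using assms(1) by simp
qed

end

section \<open>Valuation rings in the complex numbers in which \<open>p\<close> is not a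
  unit\<close>

locale valuation_ring_above = valuation_ring V for V :: "complex set" +
  fixes p :: nat
  assumes prime_p: "prime p" and inv_p: "inverse (of_nat p) \<notin> V"
begin

abbreviation P :: complex where "P \<equiv> of_nat p"

lemma P_nonzero [simp]: "P \<noteq> 0"
  using prime_p by auto

lemma P_nonunit: "\<not> P \<preceq> 1"
  using inv_p by (auto simp: vdvd_def inverse_unique dest: inverse_unique)

lemma P_mem: "P \<in> V"
  by (rule of_nat)

lemma int_unit:
  assumes "\<not> int p dvd a"
  shows "(of_int a :: complex) \<preceq> 1"
proof (rule ccontr)
  assume *: "\<not> (of_int a :: complex) \<preceq> 1"
  have "coprime a (int p)" using assms prime_p
    by (simp add: prime_imp_coprime coprime_commute[of a])
  then obtain u v where "u * a + v * int p = 1"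
    using bezout_int[of a "int p"] by (auto simp: coprime_iff_gcd_eq_1)
  then have 1: "of_int a * of_int u + P * of_int v = (1 :: complex)"
    by (metis mult.commute of_int_1 of_int_add of_int_mult of_int_of_nat_eq)
  have "\<not> of_int a * of_int u \<preceq> (1 :: complex)" "\<not> P * of_int v \<preceq> 1"
    using * P_nonunit by (meson of_int vdvdI vdvd_trans)+
  then have "\<not> of_int a * of_int u + P * of_int v \<preceq> 1"
    by (intro nonunit_add) (auto intro: closed)
  then show False unfolding 1 by simp
qed

lemma int_dvd: "int p ^ i dvd a \<Longrightarrow> P ^ i \<preceq> of_int a"
  by (auto simp: dvd_def intro!: vdvdI of_int)

lemma nonunit_if_power:
  assumes "P \<preceq> x ^ i"
  shows "\<not> x \<preceq> 1"
  using assms P_nonunit vdvd_one_power vdvd_trans by blast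

text \<open>\<open>\<delta>\<close> has valuation \<open>v(p) / d\<close>, so
  \<open>\<delta> ^ (d - 1)\<close> falls short of \<open>p\<close>; as an integer not divisible by
  \<open>p\<close> is a unit, only a factor \<open>p\<close> of \<open>a\<close> can make up for
  it.\<close>

lemma dvd_if_vdvd_power_pred:
  assumes "\<delta> ^ d \<preceq> P" "P \<preceq> \<delta> ^ d" "d > 0" "e \<preceq> 1"
    and "P \<preceq> of_int a * e * \<delta> ^ (d - 1)"
  shows "int p dvd a"
proof (rule ccontr)
  assume "\<not> int p dvd a"
  then have "(of_int a :: complex) * e \<preceq> 1" using int_unit assms(4) by (intro vdvd_one_mult)
  then have "of_int a * e * \<delta> ^ (d - 1) \<preceq> 1 * \<delta> ^ (d - 1)" by (rule vdvd_mult_mono) simp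
  from vdvd_trans[OF vdvd_trans[OF assms(1,5)] this] have "\<delta> ^ d \<preceq> \<delta> ^ (d - 1)" by simp
  then have *: "\<delta> ^ (d - 1) * \<delta> \<preceq> \<delta> ^ (d - 1) * 1" using \<open>d > 0\<close> by (cases d) (auto simp: mult_ac)
  have "\<delta> \<noteq> 0" using assms(1,3) zero_vdvd[of P] P_nonzero by (auto simp: zero_power)
  then have "\<delta> \<preceq> 1" using * vdvd_mult_cancel[of "\<delta> ^ (d - 1)" \<delta> 1] by simp
  then show False using nonunit_if_power assms by blast
qed

text \<open>Multiplying by \<open>\<delta> ^ (d - 1 - i)\<close> makes the terms after
  \<open>i\<close> multiples of \<open>\<delta> ^ d\<close>, hence of \<open>P\<close>; those before
  \<open>i\<close> are handled by induction, which leaves a single term.\<close>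

lemma dvd_coeffs_if_vdvd_sum:
  assumes "\<delta> ^ d \<preceq> P" "P \<preceq> \<delta> ^ d" "\<delta> \<in> V" and sum: "P \<preceq> (\<Sum>i<d. of_int (a i) * \<delta> ^ i)" and "i < d"
  shows "int p dvd a i"
  using \<open>i < d\<close>
proof (induction i rule: less_induct)
  case (less i)
  let ?e = "d - 1 - i"
  have "P \<preceq> (\<Sum>j<d. of_int (a j) * \<delta> ^ j) * \<delta> ^ ?e"
    using sum \<open>\<delta> \<in> V\<close> by (intro vdvd_mult_right power)
  also have "(\<Sum>j<d. of_int (a j) * \<delta> ^ j) * \<delta> ^ ?e =
      of_int (a i) * \<delta> ^ i * \<delta> ^ ?e + (\<Sum>j\<in>{..<d} - {i}. of_int (a j) * \<delta> ^ j * \<delta> ^ ?e)"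
    using less.prems by (simp add: sum.remove[of "{..<d}" i] distrib_right sum_distrib_right)
  finally have *: "P \<preceq> of_int (a i) * \<delta> ^ i * \<delta> ^ ?e + (\<Sum>j\<in>{..<d} - {i}. of_int (a j) * \<delta> ^ j * \<delta> ^ ?e)" .
  have "P \<preceq> (\<Sum>j\<in>{..<d} - {i}. of_int (a j) * \<delta> ^ j * \<delta> ^ ?e)"
  proof (rule vdvd_sum)
    fix j assume j: "j \<in> {..<d} - {i}"
    show "P \<preceq> of_int (a j) * \<delta> ^ j * \<delta> ^ ?e"
    proof (cases "j < i")
      case True
      then have "P \<preceq> of_int (a j)" using less int_dvd[of 1 "a j"] j by auto
      then show ?thesis using \<open>\<delta> \<in> V\<close> by (auto intro!: vdvd_mult_right power)
    next
      case False
      then have "\<delta> ^ j * \<delta> ^ ?e = \<delta> ^ d * \<delta> ^ (j - i - 1)"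
        using j by (simp add: add.commute flip: power_add)
      moreover have "P \<preceq> of_int (a j) * (\<delta> ^ d * \<delta> ^ (j - i - 1))"
        using assms(2,3) by (intro vdvd_mult_left vdvd_mult_right closed)
      ultimately show ?thesis by (simp add: mult.assoc)
    qed
  qed
  from vdvd_diff[OF * this] have "P \<preceq> of_int (a i) * \<delta> ^ i * \<delta> ^ ?e" by simp
  moreover have "\<delta> ^ i * \<delta> ^ ?e = \<delta> ^ (d - 1)" using less.prems by (simp flip: power_add)
  ultimately have "P \<preceq> of_int (a i) * 1 * \<delta> ^ (d - 1)" by (simp add: mult.assoc)
  then show ?case using assms less.prems by (intro dvd_if_vdvd_power_pred[of \<delta> d 1 "a i"]) auto
qed

end

lemma exists_valuation_ring_above:
  assumes "prime p"
  obtains V where "valuation_ring_above V p"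
proof -
  interpret Z: subring_set "\<int> :: complex set" by unfold_locales auto
  have "inverse (of_nat p :: complex) \<notin> \<int>"
  proof
    assume "inverse (of_nat p :: complex) \<in> \<int>"
    then obtain a where "inverse (of_nat p :: complex) = of_int a" by (auto elim: Ints_cases)
    then have "of_int (a * int p) = (of_int 1 :: complex)"
      using assms by (simp flip: \<open>inverse _ = of_int a\<close>)
    then have "a * int p = 1" by (simp only: of_int_eq_iff)
    then have "int p dvd 1" by (metis dvd_triv_right)
    then show False using assms by simp
  qed
  then obtain V where "valuation_ring V" "inverse (of_nat p :: complex) \<notin> V"
    using exists_valuation_ring[of "\<int> :: complex set" "of_nat p"] Z.subring_set_axioms by auto
  then have "valuation_ring_above V p"
    using assms by (simp add: valuation_ring_above_def valuation_ring_above_axioms_def)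
  then show ?thesis by (rule that)
qed

section \<open>Indices of additive groups\<close>

definition add_subgroup :: "'a::ab_group_add set \<Rightarrow> bool" where
  "add_subgroup A \<longleftrightarrow> 0 \<in> A \<and> (\<forall>x\<in>A. \<forall>y\<in>A. x - y \<in> A)"

text \<open>Cosets as sets, in the shape used by \<open>ind\<close>, so that \<open>ind x\<close>
  unfolds to such a cardinality.\<close>

definition add_cosets :: "'a::ab_group_add set \<Rightarrow> 'a set \<Rightarrow> 'a set set" where
  "add_cosets A B = (\<lambda>x. (+) x ` B) ` A"

lemma coset_in_add_cosets: "x \<in> A \<Longrightarrow> (+) x ` B \<in> add_cosets A B"
  unfolding add_cosets_def by (rule imageI)

lemma add_subgroup_uminus: "add_subgroup A \<Longrightarrow> x \<in> A \<Longrightarrow> - x \<in> A"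
  unfolding add_subgroup_def by (metis diff_0)

lemma add_subgroup_add: "add_subgroup A \<Longrightarrow> x \<in> A \<Longrightarrow> y \<in> A \<Longrightarrow> x + y \<in> A"
  using add_subgroup_uminus[of A y] unfolding add_subgroup_def by (metis diff_minus_eq_add)

lemma add_subgroup_diff: "add_subgroup A \<Longrightarrow> x \<in> A \<Longrightarrow> y \<in> A \<Longrightarrow> x - y \<in> A"
  by (simp add: add_subgroup_def)

lemma add_subgroup_of_int_mult:
  fixes A :: "'a::comm_ring_1 set"
  assumes "add_subgroup A" "x \<in> A"
  shows "of_int i * x \<in> A"
proof -
  have *: "of_nat j * x \<in> A" for j
    using assms by (induction j) (auto simp: algebra_simps add_subgroup_def add_subgroup_add)
  show ?thesis
    using *[of "nat i"] add_subgroup_uminus[OF assms(1) *[of "nat (- i)"]]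
    by (cases "i \<ge> 0") simp_all
qed

lemma coset_eq_iff:
  assumes "add_subgroup B"
  shows "(+) x ` B = (+) y ` B \<longleftrightarrow> x - y \<in> B"
proof
  assume "(+) x ` B = (+) y ` B"
  moreover have "x \<in> (+) x ` B" using assms by (force simp: add_subgroup_def)
  ultimately obtain b where "b \<in> B" "x = y + b" by auto
  then show "x - y \<in> B" by simp
next
  assume *: "x - y \<in> B"
  have "x + b = y + (x - y + b)" "y + b = x + (b - (x - y))" for b by simp_all
  moreover have "x - y + b \<in> B" "b - (x - y) \<in> B" if "b \<in> B" for b
    using that * assms by (auto intro: add_subgroup_add add_subgroup_diff)
  ultimately show "(+) x ` B = (+) y ` B" by blast
qed

lemma add_cosets_product:
  assumes A: "add_subgroup A" and B: "add_subgroup B" and C: "add_subgroup C" and "C \<subseteq> B" "B \<subseteq> A"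
  shows "\<exists>f. bij_betw f (add_cosets A B \<times> add_cosets B C) (add_cosets A C)"
proof -
  define r where "r X = (SOME x. x \<in> A \<and> X = (+) x ` B)" for X
  have r: "r X \<in> A" "X = (+) (r X) ` B" if "X \<in> add_cosets A B" for X
    using someI_ex[of "\<lambda>x. x \<in> A \<and> X = (+) x ` B"] that unfolding r_def add_cosets_def by blast+
  have shift: "(+) x ` (+) y ` C = (+) (x + y) ` C" for x y
    by (simp add: image_image add.assoc)
  have "bij_betw (\<lambda>(X, Y). (+) (r X) ` Y) (add_cosets A B \<times> add_cosets B C) (add_cosets A C)"
    unfolding bij_betw_def
  proof (intro conjI inj_onI set_eqI iffI)
    fix u v
    assume "u \<in> add_cosets A B \<times> add_cosets B C" "v \<in> add_cosets A B \<times> add_cosets B C"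
      and eq: "(case u of (X, Y) \<Rightarrow> (+) (r X) ` Y) = (case v of (X, Y) \<Rightarrow> (+) (r X) ` Y)"
    then obtain X b X' b' where u: "u = (X, (+) b ` C)" and v: "v = (X', (+) b' ` C)"
      and X: "X \<in> add_cosets A B" "X' \<in> add_cosets A B" and b: "b \<in> B" "b' \<in> B"
      by (auto simp: add_cosets_def)
    have "(r X + b) - (r X' + b') \<in> C"
      using eq by (simp add: u v shift coset_eq_iff[OF C])
    then have *: "(r X - r X') + (b - b') \<in> C" by (simp add: algebra_simps)
    then have "(r X - r X') + (b - b') - (b - b') \<in> B"
      using b \<open>C \<subseteq> B\<close> B by (intro add_subgroup_diff) auto
    then have "r X - r X' \<in> B" by simp
    then have "X = X'" using r X coset_eq_iff[OF B] by metis
    moreover have "b - b' \<in> C" using * \<open>X = X'\<close> by simp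
    ultimately show "u = v" by (simp add: u v coset_eq_iff[OF C])
  next
    fix Z assume "Z \<in> (\<lambda>(X, Y). (+) (r X) ` Y) ` (add_cosets A B \<times> add_cosets B C)"
    then obtain X b where X: "X \<in> add_cosets A B" and b: "b \<in> B" and Z: "Z = (+) (r X) ` (+) b ` C"
      by (auto simp: add_cosets_def)
    then have "Z = (+) (r X + b) ` C" by (simp add: shift)
    moreover have "r X + b \<in> A" using r X b A \<open>B \<subseteq> A\<close> by (auto intro: add_subgroup_add)
    ultimately show "Z \<in> add_cosets A C" by (auto simp: add_cosets_def)
  next
    fix Z assume "Z \<in> add_cosets A C"
    then obtain a where a: "a \<in> A" "Z = (+) a ` C" by (auto simp: add_cosets_def)
    define X where "X = (+) a ` B"
    have X: "X \<in> add_cosets A B" using a by (auto simp: X_def add_cosets_def)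
    then have "a - r X \<in> B" using r(2)[OF X] coset_eq_iff[OF B] unfolding X_def by metis
    moreover have "Z = (+) (r X) ` (+) (a - r X) ` C" using a by (simp add: shift)
    ultimately show "Z \<in> (\<lambda>(X, Y). (+) (r X) ` Y) ` (add_cosets A B \<times> add_cosets B C)"
      using X by (intro image_eqI[of _ _ "(X, (+) (a - r X) ` C)"]) (auto simp: add_cosets_def)
  qed
  then show ?thesis by blast
qed

text \<open>Valid for infinite index too, since infinite sets have \<open>card\<close> 0; finiteness
  of intermediate indices is later read off from a nonzero product.\<close>

lemma card_add_cosets_mult:
  assumes "add_subgroup A" "add_subgroup B" "add_subgroup C" "C \<subseteq> B" "B \<subseteq> A"
  shows "card (add_cosets A C) = card (add_cosets A B) * card (add_cosets B C)"
  using add_cosets_product[OF assms] bij_betw_same_card card_cartesian_product by metis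

lemma add_cosets_same: "add_subgroup A \<Longrightarrow> add_cosets A A = {A}"
  unfolding add_cosets_def
  using coset_eq_iff[of A _ 0] by (auto simp: add_subgroup_def image_iff) 

lemma add_subgroup_adjoin:
  fixes L :: "'a::comm_ring_1 set"
  assumes "add_subgroup L"
  shows "add_subgroup {l + of_int i * x | l i. l \<in> L}"
  unfolding add_subgroup_def
proof (intro conjI ballI)
  show "0 \<in> {l + of_int i * x | l i. l \<in> L}"
    using assms by (auto simp: add_subgroup_def intro!: exI[of _ 0])
  fix u v assume "u \<in> {l + of_int i * x | l i. l \<in> L}" "v \<in> {l + of_int i * x | l i. l \<in> L}"
  then obtain l i l' i' where "u = l + of_int i * x" "v = l' + of_int i' * x" "l \<in> L" "l' \<in> L" by blast
  then have "u - v = (l - l') + of_int (i - i') * x" "l - l' \<in> L"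
    using assms by (auto simp: algebra_simps add_subgroup_def)
  then show "u - v \<in> {l + of_int i * x | l i. l \<in> L}" by blast
qed

lemma card_add_cosets_adjoin:
  fixes L :: "'a::comm_ring_1 set"
  assumes L: "add_subgroup L" and "r > 0" and r: "\<And>i. of_int i * x \<in> L \<longleftrightarrow> int r dvd i"
  shows "card (add_cosets {l + of_int i * x | l i. l \<in> L} L) = r"
proof -
  have "bij_betw (\<lambda>i. (+) (of_int (int i) * x) ` L) {..<r} (add_cosets {l + of_int i * x | l i. l \<in> L} L)"
    unfolding bij_betw_def
  proof (intro conjI inj_onI set_eqI iffI)
    fix i j assume *: "i \<in> {..<r}" "j \<in> {..<r}"
      "(+) (of_int (int i) * x) ` L = (+) (of_int (int j) * x) ` L"
    then have "of_int (int i) * x - of_int (int j) * x \<in> L"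
      by (simp only: coset_eq_iff[OF L])
    then have "of_int (int i - int j) * x \<in> L" by (simp add: algebra_simps)
    then have "int r dvd int i - int j" by (simp only: r)
    then have "int i mod int r = int j mod int r" by (simp add: mod_eq_dvd_iff)
    then show "i = j" using * by (simp flip: of_nat_mod)
  next
    fix Z assume "Z \<in> (\<lambda>i. (+) (of_int (int i) * x) ` L) ` {..<r}"
    then obtain i where "Z = (+) (0 + of_int (int i) * x) ` L" by auto
    then show "Z \<in> add_cosets {l + of_int i * x | l i. l \<in> L} L"
      using L unfolding add_cosets_def add_subgroup_def by blast
  next
    fix Z assume "Z \<in> add_cosets {l + of_int i * x | l i. l \<in> L} L"
    then obtain l i where l: "l \<in> L" and Z: "Z = (+) (l + of_int i * x) ` L"
      by (auto simp: add_cosets_def)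
    define j where "j = nat (i mod int r)"
    have j: "int j = i mod int r" "j < r" using \<open>r > 0\<close> by (auto simp: j_def nat_less_iff)
    have "of_int (i - int j) * x \<in> L" unfolding r j by (simp add: dvd_minus_mod)
    then have "l + of_int (i - int j) * x \<in> L" using add_subgroup_add[OF L l] by blast
    then have "(l + of_int i * x) - of_int (int j) * x \<in> L" by (simp add: algebra_simps)
    then have "Z = (+) (of_int (int j) * x) ` L" unfolding Z coset_eq_iff[OF L] .
    then show "Z \<in> (\<lambda>i. (+) (of_int (int i) * x) ` L) ` {..<r}" using j by blast
  qed
  then show ?thesis using bij_betw_same_card by fastforce
qed

lemma card_add_cosets_adjoin_prime:
  fixes L :: "'a::comm_ring_1 set"
  assumes L: "add_subgroup L" and "prime p" and p: "of_nat p * x \<in> L" and x: "x \<notin> L"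
  shows "card (add_cosets {l + of_int i * x | l i. l \<in> L} L) = p"
proof (rule card_add_cosets_adjoin[OF L])
  show "p > 0" using \<open>prime p\<close> prime_gt_0_nat by blast
  fix i
  show "of_int i * x \<in> L \<longleftrightarrow> int p dvd i"
  proof
    assume i: "of_int i * x \<in> L"
    show "int p dvd i"
    proof (rule ccontr)
      assume "\<not> int p dvd i"
      then have "gcd i (int p) = 1" using \<open>prime p\<close>
        by (simp add: prime_imp_coprime coprime_commute[of i] flip: coprime_iff_gcd_eq_1)
      then obtain u v where uv: "u * i + v * int p = 1" using bezout_int[of i "int p"] by auto
      have "of_int u * (of_int i * x) + of_int v * (of_nat p * x) \<in> L"
        by (intro add_subgroup_add[OF L] add_subgroup_of_int_mult[OF L i] add_subgroup_of_int_mult[OF L p])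
      also have "of_int u * (of_int i * x) + of_int v * (of_nat p * x) = of_int (u * i + v * int p) * x"
        by (simp add: algebra_simps)
      finally show False using x uv by simp
    qed
  next
    assume "int p dvd i"
    then obtain j where "i = int p * j" by blast
    then show "of_int i * x \<in> L"
      using add_subgroup_of_int_mult[OF L p, of j] by (simp add: mult_ac)
  qed
qed

lemma card_add_cosets_adjoin_dvd:
  fixes L :: "'a::comm_ring_1 set"
  assumes L: "add_subgroup L" and "N > 0" and N: "of_nat N * x \<in> L"
  shows "card (add_cosets {l + of_int i * x | l i. l \<in> L} L) dvd N"
proof -
  define r where "r = (LEAST j. j > 0 \<and> of_nat j * x \<in> L)"
  have r: "r > 0" "of_nat r * x \<in> L"
    using LeastI[of "\<lambda>j. j > 0 \<and> of_nat j * x \<in> L" N] assms unfolding r_def by auto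
  have dvd: "int r dvd i" if i: "of_int i * x \<in> L" for i
  proof -
    define j where "j = nat (i mod int r)"
    have j: "int j = i mod int r" "j < r" using \<open>r > 0\<close> by (auto simp: j_def nat_less_iff)
    have "of_int i * x - of_int (i div int r) * (of_nat r * x) \<in> L"
      by (rule add_subgroup_diff[OF L i add_subgroup_of_int_mult[OF L r(2)]])
    also have "of_int i * x - of_int (i div int r) * (of_nat r * x) = of_int (i - i div int r * int r) * x"
      by (simp add: algebra_simps)
    also have "i - i div int r * int r = int j" by (simp add: j minus_div_mult_eq_mod)
    finally have "of_nat j * x \<in> L" by simp
    then have "j = 0" using j not_less_Least[of j "\<lambda>j. j > 0 \<and> of_nat j * x \<in> L"] unfolding r_def by auto
    then show ?thesis using j by (simp add: dvd_eq_mod_eq_0)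
  qed
  have "of_int i * x \<in> L" if i: "int r dvd i" for i
  proof -
    obtain j where "i = int r * j" using i by blast
    then show ?thesis using add_subgroup_of_int_mult[OF L r(2), of j] by (simp add: mult_ac)
  qed
  then have "card (add_cosets {l + of_int i * x | l i. l \<in> L} L) = r"
    using dvd r by (intro card_add_cosets_adjoin[OF L]) auto
  then show ?thesis using dvd[of "int N"] N by simp
qed

text \<open>Climbing from \<open>L\<close> to \<open>A\<close> by adjoining one element at a time,
  every step has an index dividing \<open>N\<close>, since \<open>N\<close> kills the new generator
  modulo the smaller group.\<close>

lemma prime_not_dvd_card_add_cosets:
  fixes A :: "'a::comm_ring_1 set"
  assumes "add_subgroup A" "add_subgroup L" "L \<subseteq> A" "finite (add_cosets A L)"
    and "prime p" "\<not> p dvd N" and "\<And>x. x \<in> A \<Longrightarrow> of_nat N * x \<in> L"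
  shows "\<not> p dvd card (add_cosets A L)"
  using assms
proof (induction "card (add_cosets A L)" arbitrary: L rule: less_induct)
  case less
  show ?case
  proof (cases "A = L")
    case True
    then show ?thesis using less.prems by (auto simp: add_cosets_same)
  next
    case False
    then obtain x where x: "x \<in> A" "x \<notin> L" using less.prems by blast
    let ?L = "{l + of_int i * x | l i. l \<in> L}"
    note L' = add_subgroup_adjoin[OF \<open>add_subgroup L\<close>, of x]
    have "L \<subseteq> ?L"
    proof
      fix l assume "l \<in> L"
      then have "l = l + of_int 0 * x \<and> l \<in> L" by simp
      then show "l \<in> ?L" by blast
    qed
    have "x = 0 + of_int 1 * x \<and> 0 \<in> L" using less.prems(2) by (simp add: add_subgroup_def)
    then have "x \<in> ?L" by blast
    have "?L \<subseteq> A"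
      using less.prems x by (auto intro!: add_subgroup_add add_subgroup_of_int_mult)
    have prod: "card (add_cosets A L) = card (add_cosets A ?L) * card (add_cosets ?L L)"
      using less.prems L' \<open>L \<subseteq> ?L\<close> \<open>?L \<subseteq> A\<close> by (intro card_add_cosets_mult)
    have "card (add_cosets A L) > 0"
      using less.prems by (auto simp: card_gt_0_iff add_cosets_def add_subgroup_def)
    have "card (add_cosets ?L L) \<noteq> 1"
    proof
      assume "card (add_cosets ?L L) = 1"
      then obtain Z where Z: "add_cosets ?L L = {Z}" by (rule card_1_singletonE)
      have "0 \<in> ?L" using L' by (simp add: add_subgroup_def)
      then have "(+) x ` L = (+) 0 ` L"
        using coset_in_add_cosets[of x ?L L] coset_in_add_cosets[of 0 ?L L] \<open>x \<in> ?L\<close>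
        unfolding Z by (simp only: singleton_iff)
      then show False using x coset_eq_iff[OF less.prems(2), of x 0] by simp
    qed
    then have less': "card (add_cosets A ?L) < card (add_cosets A L)"
      using prod \<open>card (add_cosets A L) > 0\<close> by (cases "card (add_cosets ?L L)") auto
    have "finite (add_cosets A ?L)"
      using prod \<open>card (add_cosets A L) > 0\<close> by (auto intro: card_ge_0_finite)
    moreover have "of_nat N * y \<in> ?L" if "y \<in> A" for y
      using less.prems(7)[OF that] \<open>L \<subseteq> ?L\<close> by blast
    ultimately have "\<not> p dvd card (add_cosets A ?L)"
      by (intro less.hyps[OF less' less.prems(1) L' \<open>?L \<subseteq> A\<close> _ less.prems(5,6)])
    moreover have "N > 0" using less.prems(6) by (cases N) auto
    have "card (add_cosets ?L L) dvd N"
      using less.prems x \<open>N > 0\<close> by (intro card_add_cosets_adjoin_dvd) auto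
    then have "\<not> p dvd card (add_cosets ?L L)" using less.prems(6) dvd_trans by blast
    ultimately show ?thesis using \<open>prime p\<close> by (simp add: prod prime_dvd_mult_iff)
  qed
qed

section \<open>Congruences modulo a prime\<close>

lemma prime_dvd_add_power:
  fixes x y :: "'a::comm_ring_1"
  assumes "prime p"
  shows "of_nat p dvd (x + y) ^ p - (x ^ p + y ^ p)"
proof -
  have "p > 0" using assms prime_gt_0_nat by blast
  have "(x + y) ^ p = (\<Sum>k\<le>p. of_nat (p choose k) * x ^ k * y ^ (p - k))"
    by (rule binomial_ring)
  also have "{..p} = insert 0 (insert p {0<..<p})" by auto
  also have "(\<Sum>k\<in>\<dots>. of_nat (p choose k) * x ^ k * y ^ (p - k)) =
      x ^ p + y ^ p + (\<Sum>k\<in>{0<..<p}. of_nat (p choose k) * x ^ k * y ^ (p - k))"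
    using \<open>p > 0\<close> by simp
  finally have "(x + y) ^ p - (x ^ p + y ^ p) = (\<Sum>k\<in>{0<..<p}. of_nat (p choose k) * x ^ k * y ^ (p - k))"
    by simp
  moreover have "of_nat p dvd of_nat (p choose k) * x ^ k * y ^ (p - k)" if "k \<in> {0<..<p}" for k
  proof -
    have "p dvd p choose k" using assms that by (intro dvd_choose_prime) auto
    then have "(of_nat p :: 'a) dvd of_nat (p choose k)" by (auto simp: dvd_def)
    then show ?thesis by (intro dvd_mult2)
  qed
  ultimately show ?thesis by (auto intro: dvd_sum)
qed

lemma diff_dvd_power_diff:
  fixes x y :: "'a::comm_ring_1"
  shows "x - y dvd x ^ i - y ^ i"
  unfolding power_diff_sumr2 by simp

lemma prime_dvd_add_prime_power:
  fixes x y :: "'a::comm_ring_1"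
  assumes "prime p"
  shows "of_nat p dvd (x + y) ^ (p ^ j) - (x ^ (p ^ j) + y ^ (p ^ j))"
proof (induction j)
  case (Suc j)
  let ?q = "p ^ j"
  have eq: "z ^ (p ^ Suc j) = (z ^ ?q) ^ p" for z :: 'a by (simp add: mult.commute flip: power_mult)
  have "of_nat p dvd ((x + y) ^ ?q) ^ p - (x ^ ?q + y ^ ?q) ^ p"
    using Suc diff_dvd_power_diff dvd_trans by blast
  moreover have "of_nat p dvd (x ^ ?q + y ^ ?q) ^ p - ((x ^ ?q) ^ p + (y ^ ?q) ^ p)"
    by (rule prime_dvd_add_power[OF assms])
  ultimately have "of_nat p dvd (((x + y) ^ ?q) ^ p - (x ^ ?q + y ^ ?q) ^ p) +
      ((x ^ ?q + y ^ ?q) ^ p - ((x ^ ?q) ^ p + (y ^ ?q) ^ p))" by (rule dvd_add)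
  then show ?case unfolding eq by (simp only: diff_add_eq_diff_diff_swap add_diff_eq diff_add_cancel)
qed simp

lemma fermat_int:
  fixes a :: int
  assumes "prime p"
  shows "int p dvd a ^ p - a"
proof (induction a rule: int_induct[where k = 0])
  case base
  then show ?case using prime_gt_0_nat[OF assms] by (simp add: zero_power)
next
  case (step1 a)
  have "int p dvd ((a + 1) ^ p - (a ^ p + 1 ^ p)) + (a ^ p - a)"
    using prime_dvd_add_power[OF assms, of a 1] step1.IH by (intro dvd_add) auto
  then show ?case by (simp add: algebra_simps)
next
  case (step2 a)
  have "int p dvd (a ^ p - a) - ((a - 1 + 1) ^ p - ((a - 1) ^ p + 1 ^ p))"
    using dvd_diff[OF step2.IH prime_dvd_add_power[OF assms, of "a - 1" 1]] by simp
  then show ?case by (simp add: algebra_simps)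
qed

text \<open>The cofactor of \<open>a - b\<close> in \<open>a ^ p - b ^ p\<close> is congruent to
  \<open>p * b ^ (p - 1)\<close> modulo \<open>p\<close>, hence contributes one more
  \<open>p\<close>.\<close>

lemma prime_power_dvd_power_diff:
  fixes a b :: int
  assumes "int p ^ v dvd a - b" "v > 0"
  shows "int p ^ Suc v dvd a ^ p - b ^ p"
proof -
  have "int p dvd a - b" using assms by (metis dvd_power dvd_trans)
  then have "int p dvd (\<Sum>i<p. b ^ (p - Suc i) * (a ^ i - b ^ i))"
    using diff_dvd_power_diff dvd_trans by (intro dvd_sum dvd_mult) blast
  moreover have "(\<Sum>i<p. b ^ (p - Suc i) * b ^ i) = (\<Sum>i<p. b ^ (p - 1))"
    by (intro sum.cong) (auto simp flip: power_add)
  ultimately have "int p dvd (\<Sum>i<p. b ^ (p - Suc i) * a ^ i) - int p * b ^ (p - 1)"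
    by (simp add: right_diff_distrib sum_subtractf)
  from dvd_add[OF this dvd_triv_left[of "int p" "b ^ (p - 1)"]]
  have "int p dvd (\<Sum>i<p. b ^ (p - Suc i) * a ^ i)" by simp
  then have "int p ^ v * int p dvd (a - b) * (\<Sum>i<p. b ^ (p - Suc i) * a ^ i)"
    using assms by (intro mult_dvd_mono)
  then show ?thesis by (simp add: power_diff_sumr2 mult.commute)
qed

text \<open>With \<open>v\<close> the exact valuation of \<open>a ^ p - a\<close>, iteration does
  not change that valuation. This carries the definition of \<open>s\<close> over to
  \<open>m ^ n - m\<close>.\<close>

lemma prime_power_dvd_iterated_diff:
  fixes a :: int
  assumes "int p ^ v dvd a ^ p - a" "v > 0" "j > 0"
  shows "int p ^ Suc v dvd (a ^ (p ^ j) - a) - (a ^ p - a)"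
  using \<open>j > 0\<close>
proof (induction j rule: nat_induct_non_zero)
  case (Suc j)
  have "int p ^ v dvd ((a ^ (p ^ j) - a) - (a ^ p - a)) + (a ^ p - a)"
    using Suc.IH assms(1) by (intro dvd_add) (auto dest: dvd_mult_right)
  then have "int p ^ Suc v dvd (a ^ (p ^ j)) ^ p - a ^ p"
    using assms(2) by (intro prime_power_dvd_power_diff) auto
  then show ?case by (simp add: mult.commute flip: power_mult)
qed simp

lemma prime_power_sum:
  assumes "p > 1" "t \<le> k"
  shows "real (\<Sum>i<t. p ^ (k - Suc i)) = (real p ^ k - real p ^ (k - t)) / (real p - 1)"
  using assms(2)
proof (induction t)
  case (Suc t)
  then have "real p ^ (k - t) = real p * real p ^ (k - Suc t)"
    by (simp add: Suc_diff_Suc flip: power_Suc)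
  then show ?case using Suc assms(1) by (simp add: field_simps)
qed simp

text \<open>The quotient of \<open>X ^ (q * N) - c ^ (q * N)\<close> by \<open>X ^ q - c ^ q\<close>.\<close>

definition geo :: "int \<Rightarrow> nat \<Rightarrow> nat \<Rightarrow> int poly" where
  "geo c q N = (\<Sum>i<N. monom (c ^ (q * (N - Suc i))) (q * i))"

lemma geo_mult: "(monom 1 q - [:c ^ q:]) * geo c q N = monom 1 (q * N) - [:c ^ (q * N):]"
proof -
  have "geo c q N = (\<Sum>i<N. [:c ^ q:] ^ (N - Suc i) * monom 1 q ^ i)"
    unfolding geo_def
    by (intro sum.cong) (auto simp: monom_power smult_monom poly_const_pow mult.commute simp flip: power_mult)
  then have "(monom 1 q - [:c ^ q:]) * geo c q N = monom 1 q ^ N - [:c ^ q:] ^ N"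
    by (simp only: power_diff_sumr2)
  then show ?thesis by (simp add: monom_power poly_const_pow mult.commute flip: power_mult)
qed

lemma ipoly_geo_mult:
  fixes x :: "'a::comm_ring_1"
  shows "(x ^ q - of_int c ^ q) * ipoly (geo c q N) x = x ^ (q * N) - of_int c ^ (q * N)"
proof -
  have "ipoly ((monom 1 q - [:c ^ q:]) * geo c q N) x = ipoly (monom 1 (q * N) - [:c ^ (q * N):]) x"
    by (simp only: geo_mult)
  then show ?thesis by (simp add: ipoly_simps)
qed

lemma monom_diff_const_nonzero:
  assumes "q > 0"
  shows "monom 1 q - [:c:] \<noteq> (0 :: int poly)"
proof
  assume "monom 1 q - [:c:] = (0 :: int poly)"
  then have "coeff (monom 1 q - [:c:]) q = (0 :: int)" by simp
  then show False using assms by (simp add: coeff_pCons split: nat.splits)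
qed

lemma geo_mult_geo:
  assumes "q > 0"
  shows "geo c q (N * M) = geo c q N * geo c (q * N) M"
proof -
  have "(monom 1 q - [:c ^ q:]) * geo c q (N * M) =
      (monom 1 q - [:c ^ q:]) * (geo c q N * geo c (q * N) M)"
    by (simp only: geo_mult mult.assoc[symmetric])
  then show ?thesis using monom_diff_const_nonzero[OF assms] by (metis mult_cancel_left)
qed

lemma poly_geo: "poly (geo c q N) c = int N * c ^ (q * (N - 1))"
proof -
  have "poly (geo c q N) c = (\<Sum>i<N. c ^ (q * (N - Suc i)) * c ^ (q * i))"
    by (simp add: geo_def poly_sum poly_monom)
  also have "\<dots> = (\<Sum>i<N. c ^ (q * (N - 1)))"
  proof (intro sum.cong refl)
    fix i assume "i \<in> {..<N}"
    then have "q * (N - Suc i) + q * i = q * (N - 1)" by (simp flip: add_mult_distrib2)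
    then show "c ^ (q * (N - Suc i)) * c ^ (q * i) = c ^ (q * (N - 1))" by (simp flip: power_add)
  qed
  finally show ?thesis by simp
qed

lemma coeff_geo_top:
  assumes "q > 0"
  shows "coeff (geo c q (Suc M)) (q * M) = 1"
proof -
  have "coeff (geo c q (Suc M)) (q * M) = (\<Sum>i<Suc M. if i = M then 1 else 0)"
    unfolding geo_def coeff_sum using assms by (intro sum.cong) auto
  then show ?thesis by simp
qed

lemma degree_geo:
  assumes "q > 0"
  shows "degree (geo c q (Suc M)) = q * M"
proof (rule antisym)
  show "degree (geo c q (Suc M)) \<le> q * M"
    unfolding geo_def by (intro degree_sum_le order.trans[OF degree_monom_le]) auto
  show "q * M \<le> degree (geo c q (Suc M))"
    using assms by (intro le_degree) (simp add: coeff_geo_top)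
qed

lemma lead_coeff_geo: "q > 0 \<Longrightarrow> lead_coeff (geo c q (Suc M)) = 1"
  by (simp add: degree_geo coeff_geo_top)

text \<open>Frobenius gives the congruence modulo \<open>p\<close>; the difference vanishes at
  \<open>c\<close>, so \<open>X - c\<close> splits off as well. Near \<open>c\<close> this extra
  factor pushes the valuation of the error strictly above that of \<open>p\<close>.\<close>

lemma monom_diff_const_cong_power:
  fixes c :: int
  assumes "prime p"
  shows "\<exists>R. monom 1 (p ^ j) - [:c ^ (p ^ j):] = [:-c, 1:] ^ (p ^ j) + of_nat p * [:-c, 1:] * R"
proof -
  let ?q = "p ^ j"
  have q: "?q > 0" using assms prime_gt_0_nat by simp
  have "of_nat p dvd ([:-c, 1:] + [:c:]) ^ ?q - ([:-c, 1:] ^ ?q + [:c:] ^ ?q)"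
    using prime_dvd_add_prime_power[OF assms] by blast
  moreover have "[:-c, 1:] + [:c:] = monom 1 1" by (simp add: monom_Suc)
  ultimately obtain S where S: "monom 1 ?q - ([:-c, 1:] ^ ?q + [:c ^ ?q:]) = of_nat p * S"
    by (auto simp: dvd_def monom_power poly_const_pow)
  have "poly (of_nat p * S) c = 0"
    unfolding S[symmetric] using q by (simp add: poly_monom poly_power)
  then have "poly S c = 0" using assms by auto
  then obtain R where "S = [:-c, 1:] * R" by (auto simp: poly_eq_0_iff_dvd dvd_def)
  then have "monom 1 ?q - [:c ^ ?q:] = [:-c, 1:] ^ ?q + of_nat p * [:-c, 1:] * R"
    using S by (simp only: mult.assoc algebra_simps)
  then show ?thesis by blast
qed

text \<open>Quotient of two instances of the preceding congruence: \<open>(X - c) ^ (p ^ j)\<close>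
  cancels modulo \<open>p\<close>, as \<open>p\<close> is prime in the polynomial ring and does not
  divide it. For \<open>c = 1\<close> this is the Eisenstein shape of the cyclotomic polynomial of
  order \<open>p ^ Suc j\<close>.\<close>

lemma geo_cong_power:
  assumes "prime p"
  shows "\<exists>R. geo c (p ^ j) p = [:-c, 1:] ^ (p ^ Suc j - p ^ j) + of_nat p * R \<and>
    poly R c = c ^ (p ^ Suc j - p ^ j)"
proof -
  let ?q = "p ^ j" and ?x = "[:-c, 1:]"
  have p: "p > 1" and q: "?q > 0" and le: "?q < p ^ Suc j"
    using prime_gt_1_nat[OF assms] by auto
  have pe: "prime_elem (of_nat p :: int poly)"
    using assms by (simp add: of_nat_poly prime_elem_const_poly_iff)
  obtain R1 where R1: "monom 1 ?q - [:c ^ ?q:] = ?x ^ ?q + of_nat p * ?x * R1"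
    using monom_diff_const_cong_power[OF assms] by blast
  obtain R2 where R2: "monom 1 (p ^ Suc j) - [:c ^ (p ^ Suc j):] = ?x ^ (p ^ Suc j) + of_nat p * ?x * R2"
    using monom_diff_const_cong_power[OF assms] by blast
  have "(?x ^ ?q + of_nat p * ?x * R1) * geo c ?q p = ?x ^ (p ^ Suc j) + of_nat p * ?x * R2"
    unfolding R1[symmetric] R2[symmetric] geo_mult by (simp add: mult.commute)
  moreover have "?x ^ (p ^ Suc j) = ?x ^ ?q * ?x ^ (p ^ Suc j - ?q)"
    using le by (simp flip: power_add)
  ultimately have "?x ^ ?q * (geo c ?q p - ?x ^ (p ^ Suc j - ?q)) = of_nat p * (?x * R2 - ?x * R1 * geo c ?q p)"
    by (simp only: algebra_simps) 
  then have "of_nat p dvd ?x ^ ?q * (geo c ?q p - ?x ^ (p ^ Suc j - ?q))" by simp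
  moreover have "\<not> of_nat p dvd ?x ^ ?q"
  proof
    assume "of_nat p dvd ?x ^ ?q"
    then have "[:int p:] dvd ?x" using prime_elem_dvd_power[OF pe] by (simp add: of_nat_poly)
    then have "int p dvd coeff ?x 1" by (simp only: const_poly_dvd_iff)
    then show False using p by simp
  qed
  ultimately have "of_nat p dvd geo c ?q p - ?x ^ (p ^ Suc j - ?q)"
    using prime_elem_dvd_multD[OF pe] by blast
  then obtain R where R: "geo c ?q p - ?x ^ (p ^ Suc j - ?q) = of_nat p * R" by blast
  have "int p * poly R c = poly (of_nat p * R) c" by simp
  also have "\<dots> = int p * c ^ (?q * (p - 1))"
    unfolding R[symmetric] using le by (simp add: poly_geo poly_power zero_power)
  finally have "poly R c = c ^ (?q * (p - 1))" using p by simp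
  moreover have "?q * (p - 1) = p ^ Suc j - ?q" by (simp add: algebra_simps diff_mult_distrib2)
  ultimately show ?thesis using R by (auto simp: algebra_simps)
qed

lemma ipoly_diff_const:
  "\<exists>S. q = [:poly q c:] + [:-c, 1:] * S" for q :: "int poly"
proof -
  have "[:-c, 1:] dvd q - [:poly q c:]" by (simp add: poly_eq_0_iff_dvd[symmetric])
  then obtain S where "q - [:poly q c:] = [:-c, 1:] * S" by blast
  then show ?thesis by (auto simp: algebra_simps)
qed

section \<open>Roots of integers\<close>

lemma Zadj_eq: "Zadj x = {poly q x | q. \<forall>i. coeff q i \<in> \<int>}"
proof (intro set_eqI iffI)
  fix y assume "y \<in> {poly q x | q. \<forall>i. coeff q i \<in> \<int>}"
  then obtain q where q: "y = poly q x" "\<forall>i. coeff q i \<in> \<int>" by blast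
  obtain q' where "q = map_poly of_int q'" using intpolyE q(2) by blast
  then show "y \<in> Zadj x" using q by (auto simp: Zadj_def)
next
  fix y assume "y \<in> Zadj x"
  then obtain q :: "int poly" where "y = ipoly q x" by (auto simp: Zadj_def)
  then show "y \<in> {poly q x | q. \<forall>i. coeff q i \<in> \<int>}"
    by (intro CollectI exI[of _ "map_poly of_int q"]) (auto simp: coeff_map_poly)
qed

lemma num_field_eq: "num_field x = {poly q x | q. \<forall>i. coeff q i \<in> \<rat>}"
proof (intro set_eqI iffI)
  fix y assume "y \<in> {poly q x | q. \<forall>i. coeff q i \<in> \<rat>}"
  then obtain q where q: "y = poly q x" "\<forall>i. coeff q i \<in> \<rat>" by blast
  obtain q' where "q = map_poly of_rat q'" using ratpolyE q(2) by blast
  then show "y \<in> num_field x" using q by (auto simp: num_field_def)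
next
  fix y assume "y \<in> num_field x"
  then obtain q :: "rat poly" where "y = poly (map_poly of_rat q) x" by (auto simp: num_field_def)
  then show "y \<in> {poly q x | q. \<forall>i. coeff q i \<in> \<rat>}"
    by (intro CollectI exI[of _ "map_poly of_rat q"]) (auto simp: coeff_map_poly)
qed

lemma subring_Ints: "subring_set (\<int> :: complex set)"
  by unfold_locales auto

lemma subring_Rats: "subring_set (\<rat> :: complex set)"
  by unfold_locales auto

lemma subring_Zadj: "subring_set (Zadj x)"
  unfolding Zadj_eq by (rule subring_set.adjoin[OF subring_Ints])

lemma subring_num_field: "subring_set (num_field x)"
  unfolding num_field_eq by (rule subring_set.adjoin[OF subring_Rats])

lemma mem_Zadj: "x \<in> Zadj x"
  unfolding Zadj_eq by (rule subring_set.mem_adjoin[OF subring_Ints])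

lemma ipoly_mem_Zadj: "ipoly q x \<in> Zadj x"
  by (auto simp: Zadj_def)

lemma mem_ZadjE:
  assumes "y \<in> Zadj x"
  obtains q :: "int poly" where "y = ipoly q x"
  using assms by (auto simp: Zadj_def)

lemma Zadj_subset_num_field: "Zadj x \<subseteq> num_field x"
  unfolding Zadj_eq num_field_eq using Ints_subset_Rats by blast

lemma Rats_subset_num_field: "\<rat> \<subseteq> num_field x"
  unfolding num_field_eq by (rule subring_set.subset_adjoin[OF subring_Rats])

lemma subring_ring_of_ints: "subring_set (ring_of_ints x)"
proof -
  interpret subring_set "num_field x" by (rule subring_num_field)
  show ?thesis
  proof
    show "1 \<in> ring_of_ints x" using one alg_int.one by (simp add: ring_of_ints_def)
    fix u v assume "u \<in> ring_of_ints x" "v \<in> ring_of_ints x"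
    then show "u - v \<in> ring_of_ints x" "u * v \<in> ring_of_ints x"
      using diff mult alg_int.diff[of u v] alg_int.mult[of u v] by (simp_all add: ring_of_ints_def)
  qed
qed

lemma Zadj_subset_ring_of_ints:
  assumes "alg_int x"
  shows "Zadj x \<subseteq> ring_of_ints x"
proof
  fix y assume y: "y \<in> Zadj x"
  then obtain q :: "int poly" where "y = ipoly q x" by (rule mem_ZadjE)
  then have "alg_int y" using alg_int.poly_of_int[of x q] assms by simp
  then show "y \<in> ring_of_ints x" using y Zadj_subset_num_field by (auto simp: ring_of_ints_def)
qed

lemma (in subring_set) add_subgroup: "add_subgroup R"
  unfolding add_subgroup_def using zero diff by blast

lemma clear_denominators:
  obtains N :: nat and G :: "int poly" where "N > 0" "smult (of_nat N) q = map_poly rat_of_int G"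
proof -
  have "\<exists>N G. N > 0 \<and> smult (of_nat N) q = map_poly rat_of_int G"
  proof (induction q)
    case 0
    then show ?case by (intro exI[of _ 1] exI[of _ 0]) simp
  next
    case (pCons a q)
    then obtain N G where NG: "N > 0" "smult (of_nat N) q = map_poly rat_of_int G" by blast
    obtain u v where uv: "quotient_of a = (u, v)" by (cases "quotient_of a")
    then have v: "v > 0" "a = of_int u / of_int v"
      using quotient_of_denom_pos quotient_of_div by blast+
    have "smult (of_nat (nat v * N)) (pCons a q) =
        map_poly rat_of_int (pCons (u * int N) (smult v G))"
      using NG v by (simp add: map_poly_pCons map_poly_smult mult.commute flip: smult_smult NG(2))
    then show ?case using NG v by (intro exI[of _ "nat v * N"]) auto
  qed
  then show ?thesis using that by blast
qed

lemma monic_division: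
  fixes f g :: "int poly"
  assumes "lead_coeff g = 1"
  obtains u r where "f = g * u + r" "\<forall>i\<ge>degree g. coeff r i = 0"
proof -
  obtain u r where ur: "pseudo_divmod f g = (u, r)" by (cases "pseudo_divmod f g")
  have "g \<noteq> 0" using assms by auto
  from pseudo_divmod[OF this ur]
  have "f = g * u + r" "r = 0 \<or> degree r < degree g" using assms by auto
  then show ?thesis by (intro that[of u r]) (auto intro: coeff_eq_0)
qed

lemma degree_monom_diff_const:
  assumes "i > 0"
  shows "degree (monom 1 i - [:c:] :: int poly) = i" "lead_coeff (monom 1 i - [:c:] :: int poly) = 1"
proof -
  have "degree (monom 1 i - [:c:] :: int poly) = i"
    using assms unfolding diff_conv_add_uminus
    by (subst degree_add_eq_left) (auto simp: degree_monom_eq)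
  moreover have "coeff [:c:] i = 0" using assms by (cases i) auto
  ultimately show "degree (monom 1 i - [:c:] :: int poly) = i" "lead_coeff (monom 1 i - [:c:] :: int poly) = 1"
    by simp_all
qed

lemma alg_int_if_power_int:
  assumes "(x :: complex) ^ i = of_int j" "i > 0"
  shows "alg_int x"
proof -
  have "ipoly (monom 1 i - [:j:]) x = 0" using assms by (simp add: ipoly_simps)
  then show ?thesis unfolding alg_int_def using degree_monom_diff_const[OF assms(2)] by blast
qed

text \<open>By absorption, \<open>i\<close> times the binomial coefficient is a multiple of
  \<open>p ^ h\<close>, so at most the \<open>p\<close>-part \<open>p ^ e\<close> of
  \<open>i\<close> is missing; \<open>w ^ (i - 1)\<close> supplies it, because
  \<open>e < p ^ e \<le> i\<close>.\<close>

lemma prime_power_dvd_choose_mult_power: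
  fixes w :: int
  assumes "prime p" "int p dvd w" "i > 0"
  shows "int (p ^ h) dvd int (p ^ h choose i) * w ^ (i - 1)"
proof -
  let ?N = "p ^ h"
  obtain j where j: "i = Suc j" using assms by (cases i) auto
  have "?N > 0" using assms prime_gt_0_nat by simp
  then have "i * (?N choose i) = ?N * ((?N - 1) choose j)"
    using binomial_absorption[of j ?N] j by simp
  then have dvd: "?N dvd i * (?N choose i)" by simp
  obtain i' where i': "i = p ^ multiplicity p i * i'" "\<not> p dvd i'"
    using multiplicity_decompose'[of i p] assms by (metis neq0_conv not_prime_unit)
  let ?e = "multiplicity p i"
  have "coprime ?N i'" using assms i' by (simp add: prime_imp_coprime)
  moreover have "?N dvd i' * (p ^ ?e * (?N choose i))" using dvd i'(1) by (metis mult.assoc mult.commute)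
  ultimately have "?N dvd p ^ ?e * (?N choose i)" by (simp add: coprime_dvd_mult_right_iff)
  then have "int ?N dvd int p ^ ?e * int (?N choose i)"
    by (metis of_nat_dvd_iff of_nat_mult of_nat_power)
  moreover have "?e \<le> i - 1"
  proof -
    have "?e < p ^ ?e" using prime_gt_1_nat[OF assms(1)] by (simp add: power_gt_expt)
    also have "\<dots> \<le> i" using assms by (intro dvd_imp_le multiplicity_dvd) auto
    finally show ?thesis by simp
  qed
  then have "int p ^ ?e dvd w ^ (i - 1)"
    using assms(2) by (meson dvd_power_same dvd_trans le_imp_power_dvd)
  ultimately show ?thesis by (metis dvd_trans mult.commute mult_dvd_mono dvd_refl)
qed

lemma power_swap: "(a ^ i) ^ j = (a ^ j) ^ i" for a :: "'a::monoid_mult"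
  by (simp add: mult.commute flip: power_mult)

text \<open>Eisenstein: the powers of \<open>x\<close> below the \<open>n\<close>-th have valuations that are
  distinct modulo that of \<open>p\<close>.\<close>

lemma (in valuation_ring_above) dvd_coeffs_if_eisenstein:
  assumes x: "x ^ n = of_int m" "x \<in> V" and m: "int p dvd m" "\<not> int p ^ 2 dvd m"
    and "(\<Sum>i<n. of_int (a i) * x ^ i) = 0" "i < n"
  shows "int p dvd a i"
proof -
  obtain m' where m': "m = int p * m'" using m by blast
  have "\<not> int p dvd m'" using m by (auto simp: m' power2_eq_square)
  then have "(of_int m' :: complex) \<preceq> 1" by (rule int_unit)
  then have "P * of_int m' \<preceq> P * 1" by (intro vdvd_mult_mono vdvd_refl)
  then have "x ^ n \<preceq> P" by (simp add: x m')
  moreover have "P \<preceq> x ^ n" by (auto simp: x m' intro!: vdvdI of_int)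
  ultimately show ?thesis using dvd_coeffs_if_vdvd_sum[of x n a i] assms by simp
qed

text \<open>The auxiliary prime \<open>l\<close> divides \<open>m\<close> exactly once; Eisenstein
  at \<open>l\<close> stands in for the irreducibility of \<open>X ^ n - m\<close>.\<close>

locale pure_extension =
  fixes m :: int and l n :: nat
  assumes n_pos: "n > 0" and prime_l: "prime l" and l_dvd: "int l dvd m" and l_square: "\<not> int l ^ 2 dvd m"
begin

lemma m_nonzero: "m \<noteq> 0"
  using l_square by auto

lemma alg_int_root: "(x :: complex) ^ n = of_int m \<Longrightarrow> alg_int x"
  using alg_int_if_power_int n_pos by blast

lemma monic_reduction:
  fixes H :: "int poly"
  obtains u r where "H = (monom 1 n - [:m:]) * u + r" "\<forall>i\<ge>n. coeff r i = 0"
    "\<And>x :: complex. x ^ n = of_int m \<Longrightarrow> ipoly H x = ipoly r x"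
proof -
  obtain u r where ur: "H = (monom 1 n - [:m:]) * u + r" "\<forall>i\<ge>n. coeff r i = 0"
    using monic_division[of "monom 1 n - [:m:]" H] degree_monom_diff_const[OF n_pos] by metis
  moreover have "ipoly H x = ipoly r x" if "x ^ n = of_int m" for x :: complex
    unfolding ur(1) using that by (simp add: ipoly_simps)
  ultimately show ?thesis by (rule that)
qed

lemma degree_less_if_coeffs: "(\<And>i. i \<ge> n \<Longrightarrow> coeff r i = 0) \<Longrightarrow> degree r < n"
  using n_pos by (intro degree_lessI) auto

text \<open>The primitive part of a relation would have all coefficients divisible by
  \<open>l\<close>, by Eisenstein in a valuation ring above \<open>l\<close>.\<close>

lemma powers_independent:
  assumes x: "(x :: complex) ^ n = of_int m" and r: "\<And>i. i \<ge> n \<Longrightarrow> coeff r i = 0" and "ipoly r x = 0"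
  shows "r = 0"
proof (rule ccontr)
  assume "r \<noteq> 0"
  obtain V where "valuation_ring_above V l" using exists_valuation_ring_above[OF prime_l] .
  then interpret valuation_ring_above V l .
  have "x \<in> V"
    using alg_int_root[OF x] valuation_ring_axioms by (simp add: alg_int_iff_valuation_rings)
  let ?r = "primitive_part r"
  have eq: "r = smult (content r) ?r" by simp
  have content: "content r \<noteq> 0" using \<open>r \<noteq> 0\<close> by simp
  have r': "coeff ?r i = 0" if "i \<ge> n" for i
    using r[OF that] content coeff_smult[of "content r" ?r i] by (simp only: eq[symmetric]) simp
  have "of_int (content r) * ipoly ?r x = 0"
    using \<open>ipoly r x = 0\<close> by (subst (asm) eq) (simp only: ipoly_smult)
  then have "ipoly ?r x = 0" using content by simp
  then have "(\<Sum>i<n. of_int (coeff ?r i) * x ^ i) = 0"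
    using degree_less_if_coeffs[OF r'] by (simp add: ipoly_altdef_less)
  then have "int l dvd coeff ?r i" if "i < n" for i
    using dvd_coeffs_if_eisenstein[OF x \<open>x \<in> V\<close> l_dvd l_square] that by blast
  then have "[:int l:] dvd ?r" using r' by (metis const_poly_dvd_iff dvd_0_right not_le)
  then have "int l dvd content ?r" by (simp add: const_poly_dvd_iff_dvd_content)
  then have "int l dvd 1" using \<open>r \<noteq> 0\<close> by simp
  then show False using prime_l by simp
qed

lemma ipoly_eq_iff:
  assumes "(x :: complex) ^ n = of_int m" "\<And>i. i \<ge> n \<Longrightarrow> coeff r i = 0" "\<And>i. i \<ge> n \<Longrightarrow> coeff r' i = 0"
    and "ipoly r x = ipoly r' x"
  shows "r = r'"
  using powers_independent[of x "r - r'"] assms by (simp add: ipoly_diff)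

text \<open>Takes the place of Galois conjugation: the remainder of \<open>H\<close> modulo
  \<open>X ^ n - m\<close> is zero by independence.\<close>

lemma ipoly_zero_conjugate:
  assumes "(x :: complex) ^ n = of_int m" "y ^ n = of_int m" "ipoly H x = 0"
  shows "ipoly H (y :: complex) = 0"
proof -
  obtain u r where ur: "H = (monom 1 n - [:m:]) * u + r" "\<forall>i\<ge>n. coeff r i = 0"
    "\<And>x :: complex. x ^ n = of_int m \<Longrightarrow> ipoly H x = ipoly r x"
    using monic_reduction[of H] by blast
  have "r = 0" using powers_independent[OF assms(1), of r] ur assms by simp
  then show ?thesis using ur(3)[OF assms(2)] by simp
qed

lemma alg_int_conjugate:
  fixes x y :: complex and N :: int
  assumes "x ^ n = of_int m" "y ^ n = of_int m" and "N \<noteq> 0" and "alg_int (ipoly G x / of_int N)"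
  shows "alg_int (ipoly G y / of_int N)"
proof -
  obtain q :: "int poly" where q: "lead_coeff q = 1" "ipoly q (ipoly G x / of_int N) = 0"
    using assms(4) unfolding alg_int_def by blast
  let ?d = "degree q"
  \<comment> \<open>\<open>q\<close> evaluated at \<open>G / N\<close>, multiplied by
    \<open>N ^ ?d\<close> to have integer coefficients.\<close>
  define H where "H = (\<Sum>i\<le>?d. smult (coeff q i * N ^ (?d - i)) (G ^ i))"
  have H: "ipoly H z = of_int N ^ ?d * ipoly q (ipoly G z / of_int N)" for z :: complex
    unfolding H_def ipoly_altdef[of q] sum_distrib_left ipoly_sum
  proof (intro sum.cong refl)
    fix i assume "i \<in> {..?d}"
    then have "(of_int N :: complex) ^ ?d = of_int N ^ (?d - i) * of_int N ^ i"
      by (simp flip: power_add)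
    then show "ipoly (smult (coeff q i * N ^ (?d - i)) (G ^ i)) z =
        of_int N ^ ?d * (of_int (coeff q i) * (ipoly G z / of_int N) ^ i)"
      using \<open>N \<noteq> 0\<close> by (simp add: ipoly_smult ipoly_power power_divide)
  qed
  have "ipoly H y = 0" using ipoly_zero_conjugate[OF assms(1,2)] H[of x] q by simp
  then have "ipoly q (ipoly G y / of_int N) = 0" using H[of y] \<open>N \<noteq> 0\<close> by simp
  then show ?thesis unfolding alg_int_def using q by blast
qed

lemma num_fieldE:
  assumes "z \<in> num_field x" "x ^ n = of_int m"
  obtains N :: nat and G where "N > 0" "z = ipoly G x / of_nat N" "\<And>i. i \<ge> n \<Longrightarrow> coeff G i = 0"
proof -
  obtain q :: "rat poly" where q: "z = poly (map_poly of_rat q) x"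
    using assms by (auto simp: num_field_def)
  obtain N G where NG: "N > 0" "smult (of_nat N) q = map_poly rat_of_int G"
    using clear_denominators[of q] .
  have "smult (of_nat N) (map_poly of_rat q) = map_poly of_rat (smult (of_nat N) q)"
    by (simp add: poly_eq_iff coeff_map_poly of_rat_mult)
  also have "\<dots> = map_poly complex_of_int G"
    by (simp add: NG poly_eq_iff coeff_map_poly)
  finally have "of_nat N * z = ipoly G x" unfolding q by (metis poly_smult)
  moreover obtain u r where "\<forall>i\<ge>n. coeff r i = 0" "ipoly G x = ipoly r x"
    using monic_reduction[of G] assms(2) by metis
  ultimately show ?thesis using NG(1) by (intro that[of N r]) (auto simp: field_simps)
qed

text \<open>Fourier inversion: summing the conjugates of \<open>z\<close> against powers of an
  \<open>n\<close>-th root of unity isolates \<open>n\<close> times one term \<open>g x ^ i\<close>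
  of \<open>z\<close>; multiplying by \<open>x ^ (n - i)\<close> gives \<open>n * m * g\<close>,
  rational and integral, hence an integer.\<close>

lemma ring_of_ints_subset:
  assumes x: "x ^ n = of_int m" and z: "z \<in> ring_of_ints x"
  shows "of_int (int n * m) * z \<in> Zadj x"
proof -
  have "z \<in> num_field x" "alg_int z" using z by (auto simp: ring_of_ints_def)
  obtain N G where N: "N > 0" and zG: "z = ipoly G x / of_nat N" and G: "\<And>i. i \<ge> n \<Longrightarrow> coeff G i = 0"
    using num_fieldE[OF \<open>z \<in> num_field x\<close> x] by metis
  define \<omega> where "\<omega> = cis (2 * pi / n)"
  have \<omega>: "\<omega> ^ n = 1" using n_pos by (simp add: \<omega>_def DeMoivre)
  have \<omega>0: "\<omega> \<noteq> 0" by (simp add: \<omega>_def)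
  have inj: "\<omega> ^ i \<noteq> \<omega> ^ j" if "i < n" "j < n" "i \<noteq> j" for i j
  proof
    assume "\<omega> ^ i = \<omega> ^ j"
    then have "cis (2 * pi * real i / real n) = cis (2 * pi * real j / real n)"
      by (simp add: \<omega>_def DeMoivre mult_ac)
    then show False using that bij_betw_roots_unity[OF n_pos] by (auto simp: bij_betw_def inj_on_def)
  qed
  have int: "of_int (int n * m * coeff G i) / of_nat N \<in> (\<int> :: complex set)" if i: "i < n" for i
  proof -
    let ?S = "\<Sum>r<n. ipoly G (x * \<omega> ^ r) / of_nat N * inverse (\<omega> ^ i) ^ r"
    have root: "(x * \<omega> ^ r) ^ n = of_int m" for r
      using x \<omega> by (simp add: power_mult_distrib power_swap[of \<omega> r])
    have "alg_int (inverse (\<omega> ^ i))"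
    proof -
      have "inverse (\<omega> ^ i) ^ n = of_int 1"
        using \<omega> by (simp add: power_inverse power_swap[of \<omega> i])
      then show ?thesis using alg_int_if_power_int n_pos by blast
    qed
    moreover have "alg_int (ipoly G (x * \<omega> ^ r) / of_nat N)" for r
      using alg_int_conjugate[OF x root, of "int N" G r] N \<open>alg_int z\<close> by (simp add: zG)
    ultimately have int_S: "?S * x ^ (n - i) \<in> Collect alg_int"
      using alg_int_root[OF x] by (intro alg_int.mult alg_int.sum alg_int.power) auto
    have S_eq: "?S = of_int (int n * coeff G i) * x ^ i / of_nat N"
    proof -
      have "?S = (\<Sum>r<n. \<Sum>j<n. of_int (coeff G j) * x ^ j / of_nat N * (\<omega> ^ j / \<omega> ^ i) ^ r)"
        using degree_less_if_coeffs[OF G] \<omega>0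
        by (simp add: ipoly_altdef_less sum_divide_distrib sum_distrib_left sum_distrib_right
            power_mult_distrib power_divide field_simps flip: power_mult)
      also have "\<dots> = (\<Sum>j<n. of_int (coeff G j) * x ^ j / of_nat N * (\<Sum>r<n. (\<omega> ^ j / \<omega> ^ i) ^ r))"
        by (subst sum.swap) (simp add: sum_distrib_left)
      also have "\<dots> = (\<Sum>j<n. if j = i then of_int (coeff G j) * x ^ j / of_nat N * of_nat n else 0)"
      proof (intro sum.cong refl)
        fix j assume "j \<in> {..<n}"
        show "of_int (coeff G j) * x ^ j / of_nat N * (\<Sum>r<n. (\<omega> ^ j / \<omega> ^ i) ^ r) =
            (if j = i then of_int (coeff G j) * x ^ j / of_nat N * of_nat n else 0)"
        proof (cases "j = i")
          case False
          then have "\<omega> ^ j / \<omega> ^ i \<noteq> 1" using inj \<open>j \<in> {..<n}\<close> i \<omega>0 by auto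
          moreover have "(\<omega> ^ j / \<omega> ^ i) ^ n = 1"
            using \<omega> by (simp add: power_divide power_swap[of \<omega> _ n])
          ultimately have "(\<Sum>r<n. (\<omega> ^ j / \<omega> ^ i) ^ r) = 0" by (simp only: sum_gp_strict if_False) simp
          then show ?thesis using False by simp
        qed (use \<omega>0 in simp)
      qed
      also have "\<dots> = of_int (int n * coeff G i) * x ^ i / of_nat N" using i by simp
      finally show ?thesis .
    qed
    have "x ^ i * x ^ (n - i) = of_int m" using i x by (simp flip: power_add)
    then have "?S * x ^ (n - i) = of_int (int n * m * coeff G i) / of_nat N"
      unfolding S_eq by (simp add: mult_ac)
    then have "algebraic_int (of_int (int n * m * coeff G i) / of_nat N :: complex)"
      using int_S by (simp add: alg_int_iff)
    then show ?thesis by (rule rational_algebraic_int_is_int) simp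
  qed
  have "of_int (int n * m) * z = (\<Sum>i<n. of_int (int n * m * coeff G i) / of_nat N * x ^ i)"
    unfolding zG using degree_less_if_coeffs[OF G]
    by (simp add: ipoly_altdef_less sum_divide_distrib sum_distrib_left mult_ac)
  also have "\<dots> \<in> Zadj x"
  proof -
    interpret Z: subring_set "Zadj x" by (rule subring_Zadj)
    have "of_int (int n * m * coeff G i) / of_nat N \<in> Zadj x" if "i < n" for i
      using int[OF that] by (auto elim!: Ints_cases intro: Z.of_int)
    then show ?thesis using mem_Zadj by (intro Z.sum Z.mult Z.power) auto
  qed
  finally show ?thesis .
qed

text \<open>Over the common denominator \<open>N\<close>, numerators matter only modulo
  \<open>N\<close>.\<close>

lemma finite_add_cosets_ring_of_ints:
  assumes x: "x ^ n = of_int m"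
  shows "finite (add_cosets (ring_of_ints x) (Zadj x))"
proof -
  define N where "N = \<bar>int n * m\<bar>"
  have N: "N > 0" using n_pos m_nonzero by (simp add: N_def)
  interpret Z: subring_set "Zadj x" by (rule subring_Zadj)
  let ?F = "\<lambda>c. (+) ((\<Sum>i<n. of_int (c i) * x ^ i) / of_int N) ` Zadj x"
  have "add_cosets (ring_of_ints x) (Zadj x) \<subseteq> ?F ` (PiE {..<n} (\<lambda>_. {0..<N}))"
  proof
    fix Z assume "Z \<in> add_cosets (ring_of_ints x) (Zadj x)"
    then obtain z where z: "z \<in> ring_of_ints x" "Z = (+) z ` Zadj x" by (auto simp: add_cosets_def)
    have "of_int N * z \<in> Zadj x"
      using ring_of_ints_subset[OF x z(1)] Z.uminus by (auto simp: N_def abs_if)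
    then obtain H where "of_int N * z = ipoly H x" by (rule mem_ZadjE)
    moreover obtain u r where r: "\<forall>i\<ge>n. coeff r i = 0" "ipoly H x = ipoly r x"
      using monic_reduction[of H] x by metis
    ultimately have zr: "z = (\<Sum>i<n. of_int (coeff r i) * x ^ i) / of_int N"
      using N degree_less_if_coeffs[of r] by (simp add: ipoly_altdef_less field_simps)
    define c where "c = restrict (\<lambda>i. coeff r i mod N) {..<n}"
    have "z - (\<Sum>i<n. of_int (c i) * x ^ i) / of_int N = (\<Sum>i<n. of_int (coeff r i div N) * x ^ i)"
    proof -
      have "of_int (coeff r i) = (of_int (c i) + of_int N * of_int (coeff r i div N) :: complex)"
        if "i < n" for i
        using that by (simp add: c_def flip: of_int_mult of_int_add)
      then have "(\<Sum>i<n. of_int (coeff r i) * x ^ i) =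
          (\<Sum>i<n. of_int (c i) * x ^ i) + of_int N * (\<Sum>i<n. of_int (coeff r i div N) * x ^ i)"
        by (simp add: sum_distrib_left distrib_right mult.assoc flip: sum.distrib)
      then show ?thesis using N by (simp add: zr field_simps)
    qed
    also have "\<dots> \<in> Zadj x" using mem_Zadj by (intro Z.sum Z.mult Z.power Z.of_int)
    finally have "Z = ?F c" unfolding z(2) coset_eq_iff[OF Z.add_subgroup] .
    moreover have "c \<in> PiE {..<n} (\<lambda>_. {0..<N})" using N by (auto simp: c_def)
    ultimately show "Z \<in> ?F ` (PiE {..<n} (\<lambda>_. {0..<N}))" by blast
  qed
  then show ?thesis by (rule finite_subset) (intro finite_imageI finite_PiE, auto)
qed

end

section \<open>The integral elements \<open>E h\<close>\<close>

lemma prod_roots_unity: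
  fixes c :: complex
  assumes "N > 0" "c \<noteq> 0"
  shows "(\<Prod>\<zeta>\<in>{\<zeta>. \<zeta> ^ N = 1}. [:-(c * \<zeta>), 1:]) = monom 1 N - [:c ^ N:]"
proof -
  let ?U = "{\<zeta> :: complex. \<zeta> ^ N = 1}" and ?P = "\<Prod>\<zeta>\<in>{\<zeta>. \<zeta> ^ N = 1}. [:-(c * \<zeta>), 1:]"
  have U: "finite ?U" "card ?U = N"
    using assms finite_roots_unity[of N] card_roots_unity_eq[of N] by auto
  have deg: "degree ?P = N"
    using U by (subst degree_prod_eq_sum_degree) auto
  moreover have "lead_coeff ?P = 1" by (simp add: lead_coeff_prod)
  ultimately have "coeff ?P N = 1" by simp
  moreover have "coeff (monom 1 N - [:c ^ N:]) N = 1" using assms by (cases N) auto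
  moreover have "degree (monom 1 N - [:c ^ N:]) \<le> N"
    by (intro degree_diff_le degree_monom_le) auto
  moreover have "card ((*) c ` ?U) = N"
    using assms U by (subst card_image) (auto simp: inj_on_def)
  moreover have "poly ?P z = poly (monom 1 N - [:c ^ N:]) z" if z: "z \<in> (*) c ` ?U" for z
  proof -
    obtain \<zeta> where "\<zeta> \<in> ?U" "z = c * \<zeta>" using z by blast
    then have "poly ?P z = 0" using U by (auto simp: poly_prod)
    moreover have "poly (monom 1 N - [:c ^ N:]) z = 0"
      using \<open>\<zeta> \<in> ?U\<close> by (simp add: \<open>z = c * \<zeta>\<close> poly_monom power_mult_distrib)
    ultimately show ?thesis by simp
  qed
  ultimately show ?thesis using deg by (intro poly_eqI_degree_lead_coeff[of _ N _ "(*) c ` ?U"]) auto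
qed

lemma prod_roots_unity_diff:
  fixes c :: int and x :: complex
  assumes "q > 0" "N > 0" "c \<noteq> 0"
  shows "(\<Prod>\<zeta>\<in>{\<zeta>. \<zeta> ^ (q * N) = 1} - {\<zeta>. \<zeta> ^ q = 1}. x - of_int c * \<zeta>) = ipoly (geo c q N) x"
proof -
  let ?c = "of_int c :: complex"
  let ?U = "{\<zeta> :: complex. \<zeta> ^ (q * N) = 1}" and ?W = "{\<zeta> :: complex. \<zeta> ^ q = 1}"
  let ?f = "\<lambda>\<zeta>. [:-(?c * \<zeta>), 1:]"
  have fin: "finite ?U" using assms by (intro finite_roots_unity) auto
  have sub: "?W \<subseteq> ?U" by (auto simp: power_mult)
  have "(monom 1 q - [:?c ^ q:]) * prod ?f (?U - ?W) = prod ?f ?W * prod ?f (?U - ?W)"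
    using assms by (subst prod_roots_unity) auto
  also have "\<dots> = prod ?f ?U" using prod.subset_diff[OF sub fin, of ?f] by (simp only: mult.commute)
  also have "\<dots> = monom 1 (q * N) - [:?c ^ (q * N):]" using assms by (intro prod_roots_unity) auto
  also have "\<dots> = map_poly of_int (monom 1 (q * N) - [:c ^ (q * N):])"
    by (simp add: poly_eq_iff coeff_map_poly coeff_pCons split: nat.split)
  also have "\<dots> = map_poly of_int ((monom 1 q - [:c ^ q:]) * geo c q N)" by (simp only: geo_mult)
  also have "\<dots> = (monom 1 q - [:?c ^ q:]) * map_poly of_int (geo c q N)"
    by (simp only: poly_eq_poly_eq_iff[symmetric] fun_eq_iff)
       (simp add: ipoly_mult ipoly_diff ipoly_monom map_poly_pCons poly_monom)
  finally have "(monom 1 q - [:?c ^ q:]) * prod ?f (?U - ?W) =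
      (monom 1 q - [:?c ^ q:]) * map_poly of_int (geo c q N)" .
  moreover have "monom 1 q - [:?c ^ q:] \<noteq> 0"
  proof
    assume "monom 1 q - [:?c ^ q:] = 0"
    then have "coeff (monom 1 q - [:?c ^ q:]) q = 0" by simp
    then show False using assms by (simp add: coeff_pCons split: nat.splits)
  qed
  ultimately have "prod ?f (?U - ?W) = map_poly of_int (geo c q N)" by (metis mult_cancel_left)
  then have "poly (prod ?f (?U - ?W)) x = ipoly (geo c q N) x" by simp
  then show ?thesis by (simp add: poly_prod)
qed

lemma exists_primitive_root:
  assumes "N > 0"
  obtains \<zeta> :: complex where "\<zeta> ^ N = 1" "\<And>i. 0 < i \<Longrightarrow> i < N \<Longrightarrow> \<zeta> ^ i \<noteq> 1"
proof
  let ?\<zeta> = "cis (2 * pi / N)"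
  show "?\<zeta> ^ N = 1" using assms by (simp add: DeMoivre)
  fix i assume i: "0 < i" "i < N"
  show "?\<zeta> ^ i \<noteq> 1"
  proof
    assume "?\<zeta> ^ i = 1"
    then have "cis (2 * pi * real i / real N) = cis (2 * pi * real 0 / real N)"
      by (simp add: DeMoivre mult_ac)
    moreover have "inj_on (\<lambda>i. cis (2 * pi * real i / real N)) {..<N}"
      using bij_betw_roots_unity[OF assms] by (rule bij_betw_imp_inj_on)
    ultimately show False using i assms inj_onD[of _ "{..<N}" i 0] by fastforce
  qed
qed

lemma ipoly_geo: "ipoly (geo c q N) x = (\<Sum>i<N. of_int c ^ (q * (N - Suc i)) * (x ^ q) ^ i)"
  by (simp add: geo_def ipoly_sum ipoly_monom power_mult)

locale pure_prime_power = pure_extension m l n for m :: int and l n :: nat +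
  fixes p k s t :: nat
  assumes prime_p: "prime p" and p_not_dvd: "\<not> int p dvd m" and n_def: "n = p ^ k"
    and s_dvd: "int p ^ (s + 1) dvd m ^ n - m" and s_max: "\<not> int p ^ (s + 2) dvd m ^ n - m"
    and t_def: "t = min s k"
begin

definition q where "q h = p ^ (k - h)"
definition E :: "nat \<Rightarrow> complex \<Rightarrow> complex" where
  "E h x = ipoly (geo m (q h) (p ^ h)) x / of_nat p ^ h"
text \<open>For \<open>h \<le> t\<close> this is the value of
  \<open>(x ^ q h - m ^ q h) * E h x\<close>, the same at all roots \<open>x\<close>, and of
  valuation \<open>s + 1 - h\<close>.\<close>

definition w where "w h = (m - m ^ n) div int p ^ h"
text \<open>The exponent from which on \<open>E h x\<close> times powers of \<open>x - m\<close> is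
  \<open>p\<close> times an element of the module. For \<open>h < t\<close> it is Euler's totient of
  \<open>p ^ (k - h)\<close>, which matches roots of unity of that order.\<close>

definition D where "D h = (if h < t then q h - q (Suc h) else q h)"

lemma p_gt_1: "p > 1" and p_gt_0: "p > 0"
  using prime_gt_1_nat[OF prime_p] by auto

lemma t_le: "t \<le> k" "t \<le> s"
  by (auto simp: t_def)

lemma q_pos: "q h > 0"
  using p_gt_0 by (simp add: q_def)

lemma q_0: "q 0 = n"
  by (simp add: q_def n_def)

lemma q_mult: "h \<le> k \<Longrightarrow> q h * p ^ h = n"
  by (simp add: q_def n_def flip: power_add)

lemma q_Suc: "h < k \<Longrightarrow> q h = q (Suc h) * p"
  by (simp add: q_def Suc_diff_Suc flip: power_Suc2)

lemma q_antimono: "h \<le> h' \<Longrightarrow> q h' \<le> q h"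
  using p_gt_0 by (auto simp: q_def intro: power_increasing)

lemma D_pos: "D h > 0"
  using q_Suc[of h] q_pos[of "Suc h"] p_gt_1 t_le by (auto simp: D_def q_pos)

lemma D_less: "h < t \<Longrightarrow> D h = q (Suc h) * (p - 1)"
  using q_Suc[of h] t_le by (simp add: D_def algebra_simps)

lemma D_ge:
  assumes "h \<le> t"
  shows "D h \<ge> q t"
proof (cases "h < t")
  case True
  then have "q t \<le> q (Suc h) * 1" by (simp add: q_antimono)
  also have "\<dots> \<le> q (Suc h) * (p - 1)" using p_gt_1 by (intro mult_left_mono) auto
  finally show ?thesis using True by (simp add: D_less)
qed (use assms in \<open>simp add: D_def\<close>)

lemma w_mult: "h \<le> s + 1 \<Longrightarrow> int p ^ h * w h = m - m ^ n"
proof -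
  assume "h \<le> s + 1"
  then have "int p ^ h dvd m ^ n - m" using s_dvd by (meson dvd_trans le_imp_power_dvd)
  then have "int p ^ h dvd m - m ^ n" by (simp add: dvd_diff_commute)
  then show ?thesis by (simp add: w_def)
qed

lemma w_dvd:
  assumes "i + h \<le> s + 1"
  shows "int p ^ i dvd w h"
proof -
  have "int p ^ (i + h) dvd m - m ^ n"
    using s_dvd assms by (subst dvd_diff_commute) (meson dvd_trans le_imp_power_dvd)
  then have "int p ^ h * int p ^ i dvd int p ^ h * w h"
    using w_mult[of h] assms by (simp add: power_add mult.commute)
  then show ?thesis using p_gt_0 by simp
qed

lemma w_nonzero: "h \<le> s + 1 \<Longrightarrow> w h \<noteq> 0"
  using w_mult[of h] s_max by (auto simp: dvd_diff_commute)

lemma w_s: "\<not> int p ^ 2 dvd w s"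
proof
  assume "int p ^ 2 dvd w s"
  then have "int p ^ s * int p ^ 2 dvd int p ^ s * w s" by (rule mult_dvd_mono[OF dvd_refl])
  then show False using w_mult[of s] s_max by (simp add: dvd_diff_commute power2_eq_square mult_ac)
qed

lemma E_0: "E 0 x = 1"
  by (simp add: E_def geo_def map_poly_monom poly_monom)

lemma E_mult:
  assumes "x ^ n = of_int m" "h \<le> t"
  shows "(x ^ q h - of_int m ^ q h) * E h x = of_int (w h)"
proof -
  have "(x ^ q h - of_int m ^ q h) * ipoly (geo m (q h) (p ^ h)) x = of_int (m - m ^ n)"
    using assms t_le by (simp add: ipoly_geo_mult q_mult)
  also have "m - m ^ n = int p ^ h * w h" using w_mult[of h] assms t_le by simp
  also have "of_int (int p ^ h * w h) = of_nat p ^ h * (of_int (w h) :: complex)" by simp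
  finally show ?thesis using p_gt_0 by (simp add: E_def)
qed

text \<open>Each generator is a \<open>p\<close>-th part of a multiple of its predecessor, so
  adjoining it gives a quotient killed by \<open>p\<close>.\<close>

lemma E_Suc:
  assumes "h < k"
  shows "of_nat p * E (Suc h) x = E h x * ipoly (geo m (q (Suc h)) p) x"
proof -
  have "geo m (q (Suc h)) (p * p ^ h) = geo m (q (Suc h)) p * geo m (q h) (p ^ h)"
    using geo_mult_geo[OF q_pos] q_Suc[OF assms] by simp
  then show ?thesis using p_gt_0 by (simp add: E_def ipoly_mult)
qed

text \<open>In particular, \<open>E h\<close> does not change when \<open>x\<close> is multiplied by
  a root of unity of order dividing \<open>q h\<close>.\<close>

lemma E_cong: "x ^ q h = y ^ q h \<Longrightarrow> E h x = E h y"
  by (simp add: E_def ipoly_geo)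

text \<open>If \<open>E h x\<close> were not in \<open>V\<close>, expanding \<open>x ^ n = m\<close> in powers of its inverse would exhibit that
  inverse as a unit.\<close>

lemma alg_int_E:
  assumes x: "x ^ n = of_int m" and h: "h \<le> t"
  shows "alg_int (E h x)"
  unfolding alg_int_iff_valuation_rings
proof (intro allI impI, rule ccontr)
  fix V :: "complex set" assume V: "valuation_ring V" and notin: "E h x \<notin> V"
  interpret valuation_ring V by (fact V)
  let ?u = "inverse (E h x)" and ?N = "p ^ h" and ?c = "of_int m ^ q h :: complex"
  have u: "?u \<in> V" using total notin by blast
  have E0: "E h x \<noteq> 0" using notin zero by auto
  have "int p dvd w h" using w_dvd[of 1 h] h t_le by simp
  \<comment> \<open>With one factor \<open>w h\<close> set aside, \<open>p ^ h\<close> divides every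
    binomial term with \<open>i > 0\<close>. All of them are then multiples of
    \<open>p ^ h * w h = m - m ^ n\<close>, which cancels at the end.\<close>
  have "\<exists>e. \<forall>i>0. int (?N choose i) * w h ^ (i - 1) = int ?N * e i"
    using prime_power_dvd_choose_mult_power[OF prime_p \<open>int p dvd w h\<close>, of _ h]
    by (auto simp: dvd_def intro!: choice)
  then obtain e where e: "\<And>i. i > 0 \<Longrightarrow> int (?N choose i) * w h ^ (i - 1) = int ?N * e i" by blast
  have xq: "x ^ q h = of_int (w h) * ?u + ?c"
    using E_mult[OF x h] E0 by (simp add: field_simps)
  have "of_int m = (x ^ q h) ^ ?N" using x h t_le by (simp add: q_mult flip: power_mult)
  also have "\<dots> = (\<Sum>i\<le>?N. of_nat (?N choose i) * (of_int (w h) * ?u) ^ i * ?c ^ (?N - i))"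
    unfolding xq by (rule binomial_ring)
  also have "\<dots> = ?c ^ ?N + (\<Sum>i\<in>{1..?N}. of_nat (?N choose i) * (of_int (w h) * ?u) ^ i * ?c ^ (?N - i))"
    by (subst sum.atMost_shift) (simp add: sum.atLeast1_atMost_eq)
  also have "?c ^ ?N = of_int (m ^ n)" using h t_le by (simp add: q_mult flip: power_mult)
  also have "(\<Sum>i\<in>{1..?N}. of_nat (?N choose i) * (of_int (w h) * ?u) ^ i * ?c ^ (?N - i)) =
      (\<Sum>i\<in>{1..?N}. of_int (int ?N * w h) * ?u * (of_int (e i) * ?u ^ (i - 1) * ?c ^ (?N - i)))"
  proof (intro sum.cong refl)
    fix i assume "i \<in> {1..?N}"
    then obtain j where j: "i = Suc j" by (cases i) auto
    have "of_int (int (?N choose i) * w h ^ j) = (of_int (int ?N * e i) :: complex)"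
      using e[of i] j by simp
    then have "of_nat (?N choose i) * of_int (w h) ^ j = (of_nat ?N * of_int (e i) :: complex)"
      by (simp only: of_int_mult of_int_power of_int_of_nat_eq)
    then show "of_nat (?N choose i) * (of_int (w h) * ?u) ^ i * ?c ^ (?N - i) =
        of_int (int ?N * w h) * ?u * (of_int (e i) * ?u ^ (i - 1) * ?c ^ (?N - i))"
      by (simp add: j power_mult_distrib mult_ac)
  qed
  also have "\<dots> = of_int (int ?N * w h) * (?u * (\<Sum>i\<in>{1..?N}. of_int (e i) * ?u ^ (i - 1) * ?c ^ (?N - i)))"
    by (simp only: sum_distrib_left mult.assoc)
  finally have "of_int (m - m ^ n) = of_int (int ?N * w h) *
      (?u * (\<Sum>i\<in>{1..?N}. of_int (e i) * ?u ^ (i - 1) * ?c ^ (?N - i)))" (is "_ = _ * (?u * ?S)")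
    by (simp add: algebra_simps)
  moreover have "int ?N * w h = m - m ^ n" using w_mult[of h] h t_le by simp
  moreover have "m - m ^ n \<noteq> 0" using w_mult[of 0] w_nonzero[of 0] by simp
  ultimately have "?u * ?S = 1" by (simp add: mult_cancel_left1 del: of_int_diff of_int_mult of_int_power)
  then have "E h x = ?S" using E0 by (simp add: field_simps)
  also have "?S \<in> V" using u by (intro sum mult power of_int)
  finally show False using notin by simp
qed

end

context valuation_ring_above
begin

text \<open>The cyclotomic polynomial in Eisenstein form, evaluated at \<open>\<zeta>\<close>: the
  cofactor of \<open>P\<close> is, up to sign, 1 plus a multiple of the nonunit
  \<open>\<zeta> - 1\<close>, hence a unit.\<close>

lemma root_of_unity_minus_one:
  assumes "\<zeta> ^ (p ^ Suc j) = 1" "\<zeta> ^ (p ^ j) \<noteq> 1" and "\<zeta> \<in> V"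
  shows "(\<zeta> - 1) ^ (p ^ Suc j - p ^ j) \<preceq> P" "P \<preceq> (\<zeta> - 1) ^ (p ^ Suc j - p ^ j)"
proof -
  obtain R where R: "geo 1 (p ^ j) p = [:-1, 1:] ^ (p ^ Suc j - p ^ j) + of_nat p * R" "poly R 1 = 1"
    using geo_cong_power[OF prime_p, of 1 j] by auto
  obtain S where S: "R = [:1:] + [:-1, 1:] * S"
    using ipoly_diff_const[of R 1] R(2) by auto
  have "(\<zeta> ^ p ^ j - of_int 1 ^ p ^ j) * ipoly (geo 1 (p ^ j) p) \<zeta> = 0"
    unfolding ipoly_geo_mult using assms(1) by (simp add: mult.commute)
  then have "ipoly (geo 1 (p ^ j) p) \<zeta> = 0" using assms(2) by simp
  then have "(\<zeta> - 1) ^ (p ^ Suc j - p ^ j) + P * (1 + (\<zeta> - 1) * ipoly S \<zeta>) = 0"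
    unfolding R(1) S of_nat_poly by (simp add: ipoly_simps algebra_simps)
  then have eq: "(\<zeta> - 1) ^ (p ^ Suc j - p ^ j) = P * - (1 + (\<zeta> - 1) * ipoly S \<zeta>)"
    by (simp only: mult_minus_right eq_neg_iff_add_eq_0)
  have S_mem: "ipoly S \<zeta> \<in> V" using assms by (intro poly_of_int)
  then show 1: "P \<preceq> (\<zeta> - 1) ^ (p ^ Suc j - p ^ j)"
    unfolding eq using assms by (intro vdvdI[OF _ refl] closed)
  have "\<not> \<zeta> - 1 \<preceq> 1" using 1 by (rule nonunit_if_power)
  then have "\<not> (\<zeta> - 1) * ipoly S \<zeta> \<preceq> 1"
    using S_mem by (meson vdvdI vdvd_trans)
  then have "1 + (\<zeta> - 1) * ipoly S \<zeta> \<preceq> 1"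
    using assms S_mem by (intro unit_add) (auto intro: closed)
  then have "- (1 + (\<zeta> - 1) * ipoly S \<zeta>) \<preceq> 1" using vdvd_minus_iff[of _ 1] 
    by (metis minus_minus mult_minus1_right one uminus vdvdI vdvd_trans)
  then have "P * - (1 + (\<zeta> - 1) * ipoly S \<zeta>) \<preceq> P * 1" by (rule vdvd_mult_mono[OF vdvd_refl])
  then show "(\<zeta> - 1) ^ (p ^ Suc j - p ^ j) \<preceq> P" by (simp only: eq mult_1_right)
qed

end

section \<open>Valuations at the roots\<close>

locale pure_prime_power_valuation =
  pure_prime_power m l n p k s t + valuation_ring_above V p
  for m :: int and l n p k s t :: nat and V :: "complex set"
begin

abbreviation c :: complex where "c \<equiv> of_int m"

lemma c_mem: "c \<in> V" and c_unit: "c \<preceq> 1"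
  using p_not_dvd by (auto intro: of_int int_unit)

lemma alg_int_mem: "alg_int x \<Longrightarrow> x \<in> V"
  using alg_int_iff_valuation_rings valuation_ring_axioms by blast

lemma root_mem: "x ^ n = c \<Longrightarrow> x \<in> V"
  by (intro alg_int_mem alg_int_root)

lemma root_unit: "x ^ n = c \<Longrightarrow> x \<preceq> 1"
  using vdvd_one_power_iff[OF root_mem n_pos] c_unit by metis

lemma E_mem: "x ^ n = c \<Longrightarrow> h \<le> t \<Longrightarrow> E h x \<in> V"
  by (intro alg_int_mem alg_int_E)

lemma root_of_unity_mem: "\<zeta> ^ N = 1 \<Longrightarrow> N > 0 \<Longrightarrow> \<zeta> \<in> V"
  using alg_int_if_power_int[of \<zeta> N 1] by (intro alg_int_mem) simp

lemma int_unit_multiple: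
  assumes "int p dvd a" "\<not> int p ^ 2 dvd a"
  shows "of_int a \<preceq> P"
proof -
  obtain b where b: "a = int p * b" using assms by blast
  then have "\<not> int p dvd b" using assms by (auto simp: power2_eq_square)
  then have "P * of_int b \<preceq> P * 1" by (intro vdvd_mult_mono vdvd_refl int_unit)
  then show ?thesis by (simp add: b)
qed

lemma exists_closest_root:
  assumes "(x :: complex) ^ n = c"
  obtains a where "a ^ n = c" "\<And>b. b ^ n = c \<Longrightarrow> b - c \<preceq> a - c"
proof -
  have max: "finite S \<Longrightarrow> S \<noteq> {} \<Longrightarrow> \<exists>a\<in>S. \<forall>b\<in>S. b - c \<preceq> a - c" for S :: "complex set"
  proof (induction S rule: finite_ne_induct)
    case (insert x S)
    then obtain a where "a \<in> S" "\<forall>b\<in>S. b - c \<preceq> a - c" by blast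
    then show ?case using vdvd_total[of "x - c" "a - c"] vdvd_trans vdvd_refl by (metis insert_iff)
  qed simp
  have "finite {b :: complex. b ^ n = c}"
    using finite_nth_roots[OF n_pos] by simp
  then obtain a where "a \<in> {b. b ^ n = c}" "\<forall>b\<in>{b. b ^ n = c}. b - c \<preceq> a - c"
    using max[of "{b. b ^ n = c}"] assms by blast
  then show ?thesis using that by blast
qed

end

locale closest_root = pure_prime_power_valuation +
  fixes a :: complex
  assumes a: "a ^ n = c" and closest: "b ^ n = c \<Longrightarrow> b - c \<preceq> a - c"
begin

text \<open>\<open>a / \<zeta>\<close> is another root, hence no nearer to \<open>c\<close> than
  \<open>a\<close>. So \<open>a - c * \<zeta>\<close> divides \<open>a - c\<close>, and with it the
  difference of the two, \<open>c\<close> times \<open>1 - \<zeta>\<close> up to sign.\<close>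

lemma dist_root_of_unity:
  assumes "\<zeta> ^ n = 1"
  shows "a - c * \<zeta> \<preceq> 1 - \<zeta>"
proof -
  have \<zeta>: "\<zeta> \<noteq> 0" using assms n_pos by (auto simp: zero_power)
  have inv: "inverse \<zeta> \<in> V" using assms n_pos by (intro root_of_unity_mem[of _ n]) (auto simp: power_inverse)
  have "a - c * \<zeta> \<preceq> (a - c * \<zeta>) * inverse \<zeta>" using inv by (rule vdvdI) simp
  also have "\<dots> = a * inverse \<zeta> - c" using \<zeta> by (simp add: algebra_simps)
  also have "\<dots> \<preceq> a - c" using a assms by (intro closest) (simp add: power_mult_distrib power_inverse)
  finally have "a - c * \<zeta> \<preceq> (a - c * \<zeta>) - (a - c)" by (rule vdvd_diff[OF vdvd_refl])
  also have "(a - c * \<zeta>) - (a - c) = c * (1 - \<zeta>)" by (simp add: algebra_simps)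
  also have "\<dots> \<preceq> 1 * (1 - \<zeta>)" using c_unit by (rule vdvd_mult_mono) simp
  finally show ?thesis by simp
qed

text \<open>\<open>P ^ h * E h\<close> is a product of differences \<open>x - c * \<zeta>\<close>.
  At \<open>a\<close> each factor divides the one at \<open>c\<close>, and at \<open>c\<close> the
  product is \<open>P ^ h\<close> times a power of the unit \<open>c\<close>.\<close>

lemma E_unit:
  assumes "h \<le> t"
  shows "E h a \<preceq> 1"
proof -
  let ?U = "{\<zeta> :: complex. \<zeta> ^ (q h * p ^ h) = 1} - {\<zeta>. \<zeta> ^ q h = 1}"
  have prod: "(\<Prod>\<zeta>\<in>?U. x - c * \<zeta>) = ipoly (geo m (q h) (p ^ h)) x" for x
    using q_pos p_gt_0 m_nonzero by (intro prod_roots_unity_diff) auto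
  have "P ^ h * E h a = (\<Prod>\<zeta>\<in>?U. a - c * \<zeta>)"
    unfolding prod using p_gt_0 by (simp add: E_def)
  also have "\<dots> \<preceq> (\<Prod>\<zeta>\<in>?U. c - c * \<zeta>)"
  proof (rule vdvd_prod)
    fix \<zeta> assume "\<zeta> \<in> ?U"
    then have "a - c * \<zeta> \<preceq> 1 - \<zeta>" using assms t_le by (intro dist_root_of_unity) (simp add: q_mult)
    then have "a - c * \<zeta> \<preceq> c * (1 - \<zeta>)" using c_mem by (rule vdvd_mult_left)
    then show "a - c * \<zeta> \<preceq> c - c * \<zeta>" by (simp add: algebra_simps)
  qed
  also have "(\<Prod>\<zeta>\<in>?U. c - c * \<zeta>) = P ^ h * c ^ (q h * (p ^ h - 1))"
  proof -
    have "ipoly (geo m (q h) (p ^ h)) c = of_int (poly (geo m (q h) (p ^ h)) m)"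
      by (simp add: geo_def ipoly_sum ipoly_monom poly_sum poly_monom)
    then show ?thesis unfolding prod by (simp add: poly_geo)
  qed
  finally have "E h a \<preceq> c ^ (q h * (p ^ h - 1))"
    using p_gt_0 vdvd_mult_cancel[of "P ^ h" "E h a"] by simp
  then show ?thesis using vdvd_trans vdvd_one_power[OF c_unit] by blast
qed

lemma a_mem: "a \<in> V" and a_unit: "a \<preceq> 1"
  using root_mem root_unit a by auto

lemma power_diff_w:
  assumes "h \<le> t"
  shows "of_int (w h) \<preceq> a ^ q h - c ^ q h"
proof -
  have "(a ^ q h - c ^ q h) * E h a \<preceq> (a ^ q h - c ^ q h) * 1"
    using E_unit[OF assms] by (intro vdvd_mult_mono vdvd_refl)
  then show ?thesis using E_mult[OF a assms] by simp
qed

lemma P_power_vdvd_power_diff: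
  assumes "h \<le> t" "i + h \<le> s + 1"
  shows "P ^ i \<preceq> a ^ q h - c ^ q h"
  using vdvd_trans[OF int_dvd[OF w_dvd[OF assms(2)]] power_diff_w[OF assms(1)]] .

lemma a_minus_c_mem: "a - c \<in> V"
  using a_mem c_mem by (rule diff)

lemma power_diff_cong:
  obtains R where "R \<in> V" "a ^ q h - c ^ q h = (a - c) ^ q h + P * (a - c) * R"
proof -
  obtain R where R: "monom 1 (q h) - [:m ^ q h:] = [:-m, 1:] ^ q h + of_nat p * [:-m, 1:] * R"
    using monom_diff_const_cong_power[OF prime_p, of "k - h" m] unfolding q_def by blast
  have "ipoly (monom 1 (q h) - [:m ^ q h:]) a = ipoly ([:-m, 1:] ^ q h + of_nat p * [:-m, 1:] * R) a"
    by (simp only: R)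
  then have "a ^ q h - c ^ q h = (a - c) ^ q h + P * (a - c) * ipoly R a"
    by (simp add: ipoly_simps of_nat_poly del: mult_pCons_left mult_pCons_right) 
  then show ?thesis using a_mem by (intro that[of "ipoly R a"] poly_of_int)
qed

text \<open>\<open>p\<close> divides \<open>w t\<close> because \<open>t \<le> s\<close>, and
  \<open>a ^ q t - c ^ q t\<close> agrees with \<open>(a - c) ^ q t\<close> modulo
  \<open>P\<close>.\<close>

lemma P_vdvd_a_minus_c_power: "P \<preceq> (a - c) ^ q t"
proof -
  obtain R where R: "R \<in> V" "a ^ q t - c ^ q t = (a - c) ^ q t + P * (a - c) * R"
    using power_diff_cong .
  have "P \<preceq> (a ^ q t - c ^ q t) - P * ((a - c) * R)"
    using P_power_vdvd_power_diff[of t 1] t_le R a_minus_c_mem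
    by (intro vdvd_diff[of P "a ^ q t - c ^ q t"] vdvd_mult_right mult) auto
  then show ?thesis by (simp add: R mult.assoc)
qed

text \<open>For \<open>t = s\<close>, \<open>p\<close> divides \<open>w t\<close> exactly once,
  which makes the estimate sharp; the error term cannot disturb this, as it is \<open>P\<close>
  times a multiple of the nonunit \<open>a - c\<close>.\<close>

lemma a_minus_c_power_vdvd_P:
  assumes "t = s"
  shows "(a - c) ^ q t \<preceq> P"
proof -
  obtain R where R: "R \<in> V" "a ^ q t - c ^ q t = (a - c) ^ q t + P * (a - c) * R"
    using power_diff_cong .
  obtain v where v: "v \<in> V" "a ^ q t - c ^ q t = P * v"
    using P_power_vdvd_power_diff[of t 1] t_le by (auto simp: vdvd_def)
  have "a ^ q t - c ^ q t \<preceq> of_int (w t)"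
    using E_mult[OF a order.refl] E_mem[OF a order.refl] by (intro vdvdI[of "E t a"]) simp_all
  also have "\<dots> \<preceq> P" using w_s w_dvd[of 1 s] assms by (intro int_unit_multiple) simp_all
  finally have "P * v \<preceq> P * 1" using v by simp
  then have "v \<preceq> 1" using vdvd_mult_cancel[OF P_nonzero, of v 1] by blast
  moreover have "\<not> a - c \<preceq> 1" using P_vdvd_a_minus_c_power by (rule nonunit_if_power)
  then have "\<not> (a - c) * - R \<preceq> 1" using R uminus by (meson vdvdI vdvd_trans)
  ultimately have "v + (a - c) * - R \<preceq> 1" using v R a_minus_c_mem by (intro unit_add mult uminus)
  then have "P * (v + (a - c) * - R) \<preceq> P * 1" by (rule vdvd_mult_mono[OF vdvd_refl])
  moreover have "P * (v + (a - c) * - R) = (a - c) ^ q t" using R v by (simp add: algebra_simps)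
  ultimately show ?thesis by simp
qed

text \<open>The root is \<open>b = a * \<zeta>\<close> for a root of unity \<open>\<zeta>\<close> of order \<open>q h\<close>.\<close>

lemma conjugate_root:
  assumes "h < t"
  obtains b where "b ^ n = c" "(b - c) ^ D h \<preceq> P" "P \<preceq> (b - c) ^ D h"
    "\<And>h'. h' \<le> h \<Longrightarrow> E h' b = E h' a" "\<And>h'. h < h' \<Longrightarrow> h' \<le> t \<Longrightarrow> h' < s \<Longrightarrow> P \<preceq> E h' b"
    "p = 2 \<Longrightarrow> b ^ q (Suc h) = - (a ^ q (Suc h))"
proof -
  obtain \<zeta> :: complex where \<zeta>: "\<zeta> ^ q h = 1" "\<And>i. 0 < i \<Longrightarrow> i < q h \<Longrightarrow> \<zeta> ^ i \<noteq> 1"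
    by (rule exists_primitive_root[OF q_pos[of h]]) blast
  have "h < k" using assms t_le by simp
  have q_dvd: "\<zeta> ^ q h' = 1" if "h' \<le> h" for h'
  proof -
    have "q h' = q h * p ^ (h - h')" using that \<open>h < k\<close> by (simp add: q_def flip: power_add)
    then show ?thesis using \<zeta> by (simp add: power_mult)
  qed
  have \<zeta>_mem: "\<zeta> \<in> V" by (rule root_of_unity_mem[OF \<zeta>(1) q_pos])
  define b where "b = a * \<zeta>"
  have \<zeta>n: "\<zeta> ^ n = 1" using q_dvd[of 0] by (simp add: q_0)
  then have b: "b ^ n = c" using a by (simp add: b_def power_mult_distrib)
  let ?d = "\<zeta> - 1"
  have Suc_diff: "k - h = Suc (k - Suc h)" using \<open>h < k\<close> by simp
  have qS: "q (Suc h) < q h" using q_Suc[OF \<open>h < k\<close>] q_pos[of "Suc h"] p_gt_1 by simp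
  have D: "D h = q h - q (Suc h)" using assms by (simp add: D_def)
  have d: "?d ^ D h \<preceq> P" "P \<preceq> ?d ^ D h"
    using root_of_unity_minus_one[of \<zeta> "k - Suc h"] \<zeta> \<zeta>_mem qS q_pos
    unfolding D q_def Suc_diff by simp_all
  have split: "b - c = a * ?d + (a - c)" by (simp add: b_def algebra_simps)
  \<comment> \<open>As \<open>D h \<ge> q t\<close>, the valuation of \<open>a - c\<close> is at
    least that of \<open>\<zeta> - 1\<close>, so the latter bounds the valuation of
    \<open>b - c\<close> from below.\<close>
  have "?d ^ D h \<preceq> (a - c) ^ D h"
  proof -
    have "D h = q t + (D h - q t)" using D_ge[of h] assms by simp
    then have "(a - c) ^ D h = (a - c) ^ q t * (a - c) ^ (D h - q t)" by (metis power_add)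
    moreover have "P \<preceq> \<dots>" using P_vdvd_a_minus_c_power a_minus_c_mem by (intro vdvd_mult_right power)
    ultimately show ?thesis using d vdvd_trans by metis
  qed
  then have "?d \<preceq> a - c" using D_pos by (rule vdvd_power_cancel)
  then have "?d \<preceq> b - c" unfolding split using a_mem by (intro vdvd_add vdvd_mult_left vdvd_refl)
  then have 1: "P \<preceq> (b - c) ^ D h" using d vdvd_power vdvd_trans by blast
  \<comment> \<open>Conversely, no cancellation raises the valuation of \<open>b - c\<close>,
    because \<open>b\<close> is no closer to \<open>c\<close> than \<open>a\<close>.\<close>
  have "b - c \<preceq> (b - c) - (a - c)" by (rule vdvd_diff[OF vdvd_refl closest[OF b]])
  also have "\<dots> = a * ?d" by (simp add: split)
  also have "\<dots> \<preceq> 1 * ?d" using a_unit by (rule vdvd_mult_mono) simp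
  finally have "b - c \<preceq> ?d" by simp
  then have 2: "(b - c) ^ D h \<preceq> P" using d vdvd_power vdvd_trans by blast
  have 3: "E h' b = E h' a" if "h' \<le> h" for h'
    using q_dvd[OF that] by (intro E_cong) (simp add: b_def power_mult_distrib)
  \<comment> \<open>\<open>h' < s\<close> makes \<open>P ^ 2\<close> divide
    \<open>w h' = ?Y * E h' b\<close>, while \<open>?Y\<close> is a unit times
    \<open>\<zeta> ^ q h' - 1\<close> and so divides \<open>P\<close>; one \<open>P\<close> is left
    for \<open>E h' b\<close>.\<close>
  have 4: "P \<preceq> E h' b" if h': "h < h'" "h' \<le> t" "h' < s" for h'
  proof -
    let ?\<eta> = "\<zeta> ^ q h'" and ?Y = "b ^ q h' - c ^ q h'"
    have \<eta>_mem: "?\<eta> \<in> V" using \<zeta>_mem by (rule power)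
    have "h' \<le> k" using h' t_le by simp
    have "q h' * p ^ Suc (h' - Suc h) = q h" "q h' * p ^ (h' - Suc h) = q (Suc h)"
      using h' \<open>h' \<le> k\<close> unfolding q_def Suc_diff by (simp_all flip: power_add power_Suc)
    then have "?\<eta> ^ p ^ Suc (h' - Suc h) = 1" "?\<eta> ^ p ^ (h' - Suc h) \<noteq> 1"
      using \<zeta> qS q_pos by (simp_all only: power_mult[symmetric]) auto
    then have "(?\<eta> - 1) ^ (p ^ Suc (h' - Suc h) - p ^ (h' - Suc h)) \<preceq> P"
      using \<eta>_mem by (intro root_of_unity_minus_one)
    moreover have "?\<eta> - 1 \<preceq> (?\<eta> - 1) ^ (p ^ Suc (h' - Suc h) - p ^ (h' - Suc h))"
    proof -
      have "p ^ (h' - Suc h) < p ^ Suc (h' - Suc h)" using p_gt_1 by simp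
      then obtain i where "p ^ Suc (h' - Suc h) - p ^ (h' - Suc h) = Suc i"
        by (metis Suc_pred zero_less_diff)
      then show ?thesis using \<eta>_mem by (auto intro!: vdvdI[of "(?\<eta> - 1) ^ i"] power diff one)
    qed
    ultimately have eP: "?\<eta> - 1 \<preceq> P" using vdvd_trans by blast
    then obtain u where u: "u \<in> V" "P = (?\<eta> - 1) * u" by (auto simp: vdvd_def)
    have "P ^ 2 \<preceq> a ^ q h' - c ^ q h'" using h' by (intro P_power_vdvd_power_diff) auto
    then obtain y where y: "y \<in> V" "a ^ q h' - c ^ q h' = P ^ 2 * y" by (auto simp: vdvd_def)
    have "?Y = a ^ q h' * (?\<eta> - 1) + (a ^ q h' - c ^ q h')"
      by (simp add: b_def power_mult_distrib algebra_simps)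
    also have "\<dots> = (?\<eta> - 1) * (a ^ q h' + P * (u * y))"
    proof -
      have "P ^ 2 * y = (?\<eta> - 1) * (P * (u * y))"
        using arg_cong[OF u(2), of "\<lambda>z. z * (P * y)"] by (simp add: power2_eq_square mult_ac)
      then show ?thesis unfolding y(2) by (simp add: algebra_simps)
    qed
    finally have Y: "?Y = (?\<eta> - 1) * (a ^ q h' + P * (u * y))" .
    have "\<not> P * (u * y) \<preceq> 1" using P_nonunit u y mult by (meson vdvdI vdvd_trans)
    then have "a ^ q h' + P * (u * y) \<preceq> 1"
      using a_mem a_unit u y P_mem by (intro unit_add vdvd_one_power power mult)
    then have "?Y \<preceq> (?\<eta> - 1) * 1" unfolding Y by (rule vdvd_mult_mono[OF vdvd_refl])
    then have "?Y \<preceq> P" using eP vdvd_trans[of ?Y "?\<eta> - 1" P] by simp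
    then have "?Y * P \<preceq> P * P" by (rule vdvd_mult_mono) simp
    also have "P * P \<preceq> of_int (w h')"
      using int_dvd[OF w_dvd[of 2 h']] h' by (simp add: power2_eq_square)
    also have "of_int (w h') = ?Y * E h' b" using E_mult[OF b] h' by simp
    finally have YE: "?Y * P \<preceq> ?Y * E h' b" .
    have "?Y \<noteq> 0" using E_mult[OF b h'(2)] w_nonzero[of h'] h' by auto
    then show "P \<preceq> E h' b" using YE vdvd_mult_cancel by blast
  qed
  have 5: "b ^ q (Suc h) = - (a ^ q (Suc h))" if "p = 2"
  proof -
    have "(\<zeta> ^ q (Suc h)) ^ 2 = 1" using \<zeta> q_Suc[OF \<open>h < k\<close>] that by (simp flip: power_mult)
    then have "\<zeta> ^ q (Suc h) = 1 \<or> \<zeta> ^ q (Suc h) = -1" by (simp add: power2_eq_1_iff)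
    then have "\<zeta> ^ q (Suc h) = -1" using \<zeta> qS q_pos by blast
    then show ?thesis by (simp add: b_def power_mult_distrib)
  qed
  show ?thesis by (rule that[OF b 2 1 3 4 5])
qed

end

section \<open>Isolating coefficients modulo \<open>p\<close> by evaluation at conjugate
  roots\<close>

context closest_root
begin

lemma unit_sum_not_vdvd:
  assumes "\<delta> ^ d \<preceq> P" "P \<preceq> \<delta> ^ d" "d > 0" "P \<preceq> x * \<delta> ^ (d - 1)"
  shows "\<not> x \<preceq> 1"
  using dvd_if_vdvd_power_pred[of \<delta> d x 1] assms prime_p by auto

context
  fixes u :: "nat \<Rightarrow> int"
  assumes vdvd: "b ^ n = c \<Longrightarrow> P \<preceq> (\<Sum>h\<le>t. of_int (u h) * E h b * (b - c) ^ (D h - 1))"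
begin

lemma vdvd_single_term:
  assumes "b ^ n = c" "h \<le> t"
    and "\<And>h'. h' \<le> t \<Longrightarrow> h' \<noteq> h \<Longrightarrow> P \<preceq> of_int (u h') * E h' b * (b - c) ^ (D h' - 1)"
  shows "P \<preceq> of_int (u h) * E h b * (b - c) ^ (D h - 1)"
proof -
  let ?f = "\<lambda>h. of_int (u h) * E h b * (b - c) ^ (D h - 1)"
  have "(\<Sum>h\<le>t. ?f h) = ?f h + (\<Sum>h\<in>{..t} - {h}. ?f h)" using assms by (intro sum.remove) auto
  moreover have "P \<preceq> (\<Sum>h\<in>{..t} - {h}. ?f h)" using assms(3) by (intro vdvd_sum) auto
  ultimately show ?thesis using vdvd[OF assms(1)] by (simp only: vdvd_add_cancel)
qed

lemma term_vdvd_if_dvd: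
  assumes "b ^ n = c" "h \<le> t" "int p dvd u h"
  shows "P \<preceq> of_int (u h) * E h b * (b - c) ^ (D h - 1)"
  using int_dvd[of 1 "u h"] assms root_mem[of b] c_mem
  by (intro vdvd_mult_right power diff E_mem) auto

lemma term_vdvd_if_power:
  assumes b: "b ^ n = c" "h \<le> t" and "P \<preceq> (b - c) ^ d" "d < D h"
  shows "P \<preceq> of_int (u h) * E h b * (b - c) ^ (D h - 1)"
proof -
  have "(b - c) ^ (D h - 1) = (b - c) ^ d * (b - c) ^ (D h - 1 - d)"
    using assms by (simp flip: power_add)
  also have "P \<preceq> \<dots>" using assms root_mem[of b] c_mem by (intro vdvd_mult_right power diff)
  finally show ?thesis using b by (intro vdvd_mult_left mult of_int E_mem)
qed

text \<open>Evaluation at \<open>a\<close> isolates the last coefficient unless \<open>p = 2\<close>, where the coefficient before it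
  enters with the same valuation. It is doubled upon adding the value at the conjugate root \<open>b\<close>,
  while \<open>E t a + E t b\<close> is a unit.\<close>

lemma last_term:
  assumes "t = s"
  shows "int p dvd u t"
proof (cases "\<forall>h<t. q t < D h")
  case True
  have "P \<preceq> of_int (u t) * E t a * (a - c) ^ (D t - 1)"
  proof (rule vdvd_single_term[OF a order.refl])
    fix h assume h: "h \<le> t" "h \<noteq> t"
    then show "P \<preceq> of_int (u h) * E h a * (a - c) ^ (D h - 1)"
      using True by (intro term_vdvd_if_power[OF a h(1) P_vdvd_a_minus_c_power]) auto
  qed
  then show ?thesis
    using a_minus_c_power_vdvd_P[OF assms] P_vdvd_a_minus_c_power D_pos[of t]
    by (intro dvd_if_vdvd_power_pred[of "a - c" "D t" "E t a"] E_unit) (simp_all add: D_def)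
next
  case False
  then obtain h where h: "h < t" "D h \<le> q t" by force
  \<comment> \<open>\<open>D h\<close> is \<open>p - 1\<close> times \<open>q (Suc h)\<close>, which
    can be as small as \<open>q t\<close> only if \<open>p = 2\<close> and
    \<open>h = t - 1\<close>.\<close>
  have "q t \<le> q (Suc h)" using h by (simp add: q_antimono)
  moreover have "q (Suc h) * 1 \<le> q (Suc h) * (p - 1)" using p_gt_1 by (intro mult_left_mono) auto
  ultimately have "q (Suc h) = q t" "q (Suc h) * (p - 1) = q (Suc h)"
    using h D_less[of h] by linarith+
  then have "p = 2" using q_pos[of "Suc h"] p_gt_1 by simp
  have "k - Suc h = k - t" using \<open>q (Suc h) = q t\<close> p_gt_1 by (simp add: q_def)
  then have t: "t = Suc h" using h t_le by simp
  then have "h < k" using t_le by simp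
  have Dh: "D h = q t" using D_less[of h] by (simp add: t \<open>p = 2\<close>)
  have Dless: "q t < D h'" if "h' < h" for h'
  proof -
    have "h' < k" using that \<open>h < k\<close> by simp
    have "q t = q (Suc h)" by (simp add: t)
    also have "\<dots> < q h" using q_Suc[OF \<open>h < k\<close>] q_pos[of "Suc h"] p_gt_1 by simp
    also have "q h \<le> q (Suc h')" using that by (intro q_antimono) simp
    also have "q (Suc h') = D h'" using D_less[of h'] that h(1) by (simp add: \<open>p = 2\<close>)
    finally show ?thesis .
  qed
  obtain b where b: "b ^ n = c" "(b - c) ^ D h \<preceq> P" "P \<preceq> (b - c) ^ D h"
    "\<And>h'. h' \<le> h \<Longrightarrow> E h' b = E h' a" "p = 2 \<Longrightarrow> b ^ q (Suc h) = - (a ^ q (Suc h))"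
    using conjugate_root[OF h(1)] by metis
  \<comment> \<open>Terms with index below \<open>h\<close> have \<open>D h' > q t\<close> and
    vanish modulo \<open>P\<close>; the last two share the exponent \<open>q t - 1\<close>, so only
    their combined coefficient is seen.\<close>
  have nonunit: "\<not> of_int (u t) * E t x + of_int (u h) * E h a \<preceq> 1"
    if x: "x ^ n = c" "(x - c) ^ q t \<preceq> P" "P \<preceq> (x - c) ^ q t" "E h x = E h a" for x
  proof -
    have set: "{..t} = insert t (insert h {..<h})" by (auto simp: t)
    have "D t = q t" by (simp add: D_def)
    then have "(\<Sum>h'\<le>t. of_int (u h') * E h' x * (x - c) ^ (D h' - 1)) =
        (of_int (u t) * E t x + of_int (u h) * E h a) * (x - c) ^ (q t - 1) +
        (\<Sum>h'<h. of_int (u h') * E h' x * (x - c) ^ (D h' - 1))" (is "_ = ?X + ?Y")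
      unfolding set using x(4) Dh \<open>D t = q t\<close> h(1) by (simp add: distrib_right)
    then have *: "P \<preceq> ?X + ?Y" using vdvd[OF x(1)] by simp
    have "P \<preceq> ?Y"
      using Dless h(1) by (intro vdvd_sum term_vdvd_if_power[OF x(1) _ x(3)]) auto
    with * have "P \<preceq> ?X" by (rule vdvd_add_cancel)
    then show ?thesis using x q_pos by (intro unit_sum_not_vdvd)
  qed
  let ?q = "q t"
  \<comment> \<open>For \<open>p = 2\<close> the factor in \<open>E_Suc\<close> is
    \<open>x ^ q t + c ^ q t\<close>; the powers of \<open>a\<close> and \<open>b\<close> are
    opposite and cancel in the sum.\<close>
  have geo2: "P * E t x = E h x * (x ^ ?q + c ^ ?q)" for x
    using E_Suc[OF \<open>h < k\<close>, of x, folded t] \<open>p = 2\<close> by (simp add: ipoly_geo numeral_2_eq_2 algebra_simps)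
  have "P * (E t a + E t b) = P * (E h a * c ^ ?q)"
    using geo2[of a] geo2[of b] b(4)[of h] b(5)[folded t] \<open>p = 2\<close> by (simp add: algebra_simps)
  then have sum_E: "E t a + E t b = E h a * c ^ ?q" by (simp only: mult_cancel_left P_nonzero simp_thms)
  show ?thesis
  proof (rule ccontr)
    assume "\<not> int p dvd u t"
    then have 1: "of_int (u t) * (E h a * c ^ ?q) \<preceq> 1"
      using h E_unit[of h] vdvd_one_power[OF c_unit] int_unit[of "u t"] by (intro vdvd_one_mult) auto
    let ?X = "\<lambda>x. of_int (u t) * E t x + of_int (u h) * E h a"
    have "?X a \<in> V" "?X b \<in> V" using a b(1) h by (auto intro!: add mult of_int E_mem)
    moreover have "\<not> ?X a \<preceq> 1" "\<not> ?X b \<preceq> 1"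
      using nonunit[OF a a_minus_c_power_vdvd_P[OF assms] P_vdvd_a_minus_c_power]
        nonunit[OF b(1)] b Dh by auto
    ultimately have "\<not> ?X a + ?X b \<preceq> 1" by (rule nonunit_add)
    moreover have "?X a + ?X b = of_int (u t) * (E h a * c ^ ?q) + P * (of_int (u h) * E h a)"
      unfolding sum_E[symmetric] using \<open>p = 2\<close> by (simp add: algebra_simps)
    moreover have "of_int (u t) * (E h a * c ^ ?q) + P * (of_int (u h) * E h a) \<preceq> 1"
    proof (rule unit_add[OF 1])
      have 2: "of_int (u h) * E h a \<in> V" using a h by (auto intro!: mult of_int E_mem)
      show "of_int (u t) * (E h a * c ^ ?q) \<in> V" using a h c_mem by (auto intro!: mult power of_int E_mem)
      show "P * (of_int (u h) * E h a) \<in> V" using P_mem 2 by (rule mult)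
      show "\<not> P * (of_int (u h) * E h a) \<preceq> 1" using P_nonunit 2 by (meson vdvdI vdvd_trans)
    qed
    ultimately show False by simp
  qed
qed

text \<open>At the conjugate root for \<open>h\<close>, earlier terms vanish modulo \<open>P\<close>
  by induction, those with \<open>h < h' < s\<close> because \<open>P\<close> divides
  \<open>E h' b\<close>, and the remaining possibility \<open>h' = t = s\<close> through
  \<open>last_term\<close>.\<close>

lemma lower_terms:
  assumes "h < t"
  shows "int p dvd u h"
  using assms
proof (induction h rule: less_induct)
  case (less h)
  obtain b where b: "b ^ n = c" "(b - c) ^ D h \<preceq> P" "P \<preceq> (b - c) ^ D h"
    "\<And>h'. h' \<le> h \<Longrightarrow> E h' b = E h' a" "\<And>h'. h < h' \<Longrightarrow> h' \<le> t \<Longrightarrow> h' < s \<Longrightarrow> P \<preceq> E h' b"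
    using conjugate_root[OF less.prems] by metis
  have "h \<le> t" using less.prems by simp
  have "P \<preceq> of_int (u h) * E h b * (b - c) ^ (D h - 1)"
  proof (rule vdvd_single_term[OF b(1) \<open>h \<le> t\<close>])
    fix h' assume h': "h' \<le> t" "h' \<noteq> h"
    show "P \<preceq> of_int (u h') * E h' b * (b - c) ^ (D h' - 1)"
    proof (cases "h < h' \<and> h' < s")
      case True
      then show ?thesis
        using b(5)[of h'] h' root_mem[OF b(1)] c_mem
        by (intro vdvd_mult_right vdvd_mult_left power diff of_int) auto
    next
      case False
      then have "h' < h \<or> h' = t \<and> t = s" using h' t_le by auto
      then have "int p dvd u h'" using less last_term by auto
      then show ?thesis using b(1) h' by (intro term_vdvd_if_dvd)
    qed
  qed
  then show ?case
    using b D_pos[of h] E_unit[OF \<open>h \<le> t\<close>]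
    by (intro dvd_if_vdvd_power_pred[of "b - c" "D h" "E h b" "u h"]) auto
qed

lemma all_terms:
  assumes "h \<le> t"
  shows "int p dvd u h"
proof (cases "h < t \<or> t = s")
  case True
  then show ?thesis using assms lower_terms last_term by (cases "h = t") auto
next
  case False
  \<comment> \<open>Here \<open>q t = D t = 1\<close>: the last term carries no power of
    \<open>a - c\<close>, so \<open>P\<close> itself with exponent 1 serves as
    \<open>\<delta>\<close>.\<close>
  then have "h = t" "t = k" using assms t_def by auto
  have "P \<preceq> of_int (u t) * E t a * (a - c) ^ (D t - 1)"
    using lower_terms by (intro vdvd_single_term[OF a order.refl] term_vdvd_if_dvd a) auto
  moreover have "D t = q t" by (simp add: D_def)
  moreover have "q t = 1" by (simp add: q_def \<open>t = k\<close>)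
  ultimately show ?thesis
    using dvd_if_vdvd_power_pred[of P 1 "E t a" "u t"] E_unit[of t] \<open>h = t\<close> by simp
qed

end

end

context pure_prime_power
begin

lemma dvd_if_alg_int_sum:
  assumes x: "x ^ n = of_int m"
    and int: "alg_int ((\<Sum>h\<le>t. of_int (u h) * E h x * (x - of_int m) ^ (D h - 1)) / of_nat p)"
    and "h \<le> t"
  shows "int p dvd u h"
proof -
  \<comment> \<open>The denominators \<open>p ^ h\<close> are all brought to \<open>p ^ t\<close>,
    because conjugation is available for an integer polynomial over one fixed integer.\<close>
  define G where
    "G = (\<Sum>h\<le>t. smult (u h * int p ^ (t - h)) (geo m (q h) (p ^ h) * [:-m, 1:] ^ (D h - 1)))"
  let ?N = "int p ^ Suc t"
  have G: "ipoly G y / of_int ?N = (\<Sum>h\<le>t. of_int (u h) * E h y * (y - of_int m) ^ (D h - 1)) / of_nat p" for y :: complex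
  proof -
    have "ipoly G y = (\<Sum>h\<le>t. of_nat p ^ t * (of_int (u h) * E h y * (y - of_int m) ^ (D h - 1)))"
      unfolding G_def ipoly_sum
    proof (intro sum.cong refl)
      fix h assume "h \<in> {..t}"
      then have "(of_nat p :: complex) ^ t = of_nat p ^ (t - h) * of_nat p ^ h" by (simp flip: power_add)
      then show "ipoly (smult (u h * int p ^ (t - h)) (geo m (q h) (p ^ h) * [:-m, 1:] ^ (D h - 1))) y =
          of_nat p ^ t * (of_int (u h) * E h y * (y - of_int m) ^ (D h - 1))"
        using p_gt_0 by (simp add: ipoly_smult ipoly_mult ipoly_power map_poly_pCons E_def)
    qed
    then show ?thesis using p_gt_0 by (simp flip: sum_distrib_left)
  qed
  have conj: "alg_int ((\<Sum>h\<le>t. of_int (u h) * E h y * (y - of_int m) ^ (D h - 1)) / of_nat p)"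
    if "y ^ n = of_int m" for y
    using alg_int_conjugate[OF x that, of ?N G] int p_gt_0 unfolding G by simp
  obtain V where "valuation_ring_above V p" using exists_valuation_ring_above[OF prime_p] .
  then interpret valuation_ring_above V p .
  interpret pure_prime_power_valuation m l n p k s t V ..
  obtain a where a: "a ^ n = of_int m" "\<And>b. b ^ n = of_int m \<Longrightarrow> vdvd (b - of_int m) (a - of_int m)"
    using exists_closest_root[OF x] by metis
  interpret closest_root m l n p k s t V a
    using a by unfold_locales auto
  show ?thesis
  proof (rule all_terms[OF _ \<open>h \<le> t\<close>])
    fix b :: complex assume b: "b ^ n = of_int m"
    show "vdvd (of_nat p) (\<Sum>h\<le>t. of_int (u h) * E h b * (b - of_int m) ^ (D h - 1))"
      using alg_int_mem[OF conj[OF b]] p_gt_0 by (intro vdvdI[OF alg_int_mem[OF conj[OF b]]]) simp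
  qed
qed

end

section \<open>The index of the order generated by a root\<close>

lemma Zadj_shift: "Zadj x \<subseteq> Zadj (x - of_int j)"
proof
  fix z assume "z \<in> Zadj x"
  then obtain g where z: "z = ipoly g x" by (rule mem_ZadjE)
  interpret subring_set "Zadj (x - of_int j)" by (rule subring_Zadj)
  have "(x - of_int j) + of_int j \<in> Zadj (x - of_int j)"
    using mem_Zadj by (intro add of_int)
  then show "z \<in> Zadj (x - of_int j)" unfolding z by (intro poly_of_int) simp
qed

context pure_prime_power
begin

text \<open>The \<open>\<int>[x]\<close>-module generated by \<open>E 0 x = 1\<close>, \<dots>, \<open>E h x\<close>.\<close>

primrec M :: "nat \<Rightarrow> complex \<Rightarrow> complex set" where
  "M 0 x = Zadj x"
| "M (Suc h) x = {y + E (Suc h) x * z | y z. y \<in> M h x \<and> z \<in> Zadj x}"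

lemma Zadj_mult: "y \<in> Zadj x \<Longrightarrow> z \<in> Zadj x \<Longrightarrow> y * z \<in> Zadj x"
  by (rule subring_set.mult[OF subring_Zadj])

lemma M_diff: "y \<in> M h x \<Longrightarrow> y' \<in> M h x \<Longrightarrow> y - y' \<in> M h x"
proof (induction h arbitrary: y y')
  case 0
  then show ?case using subring_set.diff[OF subring_Zadj] by simp
next
  case (Suc h)
  then obtain u z u' z' where "y = u + E (Suc h) x * z" "y' = u' + E (Suc h) x * z'"
    "u \<in> M h x" "z \<in> Zadj x" "u' \<in> M h x" "z' \<in> Zadj x" by auto
  then have "y - y' = (u - u') + E (Suc h) x * (z - z')" "u - u' \<in> M h x" "z - z' \<in> Zadj x"
    using Suc.IH subring_set.diff[OF subring_Zadj] by (auto simp: algebra_simps)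
  then show ?case by auto
qed

lemma M_mult: "y \<in> M h x \<Longrightarrow> z \<in> Zadj x \<Longrightarrow> y * z \<in> M h x"
proof (induction h arbitrary: y)
  case 0
  then show ?case using Zadj_mult by simp
next
  case (Suc h)
  then obtain u z' where "y = u + E (Suc h) x * z'" "u \<in> M h x" "z' \<in> Zadj x" by auto
  then have "y * z = u * z + E (Suc h) x * (z' * z)" "u * z \<in> M h x" "z' * z \<in> Zadj x"
    using Suc Zadj_mult by (auto simp: algebra_simps)
  then show ?case by auto
qed

lemma M_mono: "h \<le> h' \<Longrightarrow> M h x \<subseteq> M h' x"
proof (induction h' rule: dec_induct)
  case (step h')
  have "M h' x \<subseteq> M (Suc h') x"
  proof
    fix y assume "y \<in> M h' x"
    then have "y = y + E (Suc h') x * 0 \<and> y \<in> M h' x \<and> 0 \<in> Zadj x"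
      using subring_set.zero[OF subring_Zadj] by simp
    then show "y \<in> M (Suc h') x" unfolding M.simps by blast
  qed
  then show ?case using step by blast
qed simp

lemma Zadj_subset_M: "Zadj x \<subseteq> M h x"
  using M_mono[of 0 h x] by simp

lemma M_zero: "0 \<in> M h x"
  using Zadj_subset_M subring_set.zero[OF subring_Zadj] by blast

lemma add_subgroup_M: "add_subgroup (M h x)"
  using M_zero M_diff by (simp add: add_subgroup_def)

lemmas M_add = add_subgroup_add[OF add_subgroup_M]

lemma E_mult_mem_M:
  assumes "h \<le> h'" "z \<in> Zadj x"
  shows "E h x * z \<in> M h' x"
proof -
  have "E h x * z \<in> M h x"
  proof (cases h)
    case (Suc j)
    have "E h x * z = 0 + E h x * z" by simp
    then show ?thesis unfolding Suc M.simps using M_zero assms by blast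
  qed (use assms E_0 in simp)
  then show ?thesis using M_mono[OF assms(1)] by blast
qed

lemma M_subset_ring_of_ints:
  assumes "x ^ n = of_int m" "h \<le> t"
  shows "M h x \<subseteq> ring_of_ints x"
  using assms(2)
proof (induction h)
  case 0
  then show ?case using Zadj_subset_ring_of_ints alg_int_root assms(1) by simp
next
  case (Suc h)
  interpret O: subring_set "ring_of_ints x" by (rule subring_ring_of_ints)
  interpret K: subring_set "num_field x" by (rule subring_num_field)
  have "(1 / of_nat p ^ Suc h :: complex) \<in> \<rat>" by simp
  then have "1 / of_nat p ^ Suc h \<in> num_field x" using Rats_subset_num_field by blast
  then have "ipoly (geo m (q (Suc h)) (p ^ Suc h)) x * (1 / of_nat p ^ Suc h) \<in> num_field x"
    using ipoly_mem_Zadj Zadj_subset_num_field by (intro K.mult) auto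
  then have "E (Suc h) x \<in> ring_of_ints x"
    using alg_int_E[OF assms(1) Suc.prems] by (simp add: ring_of_ints_def E_def)
  then show ?case
    using Suc Zadj_subset_ring_of_ints[OF alg_int_root[OF assms(1)]] by (auto intro!: O.add O.mult)
qed

lemma power_mult_M: "y \<in> M h x \<Longrightarrow> of_nat p ^ h * y \<in> Zadj x"
proof (induction h arbitrary: y)
  case (Suc h)
  interpret subring_set "Zadj x" by (rule subring_Zadj)
  obtain u z where y: "y = u + E (Suc h) x * z" and u: "u \<in> M h x" and z: "z \<in> Zadj x"
    using Suc.prems by auto
  have "of_nat p ^ Suc h * y = of_nat p * (of_nat p ^ h * u) + ipoly (geo m (q (Suc h)) (p ^ Suc h)) x * z"
    using p_gt_0 by (simp add: y E_def algebra_simps)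
  also have "\<dots> \<in> Zadj x" by (intro add mult[OF of_nat Suc.IH[OF u]] mult[OF ipoly_mem_Zadj z])
  finally show ?case .
qed simp

text \<open>The element is a monic polynomial of degree below \<open>n\<close> in \<open>x\<close> divided by \<open>p ^ Suc h\<close>, whereas
  the denominators in \<open>M h x\<close> divide \<open>p ^ h\<close>.\<close>

lemma E_mult_monic_notin_M:
  assumes x: "x ^ n = of_int m" and "Suc h \<le> k" and G: "lead_coeff G = 1" "degree G < q (Suc h)"
  shows "E (Suc h) x * ipoly G x \<notin> M h x"
proof
  assume "E (Suc h) x * ipoly G x \<in> M h x"
  then have "of_nat p ^ h * (E (Suc h) x * ipoly G x) \<in> Zadj x" by (rule power_mult_M)
  then obtain H where H: "of_nat p ^ h * (E (Suc h) x * ipoly G x) = ipoly H x" by (rule mem_ZadjE)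
  obtain u r where r: "\<forall>i\<ge>n. coeff r i = 0" "ipoly H x = ipoly r x"
    using monic_reduction[of H] x by metis
  let ?F = "geo m (q (Suc h)) (p ^ Suc h)"
  obtain j where j: "p ^ Suc h = Suc j" using p_gt_0 by (metis Suc_pred zero_less_power)
  have "lead_coeff ?F = 1" unfolding j using q_pos by (rule lead_coeff_geo)
  then have "?F \<noteq> 0" "G \<noteq> 0" using G by auto
  then have deg: "degree (?F * G) = q (Suc h) * j + degree G"
    unfolding j using q_pos by (simp add: degree_mult_eq degree_geo)
  have "q (Suc h) * Suc j = n" using q_mult[OF \<open>Suc h \<le> k\<close>] j by simp
  then have "degree (?F * G) < n" using deg G by simp
  then have F0: "coeff (?F * G) i = 0" if "i \<ge> n" for i using that by (intro coeff_eq_0) simp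
  have "ipoly (?F * G) x = ipoly (smult (int p) r) x"
    using H r p_gt_0 by (simp add: E_def ipoly_mult ipoly_smult field_simps)
  then have eq: "?F * G = smult (int p) r"
    using ipoly_eq_iff[OF x F0] r by simp
  have "lead_coeff (?F * G) = 1" using lead_coeff_geo[OF q_pos] j G by (simp add: lead_coeff_mult)
  then have "int p dvd 1" unfolding eq by (metis coeff_smult dvd_triv_left)
  then show False using p_gt_1 by simp
qed

text \<open>\<open>L i\<close> allows multiples of \<open>E (Suc h) x\<close> by polynomials of
  degree below \<open>i\<close>. Each further power of \<open>x\<close> multiplies the index by
  \<open>p\<close>, up to \<open>i = q (Suc h)\<close>; there \<open>x ^ i - m ^ i\<close> turns
  \<open>E (Suc h) x\<close> into an integer and nothing new arises.\<close>

lemma card_add_cosets_M_Suc: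
  assumes x: "x ^ n = of_int m" and h: "Suc h \<le> t"
  shows "card (add_cosets (M (Suc h) x) (M h x)) = p ^ q (Suc h)"
proof -
  define L where
    "L i = {y + E (Suc h) x * ipoly g x | y g. y \<in> M h x \<and> (\<forall>j\<ge>i. coeff g j = 0)}" for i
  have "Suc h \<le> k" using h t_le by simp
  have L_0: "L 0 = M h x"
  proof -
    have "(\<forall>j\<ge>0. coeff g j = 0) \<longleftrightarrow> g = 0" for g :: "int poly" by (simp add: poly_eq_iff)
    then show ?thesis by (simp add: L_def)
  qed
  have L_Suc: "L (Suc i) = {l + of_int j * (E (Suc h) x * x ^ i) | l j. l \<in> L i}" for i
  proof (intro set_eqI iffI)
    fix z assume "z \<in> L (Suc i)"
    then obtain y g where yg: "z = y + E (Suc h) x * ipoly g x" "y \<in> M h x" "\<forall>j\<ge>Suc i. coeff g j = 0"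
      by (auto simp: L_def)
    let ?g = "g - monom (coeff g i) i"
    have g: "\<forall>j\<ge>i. coeff ?g j = 0"
    proof (intro allI impI)
      fix j assume "i \<le> j"
      then show "coeff ?g j = 0" using yg(3) by (cases "j = i") auto
    qed
    have "z = (y + E (Suc h) x * ipoly ?g x) + of_int (coeff g i) * (E (Suc h) x * x ^ i)"
      by (simp add: yg(1) ipoly_diff ipoly_monom algebra_simps)
    moreover have "y + E (Suc h) x * ipoly ?g x \<in> L i" using yg(2) g unfolding L_def by blast
    ultimately show "z \<in> {l + of_int j * (E (Suc h) x * x ^ i) | l j. l \<in> L i}" by blast
  next
    fix z assume "z \<in> {l + of_int j * (E (Suc h) x * x ^ i) | l j. l \<in> L i}"
    then obtain y g j where yg: "z = y + E (Suc h) x * ipoly g x + of_int j * (E (Suc h) x * x ^ i)"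
      "y \<in> M h x" "\<forall>j\<ge>i. coeff g j = 0" by (auto simp: L_def)
    then have "z = y + E (Suc h) x * ipoly (g + monom j i) x"
      by (simp add: ipoly_add ipoly_monom algebra_simps)
    moreover have "\<forall>j'\<ge>Suc i. coeff (g + monom j i) j' = 0" using yg(3) by simp
    ultimately show "z \<in> L (Suc i)" using yg(2) unfolding L_def by blast
  qed
  have subgroup: "add_subgroup (L i)" for i
    by (induction i) (simp_all only: L_0 L_Suc add_subgroup_M add_subgroup_adjoin)
  have mono: "L i \<subseteq> L (Suc i)" "M h x \<subseteq> L i" for i
    unfolding L_def by (blast intro: Suc_leD, force intro: exI[of _ 0])
  have step: "card (add_cosets (L (Suc i)) (L i)) = p" if "i < q (Suc h)" for i
    unfolding L_Suc
  proof (rule card_add_cosets_adjoin_prime[OF subgroup prime_p])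
    have "of_nat p * (E (Suc h) x * x ^ i) = E h x * (ipoly (geo m (q (Suc h)) p) x * x ^ i)"
      using E_Suc[of h x] \<open>Suc h \<le> k\<close> by (simp flip: mult.assoc)
    also have "\<dots> \<in> M h x"
      using ipoly_mem_Zadj subring_set.power[OF subring_Zadj mem_Zadj]
      by (intro E_mult_mem_M Zadj_mult) auto
    finally show "of_nat p * (E (Suc h) x * x ^ i) \<in> L i" using mono(2) by blast
    show "E (Suc h) x * x ^ i \<notin> L i"
    proof
      assume "E (Suc h) x * x ^ i \<in> L i"
      then obtain y g where yg: "E (Suc h) x * x ^ i = y + E (Suc h) x * ipoly g x" "y \<in> M h x"
        "\<forall>j\<ge>i. coeff g j = 0" by (auto simp: L_def)
      let ?G = "monom 1 i - g"
      have co: "coeff ?G i = 1" "\<And>j. j > i \<Longrightarrow> coeff ?G j = 0" using yg(3) by auto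
      then have deg: "degree ?G = i" by (intro antisym degree_le le_degree) auto
      have "E (Suc h) x * ipoly ?G x = y" using yg(1) by (simp add: ipoly_diff ipoly_monom algebra_simps)
      then show False
        using E_mult_monic_notin_M[OF x \<open>Suc h \<le> k\<close>, of ?G] yg(2) co(1) that deg by simp
    qed
  qed
  have "card (add_cosets (L i) (M h x)) = p ^ i" if "i \<le> q (Suc h)" for i
    using that
  proof (induction i)
    case 0
    then show ?case by (simp add: L_0 add_cosets_same[OF add_subgroup_M])
  next
    case (Suc i)
    have "card (add_cosets (L (Suc i)) (M h x)) =
        card (add_cosets (L (Suc i)) (L i)) * card (add_cosets (L i) (M h x))"
      using subgroup mono add_subgroup_M by (intro card_add_cosets_mult)
    then show ?case using Suc step by simp
  qed
  moreover have "L (q (Suc h)) = M (Suc h) x"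
  proof (intro set_eqI iffI)
    fix z assume "z \<in> L (q (Suc h))"
    then show "z \<in> M (Suc h) x" unfolding L_def M.simps using ipoly_mem_Zadj by blast
  next
    fix z assume "z \<in> M (Suc h) x"
    then obtain y g where z: "z = y + E (Suc h) x * ipoly g x" and y: "y \<in> M h x"
      by (auto elim!: mem_ZadjE)
    obtain u r where ur: "g = (monom 1 (q (Suc h)) - [:m ^ q (Suc h):]) * u + r"
      "\<forall>i\<ge>q (Suc h). coeff r i = 0"
      using monic_division[of "monom 1 (q (Suc h)) - [:m ^ q (Suc h):]" g]
        degree_monom_diff_const[OF q_pos] by metis
    have "E (Suc h) x * ipoly g x =
        (x ^ q (Suc h) - of_int m ^ q (Suc h)) * E (Suc h) x * ipoly u x + E (Suc h) x * ipoly r x"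
      unfolding ur(1) by (simp add: ipoly_simps algebra_simps)
    then have "z = (y + of_int (w (Suc h)) * ipoly u x) + E (Suc h) x * ipoly r x"
      using E_mult[OF x h] by (simp add: z)
    moreover have "of_int (w (Suc h)) * ipoly u x \<in> M h x"
      using Zadj_subset_M ipoly_mem_Zadj subring_set.of_int[OF subring_Zadj] Zadj_mult by blast
    ultimately show "z \<in> L (q (Suc h))" using y ur(2) M_add unfolding L_def by blast
  qed
  ultimately show ?thesis using order.refl by metis
qed

lemma card_add_cosets_M:
  assumes "x ^ n = of_int m" "h \<le> t"
  shows "card (add_cosets (M h x) (Zadj x)) = p ^ (\<Sum>i<h. q (Suc i))"
  using assms(2)
proof (induction h)
  case 0
  then show ?case
    using add_cosets_same[OF subring_set.add_subgroup[OF subring_Zadj]] by simp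
next
  case (Suc h)
  have "card (add_cosets (M (Suc h) x) (Zadj x)) =
      card (add_cosets (M (Suc h) x) (M h x)) * card (add_cosets (M h x) (Zadj x))"
    using M_mono[of h "Suc h" x] Zadj_subset_M subring_set.add_subgroup[OF subring_Zadj]
    by (intro card_add_cosets_mult add_subgroup_M) auto
  then show ?case
    using Suc card_add_cosets_M_Suc[OF assms(1) Suc.prems] by (simp add: power_add mult.commute)
qed

section \<open>The module \<open>M\<close> modulo \<open>p\<close> and its saturation at
  \<open>p\<close>\<close>

definition pM :: "complex \<Rightarrow> complex set" where
  "pM x = (*) (of_nat p) ` M t x"

lemma pM_mult: "y \<in> pM x \<Longrightarrow> z \<in> Zadj x \<Longrightarrow> y * z \<in> pM x"
  using M_mult by (auto simp: pM_def mult.assoc)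

lemma pM_diff: "y \<in> pM x \<Longrightarrow> z \<in> pM x \<Longrightarrow> y - z \<in> pM x"
  using M_diff by (auto simp: pM_def simp flip: right_diff_distrib)

lemma pM_zero: "0 \<in> pM x"
  using M_zero by (auto simp: pM_def intro: image_eqI[of _ _ 0])

lemma add_subgroup_pM: "add_subgroup (pM x)"
  using pM_zero pM_diff by (simp add: add_subgroup_def)

lemma pM_add: "y \<in> pM x \<Longrightarrow> z \<in> pM x \<Longrightarrow> y + z \<in> pM x"
  by (rule add_subgroup_add[OF add_subgroup_pM])

lemma pM_sum: "(\<And>i. i \<in> A \<Longrightarrow> f i \<in> pM x) \<Longrightarrow> sum f A \<in> pM x"
  by (induction A rule: infinite_finite_induct) (auto intro: pM_zero pM_add)

lemma shift_power_mem_Zadj: "(x - of_int m) ^ i \<in> Zadj x"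
proof -
  interpret subring_set "Zadj x" by (rule subring_Zadj)
  show ?thesis using mem_Zadj by (intro power diff of_int)
qed

text \<open>For \<open>h < t\<close>, \<open>p * E (Suc h) x\<close> is \<open>E h x\<close> times a
  polynomial congruent to \<open>(X - m) ^ D h\<close>. For \<open>h = t\<close> the chain ends with
  \<open>(x ^ q t - m ^ q t) * E t x = w t\<close>, divisible by \<open>p\<close>.\<close>

lemma E_mult_power_mem_pM:
  assumes x: "x ^ n = of_int m" and h: "h \<le> t" and "D h \<le> i"
  shows "E h x * (x - of_int m) ^ i \<in> pM x"
proof -
  have "E h x * (x - of_int m) ^ D h \<in> pM x"
  proof (cases "h < t")
    case True
    then have "h < k" using t_le by simp
    then have D: "D h = p ^ Suc (k - Suc h) - p ^ (k - Suc h)"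
      using True by (simp add: D_def q_def Suc_diff_Suc)
    obtain R where "geo m (q (Suc h)) p = [:-m, 1:] ^ D h + of_nat p * R"
      using geo_cong_power[OF prime_p, of m "k - Suc h"] D unfolding q_def by auto
    then have "ipoly (geo m (q (Suc h)) p) x = (x - of_int m) ^ D h + of_nat p * ipoly R x"
      by (simp add: ipoly_simps of_nat_poly)
    then have "E h x * (x - of_int m) ^ D h = of_nat p * (E (Suc h) x * 1 - E h x * ipoly R x)"
      using E_Suc[OF \<open>h < k\<close>, of x] by (simp add: algebra_simps)
    moreover have "E (Suc h) x * 1 - E h x * ipoly R x \<in> M t x"
      using True ipoly_mem_Zadj subring_set.one[OF subring_Zadj]
      by (intro M_diff E_mult_mem_M) auto
    ultimately show ?thesis by (auto simp: pM_def)
  next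
    case False
    then have "h = t" "D h = q h" using h by (auto simp: D_def)
    obtain R where "monom 1 (q h) - [:m ^ q h:] = [:-m, 1:] ^ q h + of_nat p * [:-m, 1:] * R"
      using monom_diff_const_cong_power[OF prime_p, of "k - h" m] unfolding q_def by blast
    then have "ipoly (monom 1 (q h) - [:m ^ q h:]) x = ipoly ([:-m, 1:] ^ q h + of_nat p * ([:-m, 1:] * R)) x"
      by (simp only: mult.assoc)
    then have cong: "x ^ q h - of_int m ^ q h = (x - of_int m) ^ q h + of_nat p * ipoly ([:-m, 1:] * R) x"
      by (simp add: ipoly_diff ipoly_add ipoly_power ipoly_monom ipoly_of_nat_mult map_poly_pCons
          del: mult_pCons_left)
    obtain w' where w': "w h = int p * w'" using w_dvd[of 1 h] h t_le by auto
    have "(x ^ q h - of_int m ^ q h) * E h x = of_nat p * of_int w'"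
      using E_mult[OF x h] by (simp add: w')
    then have "E h x * (x - of_int m) ^ D h = of_nat p * (of_int w' - E h x * ipoly ([:-m, 1:] * R) x)"
      unfolding cong \<open>D h = q h\<close> by (simp add: algebra_simps del: mult_pCons_left)
    moreover have "of_int w' - E h x * ipoly ([:-m, 1:] * R) x \<in> M t x"
      using h ipoly_mem_Zadj Zadj_subset_M subring_set.of_int[OF subring_Zadj]
      by (intro M_diff E_mult_mem_M) blast+
    ultimately show ?thesis by (auto simp: pM_def)
  qed
  then have "E h x * (x - of_int m) ^ D h * (x - of_int m) ^ (i - D h) \<in> pM x"
    using shift_power_mem_Zadj by (rule pM_mult)
  then show ?thesis using \<open>D h \<le> i\<close> by (simp add: mult.assoc flip: power_add)
qed

text \<open>Exponents are counted down from \<open>D h - 1\<close>, so that multiplication by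
  \<open>(x - m) ^ d\<close> brings the terms with index \<open>d\<close> to top degree for all
  \<open>h\<close> at once.\<close>

definition spanned :: "complex \<Rightarrow> complex \<Rightarrow> bool" where
  "spanned x y \<longleftrightarrow> (\<exists>u. y - (\<Sum>h\<le>t. \<Sum>d<D h. of_int (u h d) * E h x * (x - of_int m) ^ (D h - 1 - d)) \<in> pM x)"

lemma spanned_add:
  assumes "spanned x y" "spanned x z"
  shows "spanned x (y + z)"
proof -
  obtain u v where *:
    "y - (\<Sum>h\<le>t. \<Sum>d<D h. of_int (u h d) * E h x * (x - of_int m) ^ (D h - 1 - d)) \<in> pM x"
    "z - (\<Sum>h\<le>t. \<Sum>d<D h. of_int (v h d) * E h x * (x - of_int m) ^ (D h - 1 - d)) \<in> pM x"
    using assms unfolding spanned_def by blast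
  show ?thesis unfolding spanned_def
    by (rule exI[of _ "\<lambda>h d. u h d + v h d"])
       (use pM_add[OF *] in \<open>simp add: distrib_right sum.distrib algebra_simps\<close>)
qed

lemma spanned_if_mem_pM: "y \<in> pM x \<Longrightarrow> spanned x y"
  unfolding spanned_def by (rule exI[of _ "\<lambda>_ _. 0"]) simp

lemma spanned_generator:
  assumes x: "x ^ n = of_int m" and h: "h \<le> t"
  shows "spanned x (of_int j * E h x * (x - of_int m) ^ i)"
proof (cases "i < D h")
  case True
  define d0 where "d0 = D h - 1 - i"
  define u where "u h' d = (if h' = h then if d = d0 then j else 0 else 0)" for h' d
  have "(\<Sum>h'\<le>t. \<Sum>d<D h'. of_int (u h' d) * E h' x * (x - of_int m) ^ (D h' - 1 - d)) =
      (\<Sum>h'\<le>t. if h' = h then of_int j * E h x * (x - of_int m) ^ i else 0)"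
  proof (intro sum.cong refl)
    fix h'
    show "(\<Sum>d<D h'. of_int (u h' d) * E h' x * (x - of_int m) ^ (D h' - 1 - d)) =
        (if h' = h then of_int j * E h x * (x - of_int m) ^ i else 0)"
    proof (cases "h' = h")
      case True
      have "(\<Sum>d<D h. of_int (u h d) * E h x * (x - of_int m) ^ (D h - 1 - d)) =
          (\<Sum>d<D h. if d = d0 then of_int j * E h x * (x - of_int m) ^ i else 0)"
        using \<open>i < D h\<close> by (intro sum.cong) (auto simp: u_def d0_def)
      then show ?thesis using True \<open>i < D h\<close> by (simp add: d0_def)
    qed (simp add: u_def)
  qed
  also have "\<dots> = of_int j * E h x * (x - of_int m) ^ i" using h by simp
  finally show ?thesis unfolding spanned_def using pM_zero by (intro exI[of _ u]) simp
next
  case False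
  then have "E h x * (x - of_int m) ^ i * of_int j \<in> pM x"
    using subring_set.of_int[OF subring_Zadj] by (intro pM_mult[OF E_mult_power_mem_pM[OF x h]]) auto
  then show ?thesis by (intro spanned_if_mem_pM) (simp add: mult_ac)
qed

lemma spanned_sum: "(\<And>i. i \<in> A \<Longrightarrow> spanned x (f i)) \<Longrightarrow> spanned x (sum f A)"
  by (induction A rule: infinite_finite_induct) (auto intro: spanned_add spanned_if_mem_pM pM_zero)

lemma M_spanned:
  assumes x: "x ^ n = of_int m"
  shows "h \<le> t \<Longrightarrow> y \<in> M h x \<Longrightarrow> spanned x y"
proof (induction h arbitrary: y)
  have E: "spanned x (E h x * z)" if "h \<le> t" "z \<in> Zadj x" for h z
  proof -
    have "z \<in> Zadj (x - of_int m)" using that Zadj_shift by blast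
    then obtain g where "z = ipoly g (x - of_int m)" by (rule mem_ZadjE)
    then have "E h x * z = (\<Sum>i\<le>degree g. of_int (coeff g i) * E h x * (x - of_int m) ^ i)"
      by (simp add: ipoly_altdef sum_distrib_left mult_ac)
    then show ?thesis using spanned_generator[OF x \<open>h \<le> t\<close>] by (simp add: spanned_sum)
  qed
  {
    case 0
    then show ?case using E[of 0 y] by (simp add: E_0)
  next
    case (Suc h)
    then obtain u z where "y = u + E (Suc h) x * z" "u \<in> M h x" "z \<in> Zadj x" by auto
    then show ?case using Suc E[of "Suc h" z] by (simp add: spanned_add)
  }
qed

text \<open>Multiplying by \<open>(x - m) ^ d\<close> for the largest \<open>d\<close> that still matters leaves only the terms
  of top degree, to which the divisibility criterion applies.\<close>

lemma mem_M_if_prime_multiple: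
  assumes x: "x ^ n = of_int m" and z: "alg_int z" and pz: "of_nat p * z \<in> M t x"
  shows "z \<in> M t x"
proof -
  let ?\<delta> = "x - of_int m"
  obtain u where u: "of_nat p * z - (\<Sum>h\<le>t. \<Sum>d<D h. of_int (u h d) * E h x * ?\<delta> ^ (D h - 1 - d)) \<in> pM x"
    using M_spanned[OF x order.refl pz] unfolding spanned_def by blast
  define S where "S = (\<Sum>h\<le>t. \<Sum>d<D h. of_int (u h d) * E h x * ?\<delta> ^ (D h - 1 - d))"
  note u = u[folded S_def]
  have E_pM: "of_int j * E h x * ?\<delta> ^ i \<in> pM x" if hj: "h \<le> t" "int p dvd j" for h i j
  proof -
    obtain j' where "j = int p * j'" using hj(2) by blast
    moreover have "E h x * (?\<delta> ^ i * of_int j') \<in> M t x"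
      using hj(1) shift_power_mem_Zadj subring_set.of_int[OF subring_Zadj]
      by (intro E_mult_mem_M Zadj_mult) auto
    ultimately show ?thesis unfolding pM_def by (intro image_eqI) (auto simp: mult_ac)
  qed
  \<comment> \<open>Downward induction on \<open>d0\<close>, starting at \<open>n\<close> because no
    \<open>D h\<close> exceeds \<open>n\<close>.\<close>
  have dvd: "\<forall>h\<le>t. \<forall>d. d < D h \<longrightarrow> d \<ge> d0 \<longrightarrow> int p dvd u h d" if "d0 \<le> n" for d0
    using that
  proof (induction d0 rule: inc_induct)
    case base
    have "D h \<le> n" for h
    proof -
      have "D h \<le> q h" by (simp add: D_def)
      also have "\<dots> \<le> n" using q_antimono[of 0 h] by (simp add: q_0)
      finally show ?thesis .
    qed
    then show ?case by (meson leD order.trans)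
  next
    case (step d0)
    \<comment> \<open>After multiplication by \<open>?\<delta> ^ d0\<close>, indices
      \<open>d < d0\<close> pass the top degree and fall into \<open>pM x\<close>; indices
      \<open>d > d0\<close> have coefficients divisible by \<open>p\<close>. Blocks with
      \<open>D h \<le> d0\<close> have no index \<open>d0\<close>, hence the default 0.\<close>
    define v where "v h = (if d0 < D h then u h d0 else 0)" for h
    define T where "T = (\<Sum>h\<le>t. of_int (v h) * E h x * ?\<delta> ^ (D h - 1))"
    have inner: "(\<Sum>d<D h. of_int (u h d) * E h x * ?\<delta> ^ (D h - 1 - d)) * ?\<delta> ^ d0 -
        of_int (v h) * E h x * ?\<delta> ^ (D h - 1) \<in> pM x" (is "?A * _ - ?B \<in> _") if h: "h \<le> t" for h
    proof -
      let ?f = "\<lambda>d. of_int (u h d) * E h x * ?\<delta> ^ (D h - 1 - d + d0)"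
      have f: "?f d \<in> pM x" if "d < D h" "d \<noteq> d0" for d
      proof (cases "d < d0")
        case True
        then have "E h x * ?\<delta> ^ (D h - 1 - d + d0) * of_int (u h d) \<in> pM x"
          using that subring_set.of_int[OF subring_Zadj]
          by (intro pM_mult[OF E_mult_power_mem_pM[OF x h]]) auto
        then show ?thesis by (simp add: mult_ac)
      next
        case False
        then show ?thesis using step.IH h that by (intro E_pM) auto
      qed
      have A: "?A * ?\<delta> ^ d0 = (\<Sum>d<D h. ?f d)" by (simp only: sum_distrib_right mult.assoc power_add)
      have "?A * ?\<delta> ^ d0 - ?B = (\<Sum>d\<in>{..<D h} - {d0}. ?f d)"
      proof (cases "d0 < D h")
        case True
        then have B: "?f d0 = ?B" by (simp add: v_def)
        have "(\<Sum>d<D h. ?f d) = ?f d0 + (\<Sum>d\<in>{..<D h} - {d0}. ?f d)"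
          using True by (intro sum.remove) auto
        then show ?thesis unfolding A B by (simp only: add_diff_cancel_left')
      next
        case False
        then have "{..<D h} - {d0} = {..<D h}" by auto
        then show ?thesis unfolding A using False by (simp add: v_def)
      qed
      also have "\<dots> \<in> pM x" using f by (intro pM_sum) auto
      finally show ?thesis .
    qed
    have "(of_nat p * z - S) * ?\<delta> ^ d0 + (S * ?\<delta> ^ d0 - T) \<in> pM x"
    proof (rule pM_add)
      show "(of_nat p * z - S) * ?\<delta> ^ d0 \<in> pM x" using u shift_power_mem_Zadj by (rule pM_mult)
      have "S * ?\<delta> ^ d0 - T = (\<Sum>h\<le>t. (\<Sum>d<D h. of_int (u h d) * E h x * ?\<delta> ^ (D h - 1 - d)) * ?\<delta> ^ d0 -
          of_int (v h) * E h x * ?\<delta> ^ (D h - 1))"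
        unfolding S_def T_def by (simp only: sum_distrib_right[of _ "{..t}"] sum_subtractf)
      also have "\<dots> \<in> pM x" using inner by (intro pM_sum) auto
      finally show "S * ?\<delta> ^ d0 - T \<in> pM x" .
    qed
    also have "(of_nat p * z - S) * ?\<delta> ^ d0 + (S * ?\<delta> ^ d0 - T) = of_nat p * (z * ?\<delta> ^ d0) - T"
      by (simp add: algebra_simps)
    finally obtain y where y: "y \<in> M t x" "of_nat p * (z * ?\<delta> ^ d0) - T = of_nat p * y"
      by (auto simp: pM_def)
    then have T_eq: "T / of_nat p = z * ?\<delta> ^ d0 - y" using p_gt_0 by (simp add: field_simps)
    have "alg_int y" using y(1) M_subset_ring_of_ints[OF x order.refl] by (auto simp: ring_of_ints_def)
    moreover have "?\<delta> ^ d0 \<in> Collect alg_int"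
      using alg_int_root[OF x] by (intro alg_int.power alg_int.diff alg_int.of_int) simp
    ultimately have "z * ?\<delta> ^ d0 - y \<in> Collect alg_int" using z by (intro alg_int.diff alg_int.mult) auto
    then have v: "int p dvd v h" if "h \<le> t" for h
      using dvd_if_alg_int_sum[OF x _ that, of v] by (simp only: T_eq[unfolded T_def] mem_Collect_eq)
    show ?case
    proof (intro allI impI)
      fix h d assume "h \<le> t" "d < D h" "d0 \<le> d"
      then show "int p dvd u h d" using v[of h] step.IH by (cases "d = d0") (auto simp: v_def)
    qed
  qed
  have "S \<in> pM x" unfolding S_def using dvd[of 0] by (intro pM_sum E_pM) auto
  then have "(of_nat p * z - S) + S \<in> pM x" by (rule pM_add[OF u])
  then have "of_nat p * z \<in> pM x" by simp
  then show ?thesis using p_gt_0 by (auto simp: pM_def)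
qed

lemma mem_M_if_prime_power_multiple:
  assumes x: "x ^ n = of_int m" and z: "alg_int z"
  shows "of_nat p ^ j * z \<in> M t x \<Longrightarrow> z \<in> M t x"
proof (induction j)
  case (Suc j)
  have "alg_int (of_nat p ^ j * z)"
    using alg_int.mult[OF alg_int.power[OF alg_int.of_nat[of p]], of z j] z by simp
  then show ?case using Suc mem_M_if_prime_multiple[OF x] by (simp add: mult.assoc)
qed simp

text \<open>\<open>n * m = p ^ k * m\<close> annihilates the ring of integers modulo
  \<open>Zadj x\<close>. Saturation of \<open>M t x\<close> at \<open>p\<close> removes
  \<open>p ^ k\<close>, so \<open>m\<close> annihilates it modulo \<open>M t x\<close>, and that
  index is prime to \<open>p\<close>.\<close>

theorem multiplicity_ind:
  assumes x: "x ^ n = of_int m"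
  shows "multiplicity p (ind x) = (\<Sum>i<t. q (Suc i))"
proof -
  let ?O = "ring_of_ints x" and ?Z = "Zadj x" and ?M = "M t x"
  interpret O: subring_set ?O by (rule subring_ring_of_ints)
  interpret Z: subring_set ?Z by (rule subring_Zadj)
  have sub: "?M \<subseteq> ?O" "?Z \<subseteq> ?M"
    using M_subset_ring_of_ints[OF x order.refl] Zadj_subset_M by auto
  have fin: "finite (add_cosets ?O ?Z)" by (rule finite_add_cosets_ring_of_ints[OF x])
  have prod: "card (add_cosets ?O ?Z) = card (add_cosets ?O ?M) * card (add_cosets ?M ?Z)"
    using sub O.add_subgroup Z.add_subgroup add_subgroup_M by (intro card_add_cosets_mult)
  have "card (add_cosets ?O ?Z) > 0"
    using fin O.zero by (auto simp: card_gt_0_iff add_cosets_def)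
  then have fin': "finite (add_cosets ?O ?M)" using prod by (auto intro: card_ge_0_finite)
  have "of_nat (nat \<bar>m\<bar>) * z \<in> ?M" if z: "z \<in> ?O" for z
  proof -
    have "of_int m * z \<in> ?O" using z by (intro O.mult O.of_int)
    then have "alg_int (of_int m * z)" by (simp add: ring_of_ints_def)
    moreover have "of_nat p ^ k * (of_int m * z) \<in> ?M"
      using ring_of_ints_subset[OF x z] sub by (auto simp: n_def mult.assoc)
    ultimately have "of_int m * z \<in> ?M" by (rule mem_M_if_prime_power_multiple[OF x])
    then show ?thesis using add_subgroup_uminus[OF add_subgroup_M] by (auto simp: abs_if)
  qed
  moreover have "\<not> p dvd nat \<bar>m\<bar>" using p_not_dvd by (simp add: nat_dvd_iff flip: int_dvd_int_iff) 
  ultimately have coprime: "\<not> p dvd card (add_cosets ?O ?M)"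
    using fin' sub O.add_subgroup add_subgroup_M prime_p by (intro prime_not_dvd_card_add_cosets)
  have "ind x = card (add_cosets ?O ?Z)"
    by (simp add: ind_def add_cosets_def)
  also have "\<dots> = p ^ (\<Sum>i<t. q (Suc i)) * card (add_cosets ?O ?M)"
    using card_add_cosets_M[OF x order.refl] prod by simp
  finally show ?thesis
    using coprime p_gt_0 p_gt_1 by (intro multiplicity_eqI) (auto simp: mult.commute)
qed

end

theorem theorem3p6:
  fixes m :: int and p k :: nat and \<alpha> :: complex
  assumes "squarefree m" and "m \<noteq> 1" and "m \<noteq> -1"
    and "prime p" and "\<not> int p dvd m" and "k > 0"
    and "\<alpha> ^ (p ^ k) = of_int m"
  defines "s \<equiv> multiplicity (int p) (m ^ p - m) - 1"
  shows "(s \<le> k \<longrightarrow> real (ind_p p \<alpha>) = (real p ^ k - real p ^ (k - s)) / (real p - 1)) \<and>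
         (k < s \<longrightarrow> real (ind_p p \<alpha>) = (real p ^ k - 1) / (real p - 1))"
proof -
  have p: "p > 1" using prime_gt_1_nat[OF \<open>prime p\<close>] .
  have "m \<noteq> 0" using \<open>\<not> int p dvd m\<close> by auto
  then have "nat \<bar>m\<bar> \<noteq> 1" using \<open>m \<noteq> 1\<close> \<open>m \<noteq> -1\<close> by auto
  \<comment> \<open>Any prime factor of \<open>m\<close> serves, since \<open>m\<close> is
    squarefree.\<close>
  then obtain l where l: "prime l" "l dvd nat \<bar>m\<bar>" using prime_factor_nat by blast
  then have l_dvd: "int l dvd m" by simp
  have l_square: "\<not> int l ^ 2 dvd m"
  proof
    assume "int l ^ 2 dvd m"
    then have "int l dvd 1" using squarefreeD[OF \<open>squarefree m\<close>] by blast
    then show False using l by simp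
  qed
  let ?v = "multiplicity (int p) (m ^ p - m)"
  have "m ^ p - m \<noteq> 0"
  proof
    assume "m ^ p - m = 0"
    then have "m * (m ^ (p - 1) - 1) = 0"
      using p by (simp add: right_diff_distrib flip: power_Suc)
    then have "\<bar>m\<bar> ^ (p - 1) = 1" using \<open>m \<noteq> 0\<close> by (simp flip: power_abs)
    moreover have "1 < \<bar>m\<bar> ^ (p - 1)"
      using \<open>m \<noteq> 0\<close> \<open>m \<noteq> 1\<close> \<open>m \<noteq> -1\<close> p by (intro one_less_power) auto
    ultimately show False by simp
  qed
  have "\<not> is_unit (int p)" using p by simp
  \<comment> \<open>Positive by Fermat, so the subtraction in \<open>s\<close> is not
    truncated.\<close>
  have v_pos: "?v > 0"
    using fermat_int[OF \<open>prime p\<close>, of m] \<open>m ^ p - m \<noteq> 0\<close> \<open>\<not> is_unit (int p)\<close>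
    by (simp add: multiplicity_gt_zero_iff)
  have v: "int p ^ ?v dvd m ^ p - m" "\<not> int p ^ Suc ?v dvd m ^ p - m"
    using multiplicity_dvd[of "int p" "m ^ p - m"] \<open>m ^ p - m \<noteq> 0\<close> \<open>\<not> is_unit (int p)\<close>
    by (auto simp: power_dvd_iff_le_multiplicity simp del: power_Suc)
  have diff: "int p ^ Suc ?v dvd (m ^ (p ^ k) - m) - (m ^ p - m)"
    by (rule prime_power_dvd_iterated_diff[OF v(1) v_pos \<open>k > 0\<close>])
  have "Suc s = ?v" using v_pos by (simp add: s_def)
  interpret pure_prime_power m l "p ^ k" p k s "min s k"
  proof
    show "int p ^ (s + 1) dvd m ^ (p ^ k) - m"
      using dvd_add[OF dvd_trans[OF le_imp_power_dvd[of ?v "Suc ?v"] diff] v(1)] \<open>Suc s = ?v\<close>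
      by simp
    show "\<not> int p ^ (s + 2) dvd m ^ (p ^ k) - m"
    proof
      assume "int p ^ (s + 2) dvd m ^ (p ^ k) - m"
      moreover have "s + 2 = Suc ?v" using \<open>Suc s = ?v\<close> by simp
      ultimately have "int p ^ Suc ?v dvd m ^ (p ^ k) - m" by (simp only:)
      from dvd_diff[OF this diff] show False using v(2) by simp
    qed
  qed (use p l l_dvd l_square assms in auto)
  \<comment> \<open>\<open>min s k\<close> merges both cases; for \<open>k < s\<close> the exponent
    \<open>k - min s k\<close> is 0, which gives the 1 in the second formula.\<close>
  have "real (ind_p p \<alpha>) = real (\<Sum>i<min s k. p ^ (k - Suc i))"
    using multiplicity_ind[OF \<open>\<alpha> ^ (p ^ k) = of_int m\<close>] by (simp add: ind_p_def q_def)
  also have "\<dots> = (real p ^ k - real p ^ (k - min s k)) / (real p - 1)"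
    using p by (intro prime_power_sum) auto
  finally show ?thesis by (auto simp: min_def)
qed

end
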